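(* Let $\mathcal G=(\mathrm V,\mathrm E)$ be a locally finite connected metric graph, and let $A:\mathcal G\to\mathbb R$ and $V:\mathcal G\to[1,+\infty)$ satisfy $A\in L^2_{\rm loc}(\mathcal G,\mathbb R)$ and $V\in L^1_{\rm loc}(\mathcal G,\mathbb R)$. Then $H^1_A(\mathcal G,\mathbb C)$ is a separable Hilbert space.
   Context: Each bounded edge $e$ is identified with $I_e=[0,\ell_e]$, $\ell_e>0$, each unbounded edge with $I_e=[0,+\infty)$; $\mathcal G$ carries the shortest-path metric. A connected metric graph is locally finite if $\mathrm E$ is at most countable and every bounded subset of $\mathcal G$ intersects at most finitely many edges. Functions $u:\mathcal G\to\mathbb C$ are identified with families $(u_e)_{e\in\mathrm E}$, $u_e:I_e\to\mathbb C$. $L^2(\mathcal G,\mathbb C)$ is the complex Hilbert space of families $(u_e)$ with $u_e\in L^2(I_e,\mathbb C)$ and $\sum_e\|u_e\|^2_{L^2(I_e)}<+\infty$. $A\in L^2_{\rm loc}$, $V\in L^1_{\rm loc}$ mean $A\in L^2(B)$, $V\in L^1(B)$ for every bounded $B\subset\mathcal G$. $D_A=\frac1i\frac{d}{dx}-A(x)$ (edgewise, weak derivative) and $H^1_A(\mathcal G,\mathbb C)=\{u\in C(\mathcal G,\mathbb C): D_Au\in L^2(\mathcal G,\mathbb C),\ \int_{\mathcal G}V(x)|u|^2dx<+\infty\}$, equipped with the complex inner product $(u,v)=\int_{\mathcal G}(D_Au\overline{D_Av}+V(x)u\bar v)\,dx$. *)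

theory Defs
  imports "HOL-Analysis.Analysis" "HOL-Library.Function_Algebras"
begin

section \<open>Metric graphs\<close>

text \<open>
  Loops and multiple edges are allowed. An edge \<open>e\<close> is unbounded iff \<open>len G e = \<infinity>\<close>; it is then
  attached to the graph at \<open>src G e\<close> only, and \<open>tgt G e\<close> has no meaning.
\<close>

record ('v, 'e) metric_graph =
  verts :: "'v set"
  edges :: "'e set"
  src :: "'e \<Rightarrow> 'v"
  tgt :: "'e \<Rightarrow> 'v"
  len :: "'e \<Rightarrow> ereal"

definition bounded_edges :: "('v, 'e) metric_graph \<Rightarrow> 'e set" where
  "bounded_edges G = {e \<in> edges G. len G e < \<infinity>}"

definition wf_metric_graph :: "('v, 'e) metric_graph \<Rightarrow> bool" where
  "wf_metric_graph G \<longleftrightarrow>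
     (\<forall>e\<in>edges G. 0 < len G e \<and> src G e \<in> verts G) \<and>
     (\<forall>e\<in>bounded_edges G. tgt G e \<in> verts G)"

definition connected_metric_graph :: "('v, 'e) metric_graph \<Rightarrow> bool" where
  "connected_metric_graph G \<longleftrightarrow>
     (let R = {(src G e, tgt G e) | e. e \<in> bounded_edges G}
      in \<forall>v\<in>verts G. \<forall>w\<in>verts G. (v, w) \<in> (R \<union> R\<inverse>)\<^sup>*)"

definition edge_interval :: "('v, 'e) metric_graph \<Rightarrow> 'e \<Rightarrow> real set" where
  "edge_interval G e = {x. 0 \<le> x \<and> ereal x \<le> len G e}"

datatype ('v, 'e) point = Vertex 'v | Interior 'e real

text \<open>
  The point of the graph with coordinate \<open>x\<close> on the edge \<open>e\<close>; this realises the gluing of the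
  intervals at their end points.
\<close>

definition edge_point :: "('v, 'e) metric_graph \<Rightarrow> 'e \<Rightarrow> real \<Rightarrow> ('v, 'e) point" where
  "edge_point G e x =
     (if x = 0 then Vertex (src G e)
      else if ereal x = len G e then Vertex (tgt G e)
      else Interior e x)"

text \<open>
  As functions on the graph are families indexed by the edges, the graph is the union of its edges.
  For a connected graph with at least one edge this contains every vertex; the only connected
  graphs for which it does not are the one-vertex graphs without edges.
\<close>

definition graph_points :: "('v, 'e) metric_graph \<Rightarrow> ('v, 'e) point set" where
  "graph_points G = (\<Union>e\<in>edges G. edge_point G e ` edge_interval G e)"

text \<open>\<open>is_path_length G p q L\<close>: some path made of finitely many edge segments leads from \<open>p\<close> to
  \<open>q\<close> and has length \<open>L\<close>.\<close>

inductive is_path_length ::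
    "('v, 'e) metric_graph \<Rightarrow> ('v, 'e) point \<Rightarrow> ('v, 'e) point \<Rightarrow> real \<Rightarrow> bool"
  for G where
  refl: "p \<in> graph_points G \<Longrightarrow> is_path_length G p p 0"
| step: "\<lbrakk>e \<in> edges G; x \<in> edge_interval G e; y \<in> edge_interval G e;
          is_path_length G (edge_point G e y) q L\<rbrakk>
         \<Longrightarrow> is_path_length G (edge_point G e x) q (\<bar>x - y\<bar> + L)"

text \<open>The value outside the graph is irrelevant; \<open>0\<close> is chosen because the locale
  \<open>Metric_space\<close> requires nonnegativity and symmetry on the whole type.\<close>

definition graph_dist ::
    "('v, 'e) metric_graph \<Rightarrow> ('v, 'e) point \<Rightarrow> ('v, 'e) point \<Rightarrow> real" where
  "graph_dist G p q =
     (if p \<in> graph_points G \<and> q \<in> graph_points G then Inf {L. is_path_length G p q L} else 0)"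

text \<open>Boundedness is spelled out rather than taken from \<open>Metric_space\<close> because \<open>graph_dist\<close> need
  not separate points before local finiteness is known.\<close>

definition graph_bounded :: "('v, 'e) metric_graph \<Rightarrow> ('v, 'e) point set \<Rightarrow> bool" where
  "graph_bounded G B \<longleftrightarrow>
     B \<subseteq> graph_points G \<and> (\<exists>r. \<forall>p\<in>B. \<forall>q\<in>B. graph_dist G p q \<le> r)"

definition edge_part :: "('v, 'e) metric_graph \<Rightarrow> ('v, 'e) point set \<Rightarrow> 'e \<Rightarrow> real set" where
  "edge_part G B e = {x \<in> edge_interval G e. edge_point G e x \<in> B}"

definition locally_finite_graph :: "('v, 'e) metric_graph \<Rightarrow> bool" where
  "locally_finite_graph G \<longleftrightarrow>
     countable (edges G) \<and>
     (\<forall>B. graph_bounded G B \<longrightarrow> finite {e \<in> edges G. edge_part G B e \<noteq> {}})"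

definition graph_topology :: "('v, 'e) metric_graph \<Rightarrow> ('v, 'e) point topology" where
  "graph_topology G = Metric_space.mtopology (graph_points G) (graph_dist G)"


section \<open>Integration on a metric graph\<close>

text \<open>The family \<open>(u\<^sub>e)\<close> of a function on the graph.\<close>

definition on_edge ::
    "('v, 'e) metric_graph \<Rightarrow> (('v, 'e) point \<Rightarrow> 'b) \<Rightarrow> 'e \<Rightarrow> real \<Rightarrow> 'b" where
  "on_edge G u e x = u (edge_point G e x)"

definition graph_measurable_set :: "('v, 'e) metric_graph \<Rightarrow> ('v, 'e) point set \<Rightarrow> bool" where
  "graph_measurable_set G B \<longleftrightarrow>
     B \<subseteq> graph_points G \<and> (\<forall>e\<in>edges G. edge_part G B e \<in> sets lebesgue)"

text \<open>\<open>f \<in> L\<^sup>1(B)\<close>, for a family \<open>f\<close> of functions on the edges.\<close>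

definition graph_integrable ::
    "('v, 'e) metric_graph \<Rightarrow> ('v, 'e) point set
       \<Rightarrow> ('e \<Rightarrow> real \<Rightarrow> 'b::{banach, second_countable_topology}) \<Rightarrow> bool" where
  "graph_integrable G B f \<longleftrightarrow>
     (\<forall>e\<in>edges G. set_integrable lebesgue (edge_part G B e) (f e)) \<and>
     (\<lambda>e. LINT x:edge_part G B e|lebesgue. norm (f e x)) summable_on edges G"

definition graph_integral ::
    "('v, 'e) metric_graph \<Rightarrow> ('e \<Rightarrow> real \<Rightarrow> 'b::{banach, second_countable_topology}) \<Rightarrow> 'b" where
  "graph_integral G f =
     (\<Sum>\<^sub>\<infinity>e\<in>edges G. LINT x:edge_interval G e|lebesgue. f e x)"

text \<open>\<open>f \<in> L\<^sup>2(B)\<close>\<close>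

definition graph_square_integrable ::
    "('v, 'e) metric_graph \<Rightarrow> ('v, 'e) point set
       \<Rightarrow> ('e \<Rightarrow> real \<Rightarrow> 'b::{banach, second_countable_topology}) \<Rightarrow> bool" where
  "graph_square_integrable G B f \<longleftrightarrow>
     (\<forall>e\<in>edges G. set_borel_measurable lebesgue (edge_part G B e) (f e)) \<and>
     graph_integrable G B (\<lambda>e x. (norm (f e x))\<^sup>2)"

definition L1_loc :: "('v, 'e) metric_graph \<Rightarrow> (('v, 'e) point \<Rightarrow> real) \<Rightarrow> bool" where
  "L1_loc G V \<longleftrightarrow>
     (\<forall>B. graph_bounded G B \<and> graph_measurable_set G B \<longrightarrow> graph_integrable G B (on_edge G V))"

definition L2_loc :: "('v, 'e) metric_graph \<Rightarrow> (('v, 'e) point \<Rightarrow> real) \<Rightarrow> bool" where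
  "L2_loc G A \<longleftrightarrow>
     (\<forall>B. graph_bounded G B \<and> graph_measurable_set G B \<longrightarrow>
        graph_square_integrable G B (on_edge G A))"


section \<open>Weak derivatives on an open subset of the line\<close>

definition test_function :: "real set \<Rightarrow> (real \<Rightarrow> real) \<Rightarrow> bool" where
  "test_function S \<phi> \<longleftrightarrow>
     (\<forall>n. (deriv ^^ n) \<phi> differentiable_on UNIV) \<and>
     (\<exists>K. compact K \<and> K \<subseteq> S \<and> (\<forall>x. x \<notin> K \<longrightarrow> \<phi> x = 0))"

definition locally_integrable_on :: "real set \<Rightarrow> (real \<Rightarrow> complex) \<Rightarrow> bool" where
  "locally_integrable_on S f \<longleftrightarrow> (\<forall>K. compact K \<and> K \<subseteq> S \<longrightarrow> set_integrable lebesgue K f)"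

definition has_weak_deriv :: "real set \<Rightarrow> (real \<Rightarrow> complex) \<Rightarrow> (real \<Rightarrow> complex) \<Rightarrow> bool" where
  "has_weak_deriv S f g \<longleftrightarrow>
     locally_integrable_on S f \<and> locally_integrable_on S g \<and>
     (\<forall>\<phi>. test_function S \<phi> \<longrightarrow>
        (LINT x:S|lebesgue. f x * complex_of_real (deriv \<phi> x)) =
        - (LINT x:S|lebesgue. g x * complex_of_real (\<phi> x)))"

definition weakly_differentiable :: "real set \<Rightarrow> (real \<Rightarrow> complex) \<Rightarrow> bool" where
  "weakly_differentiable S f \<longleftrightarrow> (\<exists>g. has_weak_deriv S f g)"

text \<open>A representative; weak derivatives are unique only almost everywhere.\<close>

definition weak_deriv :: "real set \<Rightarrow> (real \<Rightarrow> complex) \<Rightarrow> real \<Rightarrow> complex" where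
  "weak_deriv S f = (SOME g. has_weak_deriv S f g)"


section \<open>The magnetic Sobolev space\<close>

definition magnetic_deriv ::
    "('v, 'e) metric_graph \<Rightarrow> (('v, 'e) point \<Rightarrow> real) \<Rightarrow> (('v, 'e) point \<Rightarrow> complex)
       \<Rightarrow> 'e \<Rightarrow> real \<Rightarrow> complex" where
  "magnetic_deriv G A u e x =
     1 / \<i> * weak_deriv (interior (edge_interval G e)) (on_edge G u e) x
       - complex_of_real (on_edge G A e x) * on_edge G u e x"

text \<open>
  Elements vanish outside the graph, so that functions on the graph have unique representatives on
  the type of points. For continuous \<open>u\<close> and \<open>A \<in> L\<^sup>2_loc\<close> the product \<open>A u\<close> is locally integrable,
  so that the distribution \<open>D\<^sub>A u\<close> is a locally integrable function iff \<open>u\<close> is weakly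
  differentiable.
\<close>

definition H1A ::
    "('v, 'e) metric_graph \<Rightarrow> (('v, 'e) point \<Rightarrow> real) \<Rightarrow> (('v, 'e) point \<Rightarrow> real)
       \<Rightarrow> (('v, 'e) point \<Rightarrow> complex) set" where
  "H1A G A V = {u.
     (\<forall>p. p \<notin> graph_points G \<longrightarrow> u p = 0) \<and>
     continuous_map (graph_topology G) euclidean u \<and>
     (\<forall>e\<in>edges G. weakly_differentiable (interior (edge_interval G e)) (on_edge G u e)) \<and>
     graph_square_integrable G (graph_points G) (magnetic_deriv G A u) \<and>
     graph_integrable G (graph_points G) (\<lambda>e x. on_edge G V e x * (cmod (on_edge G u e x))\<^sup>2)}"

definition H1A_inner ::
    "('v, 'e) metric_graph \<Rightarrow> (('v, 'e) point \<Rightarrow> real) \<Rightarrow> (('v, 'e) point \<Rightarrow> real)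
       \<Rightarrow> (('v, 'e) point \<Rightarrow> complex) \<Rightarrow> (('v, 'e) point \<Rightarrow> complex) \<Rightarrow> complex" where
  "H1A_inner G A V u v =
     graph_integral G (\<lambda>e x.
       magnetic_deriv G A u e x * cnj (magnetic_deriv G A v e x) +
       complex_of_real (on_edge G V e x) * on_edge G u e x * cnj (on_edge G v e x))"


section \<open>Complex Hilbert spaces\<close>

text \<open>
  An inner product, linear in the first argument, on a linear subspace \<open>H\<close> of a complex vector
  space (with arbitrary values outside \<open>H\<close>).
\<close>

locale complex_inner_product_space = vector_space scale
  for scale :: "complex \<Rightarrow> 'a::ab_group_add \<Rightarrow> 'a" +
  fixes H :: "'a set" and ip :: "'a \<Rightarrow> 'a \<Rightarrow> complex"
  assumes subspace_H: "subspace H"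
    and ip_add: "\<lbrakk>u \<in> H; v \<in> H; w \<in> H\<rbrakk> \<Longrightarrow> ip (u + v) w = ip u w + ip v w"
    and ip_scale: "\<lbrakk>u \<in> H; v \<in> H\<rbrakk> \<Longrightarrow> ip (scale c u) v = c * ip u v"
    and ip_commute: "\<lbrakk>u \<in> H; v \<in> H\<rbrakk> \<Longrightarrow> ip u v = cnj (ip v u)"
    and ip_nonneg: "u \<in> H \<Longrightarrow> 0 \<le> Re (ip u u)"
    and ip_definite: "\<lbrakk>u \<in> H; ip u u = 0\<rbrakk> \<Longrightarrow> u = 0"
begin

definition ip_dist :: "'a \<Rightarrow> 'a \<Rightarrow> real" where
  "ip_dist u v = (if u \<in> H \<and> v \<in> H then sqrt (Re (ip (u - v) (u - v))) else 0)"

lemma ip_real: "u \<in> H \<Longrightarrow> ip u u = complex_of_real (Re (ip u u))"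
  using ip_commute[of u u] by (simp add: complex_eq_iff)

lemma Re_ip_expand:
  assumes "u \<in> H" "v \<in> H"
  shows "Re (ip (u + scale (complex_of_real t) v) (u + scale (complex_of_real t) v))
       = Re (ip u u) + 2 * t * Re (ip u v) + t\<^sup>2 * Re (ip v v)"
proof -
  let ?c = "complex_of_real t"
  have s: "scale ?c v \<in> H" and us: "u + scale ?c v \<in> H"
    using assms subspace_H by (auto simp: subspace_def)
  have *: "Re (ip w (u + scale ?c v)) = Re (ip w u) + t * Re (ip w v)" if "w \<in> H" for w
  proof -
    have "ip w (u + scale ?c v) = cnj (ip (u + scale ?c v) w)"
      by (rule ip_commute) (use that us in auto)
    also have "\<dots> = cnj (ip u w) + ?c * cnj (ip v w)"
      using that assms s by (simp add: ip_add ip_scale)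
    also have "\<dots> = ip w u + ?c * ip w v"
      using that assms by (metis ip_commute)
    finally show ?thesis by simp
  qed
  have "Re (ip v u) = Re (ip u v)"
    using ip_commute[of u v] assms by simp
  then show ?thesis
    using assms s us by (simp add: ip_add ip_scale * power2_eq_square algebra_simps)
qed

lemma Re_ip_le:
  assumes "u \<in> H" "v \<in> H"
  shows "Re (ip u v) \<le> sqrt (Re (ip u u)) * sqrt (Re (ip v v))"
proof (cases "Re (ip v v) = 0")
  case True
  then have "v = 0" using assms ip_definite ip_real by (metis of_real_0)
  then have "ip v u = 0"
    using ip_scale[of v u 0] assms by simp
  then show ?thesis using ip_commute[of u v] assms True by simp
next
  case False
  let ?a = "Re (ip u u)" and ?b = "Re (ip u v)" and ?c = "Re (ip v v)"
  have c: "?c > 0" using False ip_nonneg assms by (simp add: order_less_le)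
  let ?t = "- ?b / ?c"
  have "u + scale (complex_of_real ?t) v \<in> H"
    by (intro subspace_add subspace_scale subspace_H assms)
  then have "0 \<le> ?a + 2 * ?t * ?b + ?t\<^sup>2 * ?c"
    using ip_nonneg Re_ip_expand[OF assms, of ?t] by metis
  also have "\<dots> = ?a - ?b\<^sup>2 / ?c"
    using c by (simp add: power2_eq_square)
  finally have "?b\<^sup>2 \<le> ?a * ?c"
    using c by (simp add: field_simps)
  then have "?b \<le> sqrt (?a * ?c)"
    by (rule real_le_rsqrt)
  then show ?thesis by (simp add: real_sqrt_mult)
qed

lemma ip_norm_triangle:
  assumes "u \<in> H" "v \<in> H"
  shows "sqrt (Re (ip (u + v) (u + v))) \<le> sqrt (Re (ip u u)) + sqrt (Re (ip v v))"
proof (rule real_le_lsqrt)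
  have "Re (ip (u + v) (u + v)) = Re (ip u u) + 2 * Re (ip u v) + Re (ip v v)"
    using Re_ip_expand[OF assms, of 1] by simp
  also have "\<dots> \<le> Re (ip u u) + 2 * (sqrt (Re (ip u u)) * sqrt (Re (ip v v))) + Re (ip v v)"
    using Re_ip_le[OF assms] by simp
  also have "\<dots> = (sqrt (Re (ip u u)) + sqrt (Re (ip v v)))\<^sup>2"
    using ip_nonneg assms by (simp add: power2_sum)
  finally show "Re (ip (u + v) (u + v)) \<le> (sqrt (Re (ip u u)) + sqrt (Re (ip v v)))\<^sup>2" .
qed (use ip_nonneg assms in auto)

sublocale Metric_space H ip_dist
proof
  have diff: "u - v \<in> H" if "u \<in> H" "v \<in> H" for u v
    using that subspace_H by (rule_tac subspace_diff)
  show "0 \<le> ip_dist u v" for u v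
    using diff ip_nonneg by (simp add: ip_dist_def)
  show "ip_dist u v = ip_dist v u" for u v
  proof (cases "u \<in> H \<and> v \<in> H")
    case True
    have "v - u = 0 + scale (complex_of_real (- 1)) (u - v)"
      by simp
    moreover have "0 \<in> H" using subspace_H by (rule subspace_0)
    moreover have "ip 0 w = 0" if "w \<in> H" for w
      using ip_scale[of w w 0] that by simp
    ultimately have "Re (ip (v - u) (v - u)) = Re (ip (u - v) (u - v))"
      using Re_ip_expand[of 0 "u - v" "- 1"] diff True by simp
    then show ?thesis by (simp add: ip_dist_def True)
  qed (auto simp: ip_dist_def)
  show "ip_dist u v = 0 \<longleftrightarrow> u = v" if "u \<in> H" "v \<in> H" for u v
  proof
    assume "ip_dist u v = 0"
    then have "ip (u - v) (u - v) = 0"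
      using that diff ip_real by (metis ip_dist_def of_real_0 real_sqrt_eq_zero_cancel_iff)
    then show "u = v" using ip_definite diff that by fastforce
  next
    assume "u = v"
    moreover have "ip 0 0 = 0"
      using ip_scale[of 0 0 0] subspace_0[OF subspace_H] by simp
    ultimately show "ip_dist u v = 0" by (simp add: ip_dist_def)
  qed
  show "ip_dist u w \<le> ip_dist u v + ip_dist v w" if "u \<in> H" "v \<in> H" "w \<in> H" for u v w
    using ip_norm_triangle[of "u - v" "v - w"] diff that by (simp add: ip_dist_def)
qed

end

locale complex_hilbert_space = complex_inner_product_space +
  assumes complete: "mcomplete"

locale separable_complex_hilbert_space = complex_hilbert_space +
  assumes separable: "separable_space mtopology"

end

theory Submission
  imports Defs
begin

text \<open>
  On an edge, the weak derivative of \<open>u\<close> is \<open>\<i> (D\<^sub>A u + A u)\<close>, with \<open>D\<^sub>A u\<close> and \<open>u\<close> square integrable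
  (as \<open>V \<ge> 1\<close>) and \<open>A\<close> square integrable on bounded sets. A continuous function is the integral of its
  weak derivative (\<open>weak_deriv_FTC\<close>), so by Cauchy--Schwarz the oscillation of \<open>u\<close> on a bounded piece of
  an edge is at most a constant times the norm of \<open>u\<close>, and so is the mean of \<open>\<bar>u\<bar>\<close>. Hence \<open>\<bar>u\<bar>\<close> itself
  is bounded there by a constant times the norm (\<open>pointwise_bound_on_interval\<close>). A bounded set meets only
  finitely many edges, each in a bounded piece, so convergence in the norm implies uniform convergence on
  bounded sets (\<open>evaluation_bounded_on_bounded_sets\<close>). This one estimate drives the whole proof.

  Definiteness: a function of norm zero vanishes at every point. That the space is a linear space,
  and that its inner product is well defined, rests on the uniqueness almost everywhere of weak
  derivatives (\<open>weak_deriv_unique\<close>), because \<open>D\<^sub>A u\<close> is computed from an arbitrary representative.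

  Completeness (\<open>limit_in_H1\<close>): a sequence that is Cauchy fast enough converges uniformly on bounded sets
  to a continuous \<open>u\<close>, while its magnetic derivatives converge almost everywhere to some \<open>d\<close>. Fatou's lemma
  turns the Cauchy property into square integrability of \<open>d\<close> and of \<open>\<surd>V u\<close> and into convergence
  in norm; passing to the limit in the definition of the weak derivative gives \<open>D\<^sub>A u = d\<close>.

  Separability: the values of a continuous function at the countably many points with rational
  coordinates determine it, and every such evaluation is a bounded functional. In a Hilbert
  space, a countable family of bounded functionals that separates points forces separability:
  a nonzero vector orthogonal to the kernel can be chosen for each nonzero functional, and the closed
  span of these countably many vectors must be everything, since a vector orthogonal to all of them is
  annihilated by all the functionals (\<open>separable_if_separating_functionals\<close>).

  Sums of integrals over the edges are treated as integrals for one measure, the product of the counting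
  measure on the edges with Lebesgue measure.
\<close>


section \<open>Smooth cut-off functions\<close>

text \<open>
  The derivative of one of these functions is a linear combination of two others, so the family contains, up to
  linear combinations, all derivatives of \<open>exp (- 1/x)\<close> extended by zero.
\<close>

definition flat :: "nat \<Rightarrow> real \<Rightarrow> real" where
  "flat k x = (if x > 0 then (1 / x) ^ k * exp (- (1 / x)) else 0)"

lemma flat_tendsto_0: "(flat k \<longlongrightarrow> 0) (at 0)"
proof -
  have "((\<lambda>t::real. t ^ k / exp t) \<longlongrightarrow> 0) at_top"
    by (rule tendsto_power_div_exp_0)
  moreover have "filterlim (\<lambda>x::real. 1 / x) at_top (at_right 0)"
    using filterlim_inverse_at_top_right by (simp add: inverse_eq_divide)
  ultimately have "((\<lambda>x::real. (1 / x) ^ k / exp (1 / x)) \<longlongrightarrow> 0) (at_right 0)"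
    by (rule filterlim_compose)
  then have "(flat k \<longlongrightarrow> 0) (at_right 0)"
    by (rule Lim_transform_eventually)
       (auto simp: eventually_at_right_field flat_def exp_minus field_simps intro!: exI[of _ 1])
  moreover have "(flat k \<longlongrightarrow> 0) (at_left 0)"
    by (rule tendsto_eventually) (auto simp: eventually_at_left_field flat_def intro!: exI[of _ "-1"])
  ultimately show ?thesis by (simp add: filterlim_at_split)
qed

lemma flat_has_derivative:
  "(flat k has_real_derivative (- real k * flat (k + 1) x + flat (k + 2) x)) (at x)"
proof -
  consider "x > 0" | "x = 0" | "x < 0" by linarith
  then show ?thesis
  proof cases
    case 1
    define y where "y = 1 / x"
    have "((\<lambda>x. 1 / x) has_real_derivative - (y ^ 2)) (at x)"
      using 1 by (auto intro!: derivative_eq_intros simp: power2_eq_square y_def)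
    moreover have "((\<lambda>x. h x ^ k * exp (- h x)) has_real_derivative
        (real k * (h' * h x ^ (k - 1))) * exp (- h x) + (exp (- h x) * (- h')) * h x ^ k) (at x)"
      if "(h has_real_derivative h') (at x)" for h h'
      using that by (auto intro!: derivative_eq_intros)
    ultimately have "((\<lambda>x. (1 / x) ^ k * exp (- (1 / x))) has_real_derivative
        (real k * (- (y ^ 2) * y ^ (k - 1))) * exp (- y) + (exp (- y) * y ^ 2) * y ^ k) (at x)"
      unfolding y_def by fastforce
    also have "(real k * (- (y ^ 2) * y ^ (k - 1))) * exp (- y) + (exp (- y) * y ^ 2) * y ^ k
        = - real k * flat (k + 1) x + flat (k + 2) x"
      using 1 by (cases k) (simp_all add: flat_def power2_eq_square algebra_simps flip: y_def)
    finally have "((\<lambda>x. (1 / x) ^ k * exp (- (1 / x))) has_real_derivative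
        (- real k * flat (k + 1) x + flat (k + 2) x)) (at x)" .
    then show ?thesis
      by (rule has_field_derivative_transform_within_open[where S="{0<..}"]) (use 1 in \<open>auto simp: flat_def\<close>)
  next
    case 2
    have "((\<lambda>h. (flat k (0 + h) - flat k 0) / h) \<longlongrightarrow> 0) (at 0)"
      using flat_tendsto_0[of "k + 1"]
      by (rule Lim_transform_eventually) (auto simp: flat_def eventually_at_filter)
    then show ?thesis using 2 by (simp add: DERIV_def flat_def)
  next
    case 3
    have "((\<lambda>x. 0) has_real_derivative 0) (at x)" by simp
    then have "(flat k has_real_derivative 0) (at x)"
      by (rule has_field_derivative_transform_within_open[where S="{..<0}"]) (use 3 in \<open>auto simp: flat_def\<close>)
    then show ?thesis using 3 by (simp add: flat_def)
  qed
qed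

text \<open>
  An algebra of functions that is closed under differentiation: its members are therefore smooth, and no
  formula for their higher derivatives is needed. Reciprocals are included for the quotient
  that defines the smooth step below.
\<close>

inductive_set smooth_alg :: "(real \<Rightarrow> real) set" where
  flat: "(\<lambda>x. flat k (a * x + b)) \<in> smooth_alg"
| const: "(\<lambda>_. c) \<in> smooth_alg"
| add: "f \<in> smooth_alg \<Longrightarrow> g \<in> smooth_alg \<Longrightarrow> (\<lambda>x. f x + g x) \<in> smooth_alg"
| mult: "f \<in> smooth_alg \<Longrightarrow> g \<in> smooth_alg \<Longrightarrow> (\<lambda>x. f x * g x) \<in> smooth_alg"
| inverse: "f \<in> smooth_alg \<Longrightarrow> (\<And>x. f x \<noteq> 0) \<Longrightarrow> (\<lambda>x. inverse (f x)) \<in> smooth_alg"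

lemma smooth_alg_affine:
  "f \<in> smooth_alg \<Longrightarrow> (\<lambda>x. f (a * x + b)) \<in> smooth_alg"
proof (induction rule: smooth_alg.induct)
  case (flat k c d)
  have "(\<lambda>x. flat k ((c * a) * x + (c * b + d))) \<in> smooth_alg" by (rule smooth_alg.flat)
  then show ?case by (simp add: algebra_simps)
qed (auto intro: smooth_alg.intros)

lemma smooth_alg_deriv:
  "f \<in> smooth_alg \<Longrightarrow> \<exists>f'\<in>smooth_alg. \<forall>x. (f has_real_derivative f' x) (at x)"
proof (induction rule: smooth_alg.induct)
  case (flat k a b)
  let ?f' = "\<lambda>x. a * ((- real k) * flat (k + 1) (a * x + b) + flat (k + 2) (a * x + b))"
  have "?f' \<in> smooth_alg" by (intro smooth_alg.intros)
  moreover have "((\<lambda>x. flat k (a * x + b)) has_real_derivative ?f' x) (at x)" for x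
  proof -
    have "((\<lambda>x. a * x + b) has_real_derivative a) (at x)"
      by (auto intro!: derivative_eq_intros)
    from DERIV_chain2[OF flat_has_derivative this] show ?thesis by (simp add: mult.commute)
  qed
  ultimately show ?case by (intro bexI[of _ ?f']) auto
next
  case (const c)
  have "(\<lambda>_. 0) \<in> smooth_alg" by (rule smooth_alg.const)
  then show ?case by force
next
  case (add f g)
  then obtain f' g' where "f' \<in> smooth_alg" "g' \<in> smooth_alg"
    "\<And>x. (f has_real_derivative f' x) (at x)" "\<And>x. (g has_real_derivative g' x) (at x)" by blast
  then show ?case
    by (intro bexI[of _ "\<lambda>x. f' x + g' x"]) (auto intro: smooth_alg.intros derivative_intros)
next
  case (mult f g)
  then obtain f' g' where "f' \<in> smooth_alg" "g' \<in> smooth_alg"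
    "\<And>x. (f has_real_derivative f' x) (at x)" "\<And>x. (g has_real_derivative g' x) (at x)" by blast
  then show ?case using mult
    by (intro bexI[of _ "\<lambda>x. f' x * g x + f x * g' x"])
       (auto intro!: smooth_alg.intros derivative_eq_intros)
next
  case (inverse f)
  then obtain f' where "f' \<in> smooth_alg" "\<And>x. (f has_real_derivative f' x) (at x)" by blast
  moreover have "(\<lambda>x. (- 1) * (f' x * (inverse (f x) * inverse (f x)))) \<in> smooth_alg"
    using inverse \<open>f' \<in> smooth_alg\<close> by (intro smooth_alg.intros) auto
  ultimately show ?case using inverse
    by (intro bexI[of _ "\<lambda>x. (- 1) * (f' x * (inverse (f x) * inverse (f x)))"])
       (auto intro!: derivative_eq_intros)
qed

lemma deriv_smooth_alg: "f \<in> smooth_alg \<Longrightarrow> deriv f \<in> smooth_alg"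
  using smooth_alg_deriv[of f] DERIV_imp_deriv by (metis ext)

lemma smooth_alg_has_deriv: "f \<in> smooth_alg \<Longrightarrow> (f has_real_derivative deriv f x) (at x)"
  using smooth_alg_deriv[of f] DERIV_imp_deriv by metis

lemma smooth_alg_continuous: "f \<in> smooth_alg \<Longrightarrow> continuous_on S f"
  by (meson DERIV_continuous_on has_field_derivative_at_within smooth_alg_has_deriv)

lemma smooth_alg_smooth:
  assumes "f \<in> smooth_alg"
  shows "(deriv ^^ n) f differentiable_on UNIV"
proof -
  have "(deriv ^^ n) f \<in> smooth_alg"
    by (induction n) (auto intro: deriv_smooth_alg assms)
  then show ?thesis
    by (metis differentiable_at_withinI differentiable_on_def real_differentiable_def smooth_alg_has_deriv)
qed

text \<open>
  A transition from \<open>0\<close> on \<open>x \<le> 0\<close> to \<open>1\<close> on \<open>x \<ge> 1\<close>. The denominator is positive because \<open>x\<close> and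
  \<open>1 - x\<close> are never both \<open>\<le> 0\<close>.
\<close>

definition smooth_step :: "real \<Rightarrow> real" where
  "smooth_step x = flat 0 x * inverse (flat 0 x + flat 0 (1 - x))"

lemma smooth_step_in_alg: "smooth_step \<in> smooth_alg"
proof -
  have pos: "flat 0 x + flat 0 (1 - x) \<noteq> 0" for x
    by (cases "x > 0"; cases "x < 1") (auto simp: flat_def add_pos_pos less_imp_neq[symmetric])
  have 1: "(\<lambda>x. flat 0 (1 * x + 0)) \<in> smooth_alg" and 2: "(\<lambda>x. flat 0 ((-1) * x + 1)) \<in> smooth_alg"
    by (rule smooth_alg.flat)+
  from smooth_alg.mult[OF 1 smooth_alg.inverse[OF smooth_alg.add[OF 1 2]]] pos
  have "(\<lambda>x. flat 0 (1 * x + 0) * inverse (flat 0 (1 * x + 0) + flat 0 ((-1) * x + 1))) \<in> smooth_alg"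
    by simp
  then show ?thesis by (simp add: smooth_step_def[abs_def])
qed

lemma smooth_step_0: "x \<le> 0 \<Longrightarrow> smooth_step x = 0"
  by (simp add: smooth_step_def flat_def)

lemma smooth_step_1: "x \<ge> 1 \<Longrightarrow> smooth_step x = 1"
  by (simp add: smooth_step_def flat_def)

lemma smooth_step_bounds: "0 \<le> smooth_step x" "smooth_step x \<le> 1"
proof -
  have "flat 0 x \<ge> 0" "flat 0 (1 - x) \<ge> 0" by (simp_all add: flat_def)
  then show "0 \<le> smooth_step x" "smooth_step x \<le> 1"
    unfolding smooth_step_def by (auto simp: divide_inverse[symmetric] divide_le_eq)
qed

lemma deriv_smooth_step_outside:
  assumes "x \<notin> {0..1}" shows "deriv smooth_step x = 0"
proof (rule DERIV_imp_deriv)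
  consider "x < 0" | "x > 1" using assms by fastforce
  then show "(smooth_step has_real_derivative 0) (at x)"
  proof cases
    case 1
    have "((\<lambda>_. 0) has_real_derivative 0) (at x)" by simp
    then show ?thesis
      by (rule has_field_derivative_transform_within_open[where S="{..<0}"]) (use 1 in \<open>auto simp: smooth_step_0\<close>)
  next
    case 2
    have "((\<lambda>_. 1) has_real_derivative 0) (at x)" by simp
    then show ?thesis
      by (rule has_field_derivative_transform_within_open[where S="{1<..}"]) (use 2 in \<open>auto simp: smooth_step_1\<close>)
  qed
qed

lemma deriv_smooth_step_bounded: obtains B where "\<And>x. \<bar>deriv smooth_step x\<bar> \<le> B" "B > 0"
proof -
  have "continuous_on {0..1} (deriv smooth_step)"
    by (intro smooth_alg_continuous deriv_smooth_alg smooth_step_in_alg)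
  then have "bounded (deriv smooth_step ` {0..1})"
    by (intro compact_imp_bounded compact_continuous_image) auto
  then obtain B where "B > 0" "\<And>x. x \<in> {0..1} \<Longrightarrow> \<bar>deriv smooth_step x\<bar> \<le> B"
    by (auto simp: bounded_pos)
  then show ?thesis using deriv_smooth_step_outside that[of B] by (metis abs_zero less_imp_le)
qed

text \<open>
  As \<open>n\<close> grows, \<open>step n a\<close> tends to the indicator of \<open>t > a\<close> and its derivative \<open>spike n a\<close>
  tends to the point mass at \<open>a\<close>.
\<close>

definition step :: "nat \<Rightarrow> real \<Rightarrow> real \<Rightarrow> real" where
  "step n a t = smooth_step (real n * (t - a))"

definition spike :: "nat \<Rightarrow> real \<Rightarrow> real \<Rightarrow> real" where
  "spike n a t = real n * deriv smooth_step (real n * (t - a))"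

lemma step_smooth: "step n a \<in> smooth_alg"
  using smooth_alg_affine[OF smooth_step_in_alg, of "real n" "- real n * a"]
  by (simp add: step_def[abs_def] algebra_simps)

lemma spike_smooth: "spike n a \<in> smooth_alg"
  using smooth_alg.mult[OF smooth_alg.const smooth_alg_affine[OF deriv_smooth_alg[OF smooth_step_in_alg]],
      of "real n" "real n" "- real n * a"]
  by (simp add: spike_def[abs_def] algebra_simps)

lemma step_has_deriv: "(step n a has_real_derivative spike n a t) (at t)"
proof -
  have "((\<lambda>t. real n * (t - a)) has_real_derivative real n) (at t)"
    by (auto intro!: derivative_eq_intros)
  from DERIV_chain2[OF smooth_alg_has_deriv[OF smooth_step_in_alg] this]
  show ?thesis by (simp add: step_def[abs_def] spike_def mult.commute)
qed

lemma step_before: "t \<le> a \<Longrightarrow> step n a t = 0"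
  unfolding step_def by (intro smooth_step_0 mult_nonneg_nonpos) auto

lemma step_after:
  assumes "n > 0" "a + 1 / real n \<le> t" shows "step n a t = 1"
proof -
  have "1 / real n \<le> t - a" using assms(2) by simp
  then have "1 \<le> (t - a) * real n" using assms(1) by (simp only: pos_divide_le_eq of_nat_0_less_iff)
  then show ?thesis unfolding step_def by (intro smooth_step_1) (simp add: mult.commute)
qed

lemma step_bounds: "0 \<le> step n a t" "step n a t \<le> 1"
  by (simp_all add: step_def smooth_step_bounds)

lemma spike_outside:
  assumes "n > 0" "t \<notin> {a..a + 1 / real n}" shows "spike n a t = 0"
proof -
  have "real n * (t - a) \<notin> {0..1}" using assms by (auto simp: field_simps)
  then show ?thesis by (simp add: spike_def deriv_smooth_step_outside)
qed

lemma step_diff_outside: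
  assumes "n > 0" "x < y" "t \<notin> {x..y + 1 / real n}" shows "step n x t - step n y t = 0"
proof -
  consider "t < x" | "t > y + 1 / real n" using assms(3) by fastforce
  then show ?thesis using assms(1,2) by cases (simp_all add: step_before step_after)
qed

lemma eventually_inverse_less:
  assumes "d > 0" shows "\<forall>\<^sub>F n in sequentially. n > 0 \<and> 1 / real n < d"
proof -
  have "(\<lambda>n. 1 / real n) \<longlonglongrightarrow> 0" by (rule lim_1_over_n)
  then have "\<forall>\<^sub>F n in sequentially. 1 / real n < d" using assms by (rule order_tendstoD)
  with eventually_gt_at_top[of 0] show ?thesis by eventually_elim auto
qed

lemma step_eventually: "\<forall>\<^sub>F n in sequentially. step n a t = (if a < t then 1 else 0)"
proof (cases "a < t")
  case True
  then have "0 < t - a" by simp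
  from eventually_inverse_less[OF this] show ?thesis
    by eventually_elim (use True in \<open>simp add: step_after\<close>)
qed (simp add: step_before)

section \<open>Weak derivatives on the line\<close>

lemma locally_integrable_onD:
  "locally_integrable_on S f \<Longrightarrow> compact K \<Longrightarrow> K \<subseteq> S \<Longrightarrow> set_integrable lebesgue K f"
  by (simp add: locally_integrable_on_def)

lemma set_integrable_continuous_mult:
  fixes f g :: "real \<Rightarrow> complex"
  assumes "set_integrable lebesgue K f" "compact K" "continuous_on K g"
  shows "set_integrable lebesgue K (\<lambda>x. f x * g x)"
proof -
  have "bounded (g ` K)"
    using assms by (intro compact_imp_bounded compact_continuous_image) auto
  then obtain B where B: "\<And>x. x \<in> K \<Longrightarrow> norm (g x) \<le> B" by (auto simp: bounded_iff)
  have K: "K \<in> sets lebesgue" using assms by (simp add: borel_compact sets_completionI_sets)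
  have m: "(\<lambda>x. indicator K x *\<^sub>R g x) \<in> borel_measurable lebesgue"
    using continuous_imp_measurable_on_sets_lebesgue[OF assms(3) K] K
    by (simp add: borel_measurable_restrict_space_iff)
  show ?thesis unfolding set_integrable_def
  proof (rule Bochner_Integration.integrable_bound)
    show "integrable lebesgue (\<lambda>x. B *\<^sub>R (indicator K x *\<^sub>R f x))"
      using assms(1) unfolding set_integrable_def by (rule integrable_scaleR_right)
    have "(\<lambda>x. (indicator K x *\<^sub>R f x) * (indicator K x *\<^sub>R g x)) \<in> borel_measurable lebesgue"
      using assms(1) m by (intro borel_measurable_times) (auto simp: set_integrable_def)
    then show "(\<lambda>x. indicator K x *\<^sub>R (f x * g x)) \<in> borel_measurable lebesgue"
      by (rule measurable_cong[THEN iffD1, rotated]) (auto simp: indicator_def)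
    show "AE x in lebesgue. norm (indicator K x *\<^sub>R (f x * g x)) \<le> norm (B *\<^sub>R (indicator K x *\<^sub>R f x))"
    proof (rule AE_I2)
      fix x
      show "norm (indicator K x *\<^sub>R (f x * g x)) \<le> norm (B *\<^sub>R (indicator K x *\<^sub>R f x))"
      proof (cases "x \<in> K")
        case True
        then have "norm (f x) * norm (g x) \<le> norm (f x) * \<bar>B\<bar>"
          using B[OF True] by (intro mult_left_mono) auto
        then show ?thesis using True by (simp add: norm_mult mult.commute)
      qed simp
    qed
  qed
qed

lemma set_integral_supported:
  fixes f :: "real \<Rightarrow> complex"
  assumes "K \<subseteq> S" "\<And>x. x \<in> S \<Longrightarrow> x \<notin> K \<Longrightarrow> f x = 0"
  shows "(LINT x:S|lebesgue. f x) = (LINT x:K|lebesgue. f x)"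
  unfolding set_lebesgue_integral_def
  by (rule Bochner_Integration.integral_cong) (use assms in \<open>auto simp: indicator_def\<close>)

lemma set_integrable_extend:
  fixes f :: "real \<Rightarrow> complex"
  assumes "set_integrable lebesgue K f" "K \<subseteq> S" "\<And>x. x \<notin> K \<Longrightarrow> f x = 0"
  shows "set_integrable lebesgue S f"
  using assms(1) unfolding set_integrable_def
  by (rule Bochner_Integration.integrable_cong[THEN iffD1, rotated 2]) (use assms in \<open>auto simp: indicator_def\<close>)

text \<open>
  The spike has integral one, lives on \<open>[x, x + 1/n]\<close> and is bounded by \<open>n B\<close>, so the error is at most \<open>B\<close> times
  the oscillation of \<open>f\<close> on that interval.
\<close>

lemma approx_identity:
  fixes f :: "real \<Rightarrow> complex"
  assumes "continuous_on S f" "open S" "x \<in> S"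
  shows "(\<lambda>n. LINT t:S|lebesgue. f t * complex_of_real (spike n x t)) \<longlonglongrightarrow> f x"
proof (rule LIMSEQ_I)
  fix r :: real assume "r > 0"
  obtain B where B: "\<And>x. \<bar>deriv smooth_step x\<bar> \<le> B" "B > 0" using deriv_smooth_step_bounded by blast
  define e where "e = r / (2 * B)"
  have "e > 0" using \<open>r > 0\<close> B by (simp add: e_def)
  have "isCont f x" using assms by (simp add: continuous_on_eq_continuous_at)
  then obtain d1 where d1: "d1 > 0" "\<And>t. dist t x < d1 \<Longrightarrow> dist (f t) (f x) < e"
    using \<open>e > 0\<close> by (auto simp: continuous_at_eps_delta)
  obtain d2 where d2: "d2 > 0" "\<And>t. dist t x < d2 \<Longrightarrow> t \<in> S"
    using assms by (auto simp: open_dist)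
  have "min d1 d2 > 0" using d1 d2 by simp
  from eventually_inverse_less[OF this] obtain N where N: "\<And>n. n \<ge> N \<Longrightarrow> n > 0 \<and> 1 / real n < min d1 d2"
    by (auto simp: eventually_sequentially)
  show "\<exists>N. \<forall>n\<ge>N. norm ((LINT t:S|lebesgue. f t * complex_of_real (spike n x t)) - f x) < r"
  proof (intro exI allI impI)
    fix n assume "n \<ge> N"
    with N have n: "n > 0" and small: "1 / real n < min d1 d2" by auto
    define K where "K = {x..x + 1 / real n}"
    define w where "w = spike n x"
    have KS: "K \<subseteq> S" and Ke: "\<And>t. t \<in> K \<Longrightarrow> norm (f t - f x) < e"
      using small d1(2) d2(2) by (auto simp: K_def dist_norm)
    have w0: "w t = 0" if "t \<notin> K" for t
      using spike_outside[OF n] that by (simp add: w_def K_def)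
    have wB: "\<bar>w t\<bar> \<le> real n * B" for t
      using B(1) by (simp add: w_def spike_def abs_mult mult_left_mono)
    have cf: "continuous_on K f" using assms(1) KS by (rule continuous_on_subset)
    have cw: "continuous_on K (\<lambda>t. complex_of_real (w t))"
      unfolding w_def by (intro continuous_on_of_real smooth_alg_continuous spike_smooth)
    have int1: "set_integrable lebesgue K (\<lambda>t. complex_of_real (w t))"
      using cw unfolding K_def by (rule absolutely_integrable_continuous_real)
    have int2: "set_integrable lebesgue K (\<lambda>t. f t * complex_of_real (w t))"
      using continuous_on_mult[OF cf cw] unfolding K_def by (rule absolutely_integrable_continuous_real)
    have "(w has_integral (step n x (x + 1 / real n) - step n x x)) K"
      unfolding K_def w_def
      by (intro fundamental_theorem_of_calculus)
         (auto simp: step_has_deriv has_real_derivative_iff_has_vector_derivative[symmetric] has_field_derivative_at_within)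
    then have "(w has_integral 1) K" using n by (simp add: step_before step_after)
    then have "((\<lambda>t. complex_of_real (w t)) has_integral complex_of_real 1) K"
      by (rule has_integral_of_real)
    then have one: "(LINT t:K|lebesgue. complex_of_real (w t)) = 1"
      using int1 by (simp add: set_lebesgue_integral_eq_integral(2) integral_unique)
    have "(LINT t:S|lebesgue. f t * complex_of_real (w t)) - f x
        = (LINT t:K|lebesgue. f t * complex_of_real (w t)) - f x * (LINT t:K|lebesgue. complex_of_real (w t))"
      using one by (subst set_integral_supported[OF KS]) (auto simp: w0)
    also have "\<dots> = (LINT t:K|lebesgue. (f t - f x) * complex_of_real (w t))"
      using int1 int2 by (simp add: left_diff_distrib set_integral_diff(2))
    finally have eq: "(LINT t:S|lebesgue. f t * complex_of_real (w t)) - f x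
      = (LINT t:K|lebesgue. (f t - f x) * complex_of_real (w t))" .
    have "norm (LINT t:K|lebesgue. (f t - f x) * complex_of_real (w t)) \<le> (LINT t:K|lebesgue. e * (real n * B))"
      unfolding set_lebesgue_integral_def
    proof (rule Bochner_Integration.integral_norm_bound_integral)
      show "integrable lebesgue (\<lambda>t. indicator K t *\<^sub>R ((f t - f x) * complex_of_real (w t)))"
        using set_integral_diff(1)[OF int2 set_integrable_mult_right[OF int1], of "f x"]
        by (simp add: set_integrable_def left_diff_distrib)
      show "integrable lebesgue (\<lambda>t. indicator K t *\<^sub>R (e * (real n * B)))"
        by (simp add: K_def)
      fix t
      show "norm (indicator K t *\<^sub>R ((f t - f x) * complex_of_real (w t))) \<le> indicator K t *\<^sub>R (e * (real n * B))"
        using Ke[of t] wB[of t] \<open>e > 0\<close> by (auto simp: indicator_def norm_mult intro!: mult_mono)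
    qed
    also have "\<dots> = e * B" using n by (simp add: K_def set_integral_const lmeasurable_iff_integrable)
    also have "\<dots> < r" using B \<open>r > 0\<close> by (simp add: e_def)
    finally show "norm ((LINT t:S|lebesgue. f t * complex_of_real (spike n x t)) - f x) < r"
      using eq by (simp add: w_def)
  qed
qed

lemma test_function_step_diff:
  assumes "x < y" "n > 0" "{x..y + 1 / real n} \<subseteq> S"
  shows "test_function S (\<lambda>t. step n x t - step n y t)"
proof -
  have "(\<lambda>t. step n x t + (-1) * step n y t) \<in> smooth_alg"
    by (intro smooth_alg.intros step_smooth)
  then have "(\<lambda>t. step n x t - step n y t) \<in> smooth_alg" by simp
  then show ?thesis
    unfolding test_function_def using assms smooth_alg_smooth step_diff_outside[OF assms(2,1)]
    by (intro conjI allI exI[of _ "{x..y + 1 / real n}"]) auto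
qed

text \<open>
  Test the definition of the weak derivative against \<open>step n x - step n y\<close>, a smooth version of
  the indicator of \<open>(x, y]\<close>. Its derivative is a spike at \<open>x\<close> minus a spike at \<open>y\<close>, so the left-hand side tends
  to \<open>f x - f y\<close>; the right-hand side converges by dominated convergence.
\<close>

theorem weak_deriv_FTC:
  assumes S: "open S" and f: "continuous_on S f" and w: "has_weak_deriv S f g"
    and xy: "x < y" "{x..y} \<subseteq> S"
  shows "(LINT t:{x..y}|lebesgue. g t) = f y - f x"
proof -
  obtain d where d: "d > 0" "{x..y + d} \<subseteq> S"
  proof -
    obtain e where e: "e > 0" "\<And>t. dist t y < e \<Longrightarrow> t \<in> S"
      using S xy unfolding open_dist by (meson atLeastAtMost_iff less_imp_le order_refl subsetD)
    have "{x..y + e / 2} \<subseteq> S"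
    proof
      fix t assume "t \<in> {x..y + e / 2}"
      then show "t \<in> S" using e xy by (cases "t \<le> y") (auto simp: dist_norm)
    qed
    then show ?thesis using that[of "e / 2"] e by auto
  qed
  \<comment> \<open>the support of the test functions sticks out of \<open>[x, y]\<close> by \<open>1/n\<close> on the right, hence the margin \<open>d\<close>\<close>
  define \<phi> where "\<phi> n t = step n x t - step n y t" for n t
  have dphi: "deriv (\<phi> n) t = spike n x t - spike n y t" for n t
    unfolding \<phi>_def by (intro DERIV_imp_deriv DERIV_diff step_has_deriv)
  have gl: "locally_integrable_on S g" using w by (simp add: has_weak_deriv_def)
  have gi: "set_integrable lebesgue {x..y + d} g"
    by (rule locally_integrable_onD[OF gl]) (use d in auto)
  have xS: "x \<in> S" and yS: "y \<in> S" using xy by auto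
  have ev: "\<forall>\<^sub>F n in sequentially. (LINT t:S|lebesgue. f t * complex_of_real (spike n x t))
      - (LINT t:S|lebesgue. f t * complex_of_real (spike n y t))
      = - (LINT t:{x..y + d}|lebesgue. g t * complex_of_real (\<phi> n t))"
    using eventually_inverse_less[OF d(1)]
  proof eventually_elim
    case (elim n)
    have n: "n > 0" and sub: "{x..y + 1 / real n} \<subseteq> {x..y + d}" using elim by auto
    have tf: "test_function S (\<phi> n)"
      unfolding \<phi>_def by (rule test_function_step_diff) (use sub d n xy in auto)
    have phi0: "\<phi> n t = 0" if "t \<notin> {x..y + d}" for t
      unfolding \<phi>_def by (rule step_diff_outside[OF n xy(1)]) (use that sub in blast)
    have int: "set_integrable lebesgue S (\<lambda>t. f t * complex_of_real (spike n a t))"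
      if a: "a \<in> {x, y}" for a
    proof (rule set_integrable_extend)
      show K: "{a..a + 1 / real n} \<subseteq> S" using a sub d xy n by fastforce
      show "set_integrable lebesgue {a..a + 1 / real n} (\<lambda>t. f t * complex_of_real (spike n a t))"
        by (intro absolutely_integrable_continuous_real continuous_on_mult continuous_on_of_real
            continuous_on_subset[OF f K] smooth_alg_continuous spike_smooth)
    qed (simp add: spike_outside[OF n])
    have "(LINT t:S|lebesgue. f t * complex_of_real (deriv (\<phi> n) t))
      = - (LINT t:S|lebesgue. g t * complex_of_real (\<phi> n t))"
      using w tf by (simp add: has_weak_deriv_def)
    also have "(LINT t:S|lebesgue. g t * complex_of_real (\<phi> n t))
      = (LINT t:{x..y + d}|lebesgue. g t * complex_of_real (\<phi> n t))"
      by (rule set_integral_supported) (use d phi0 in auto)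
    also have "(LINT t:S|lebesgue. f t * complex_of_real (deriv (\<phi> n) t))
      = (LINT t:S|lebesgue. f t * complex_of_real (spike n x t)) - (LINT t:S|lebesgue. f t * complex_of_real (spike n y t))"
      by (simp add: dphi right_diff_distrib set_integral_diff(2)[OF int int])
    finally show ?case .
  qed
  have L1: "(\<lambda>n. (LINT t:S|lebesgue. f t * complex_of_real (spike n x t))
      - (LINT t:S|lebesgue. f t * complex_of_real (spike n y t))) \<longlonglongrightarrow> f x - f y"
    by (intro tendsto_diff approx_identity f S xS yS)
  have L2: "(\<lambda>n. LINT t:{x..y + d}|lebesgue. g t * complex_of_real (\<phi> n t))
      \<longlonglongrightarrow> (LINT t:{x<..y}|lebesgue. g t)"
    unfolding set_lebesgue_integral_def
  proof (rule integral_dominated_convergence[where w="\<lambda>t. norm (indicator {x..y + d} t *\<^sub>R g t)"])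
    show "integrable lebesgue (\<lambda>t. norm (indicator {x..y + d} t *\<^sub>R g t))"
      using gi unfolding set_integrable_def by (rule integrable_norm)
    have "set_integrable lebesgue {x<..y} g"
      by (rule set_integrable_subset[OF gi]) (use d in auto)
    then show "(\<lambda>t. indicator {x<..y} t *\<^sub>R g t) \<in> borel_measurable lebesgue"
      by (simp add: set_integrable_def)
    have cphi: "continuous_on {x..y + d} (\<lambda>t. complex_of_real (\<phi> n t))" for n
      unfolding \<phi>_def by (intro continuous_on_of_real continuous_on_diff smooth_alg_continuous step_smooth)
    show "(\<lambda>t. indicator {x..y + d} t *\<^sub>R (g t * complex_of_real (\<phi> n t))) \<in> borel_measurable lebesgue" for n
      using set_integrable_continuous_mult[OF gi compact_Icc cphi] by (simp add: set_integrable_def)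
    have "(\<lambda>n. indicator {x..y + d} t *\<^sub>R (g t * complex_of_real (\<phi> n t))) \<longlonglongrightarrow> indicator {x<..y} t *\<^sub>R g t" for t
    proof -
      have "\<forall>\<^sub>F n in sequentially. indicator {x<..y} t *\<^sub>R g t = indicator {x..y + d} t *\<^sub>R (g t * complex_of_real (\<phi> n t))"
        using step_eventually[of x t] step_eventually[of y t]
      proof eventually_elim
        case (elim n)
        then show ?case using xy d by (auto simp: \<phi>_def indicator_def)
      qed
      then show ?thesis by (rule tendsto_eventually[OF eventually_mono]) auto
    qed
    then show "AE t in lebesgue. (\<lambda>n. indicator {x..y + d} t *\<^sub>R (g t * complex_of_real (\<phi> n t)))
        \<longlonglongrightarrow> indicator {x<..y} t *\<^sub>R g t" by simp
    show "AE t in lebesgue. norm (indicator {x..y + d} t *\<^sub>R (g t * complex_of_real (\<phi> n t)))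
        \<le> norm (indicator {x..y + d} t *\<^sub>R g t)" for n
    proof (rule AE_I2)
      fix t
      have "\<bar>\<phi> n t\<bar> \<le> 1"
        using step_bounds[of n x t] step_bounds[of n y t]
        by (simp add: \<phi>_def abs_le_iff)
      then have "norm (g t) * \<bar>\<phi> n t\<bar> \<le> norm (g t) * 1" by (intro mult_left_mono) auto
      then show "norm (indicator {x..y + d} t *\<^sub>R (g t * complex_of_real (\<phi> n t)))
        \<le> norm (indicator {x..y + d} t *\<^sub>R g t)"
        by (simp add: norm_mult indicator_def)
    qed
  qed
  have "(\<lambda>n. (LINT t:S|lebesgue. f t * complex_of_real (spike n x t))
      - (LINT t:S|lebesgue. f t * complex_of_real (spike n y t))) \<longlonglongrightarrow> - (LINT t:{x<..y}|lebesgue. g t)"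
    using tendsto_minus[OF L2] by (rule Lim_transform_eventually) (use ev in \<open>auto elim: eventually_mono\<close>)
  with L1 have "f x - f y = - (LINT t:{x<..y}|lebesgue. g t)" by (rule LIMSEQ_unique)
  moreover have "(LINT t:{x<..y}|lebesgue. g t) = (LINT t:{x..y}|lebesgue. g t)"
    by (rule set_integral_discrete_difference[of "{x}"]) (use xy in auto)
  ultimately show ?thesis by (simp add: algebra_simps)
qed

text \<open>
  One compact set and one bound serve the test function and its derivative alike, as they appear on the two sides of
  the identity that defines a weak derivative.
\<close>

lemma test_functionE:
  assumes "test_function S \<phi>"
  obtains K B where "compact K" "K \<subseteq> S" "\<And>x. x \<notin> K \<Longrightarrow> \<phi> x = 0" "\<And>x. x \<notin> K \<Longrightarrow> deriv \<phi> x = 0"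
    "continuous_on UNIV \<phi>" "continuous_on UNIV (deriv \<phi>)"
    "\<And>x. \<bar>\<phi> x\<bar> \<le> B" "\<And>x. \<bar>deriv \<phi> x\<bar> \<le> B"
proof -
  from assms obtain K where K: "compact K" "K \<subseteq> S" "\<And>x. x \<notin> K \<Longrightarrow> \<phi> x = 0"
    and d: "\<And>n. (deriv ^^ n) \<phi> differentiable_on UNIV"
    by (auto simp: test_function_def)
  have c: "continuous_on UNIV \<phi>" "continuous_on UNIV (deriv \<phi>)"
    using d[of 0] d[of 1] by (auto intro: differentiable_imp_continuous_on)
  have dK: "deriv \<phi> x = 0" if "x \<notin> K" for x
  proof (rule DERIV_imp_deriv)
    have "((\<lambda>_. 0) has_real_derivative 0) (at x)" by simp
    then show "(\<phi> has_real_derivative 0) (at x)"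
      by (rule has_field_derivative_transform_within_open[where S="- K"])
         (use K that in \<open>auto intro: compact_imp_closed\<close>)
  qed
  have b: "\<exists>B. \<forall>x. \<bar>\<psi> x\<bar> \<le> B" if "continuous_on UNIV \<psi>" "\<And>x. x \<notin> K \<Longrightarrow> \<psi> x = 0" for \<psi> :: "real \<Rightarrow> real"
  proof -
    have "bounded (\<psi> ` K)" using K(1) that(1)
      by (intro compact_imp_bounded compact_continuous_image) (auto intro: continuous_on_subset)
    then obtain B where "B > 0" "\<And>x. x \<in> K \<Longrightarrow> \<bar>\<psi> x\<bar> \<le> B" by (auto simp: bounded_pos)
    then show ?thesis using that(2) by (metis abs_zero less_imp_le)
  qed
  obtain B1 B2 where "\<And>x. \<bar>\<phi> x\<bar> \<le> B1" "\<And>x. \<bar>deriv \<phi> x\<bar> \<le> B2"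
    using b[OF c(1) K(3)] b[OF c(2) dK] by blast
  then show ?thesis
    using that[of K "max B1 B2"] K c dK by (metis max.coboundedI1 max.coboundedI2)
qed

lemma set_integrable_mult_compactly_supported:
  fixes h :: "real \<Rightarrow> complex"
  assumes h: "locally_integrable_on S h" and K: "compact K" "K \<subseteq> S" "\<And>x. x \<notin> K \<Longrightarrow> \<psi> x = 0"
    and c: "continuous_on UNIV \<psi>"
  shows "set_integrable lebesgue S (\<lambda>x. h x * complex_of_real (\<psi> x))"
proof -
  have "set_integrable lebesgue K (\<lambda>x. h x * complex_of_real (\<psi> x))"
    by (rule set_integrable_continuous_mult[OF locally_integrable_onD[OF h] _ continuous_on_of_real])
       (use K in \<open>auto intro: continuous_on_subset[OF c]\<close>)
  then show ?thesis by (rule set_integrable_extend) (use K in auto)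
qed

lemma has_weak_deriv_add:
  assumes 1: "has_weak_deriv S f g" and 2: "has_weak_deriv S f' g'"
  shows "has_weak_deriv S (\<lambda>x. f x + f' x) (\<lambda>x. g x + g' x)"
  unfolding has_weak_deriv_def
proof (intro conjI allI impI)
  show "locally_integrable_on S (\<lambda>x. f x + f' x)" "locally_integrable_on S (\<lambda>x. g x + g' x)"
    using assms by (auto simp: has_weak_deriv_def locally_integrable_on_def)
  fix \<phi> assume t: "test_function S \<phi>"
  obtain K where K: "compact K" "K \<subseteq> S" "\<And>x. x \<notin> K \<Longrightarrow> \<phi> x = 0" "\<And>x. x \<notin> K \<Longrightarrow> deriv \<phi> x = 0"
    "continuous_on UNIV \<phi>" "continuous_on UNIV (deriv \<phi>)"
    by (rule test_functionE[OF t]) (rule that; simp)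
  have i: "set_integrable lebesgue S (\<lambda>x. h x * complex_of_real (\<phi> x))"
    "set_integrable lebesgue S (\<lambda>x. h x * complex_of_real (deriv \<phi> x))"
    if "locally_integrable_on S h" for h
    by (rule set_integrable_mult_compactly_supported[OF that K(1,2)]; use K in simp)+
  show "(LINT x:S|lebesgue. (f x + f' x) * complex_of_real (deriv \<phi> x)) =
    - (LINT x:S|lebesgue. (g x + g' x) * complex_of_real (\<phi> x))"
    using assms t by (simp add: has_weak_deriv_def distrib_right set_integral_add(2) i)
qed

lemma has_weak_deriv_cmult:
  assumes "has_weak_deriv S f g"
  shows "has_weak_deriv S (\<lambda>x. c * f x) (\<lambda>x. c * g x)"
  using assms by (auto simp: has_weak_deriv_def locally_integrable_on_def mult.assoc)

lemma set_integral_tendsto_L1: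
  fixes h :: "nat \<Rightarrow> real \<Rightarrow> complex"
  assumes n: "\<And>n. locally_integrable_on S (h n)" and l: "locally_integrable_on S g"
    and K: "compact K" "K \<subseteq> S" "\<And>x. x \<notin> K \<Longrightarrow> \<psi> x = 0" and c: "continuous_on UNIV \<psi>"
    and lim: "(\<lambda>n. LINT x:K|lebesgue. norm (h n x - g x)) \<longlonglongrightarrow> 0"
    and B: "\<And>x. \<bar>\<psi> x\<bar> \<le> B"
  shows "(\<lambda>n. LINT x:S|lebesgue. h n x * complex_of_real (\<psi> x)) \<longlonglongrightarrow> (LINT x:S|lebesgue. g x * complex_of_real (\<psi> x))"
proof -
  have i: "set_integrable lebesgue S (\<lambda>x. f x * complex_of_real (\<psi> x))" if "locally_integrable_on S f" for f
    by (rule set_integrable_mult_compactly_supported[OF that K c])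
  have "norm ((LINT x:S|lebesgue. h n x * complex_of_real (\<psi> x)) - (LINT x:S|lebesgue. g x * complex_of_real (\<psi> x)))
      \<le> B * (LINT x:K|lebesgue. norm (h n x - g x))" for n
  proof -
    have "(LINT x:S|lebesgue. h n x * complex_of_real (\<psi> x)) - (LINT x:S|lebesgue. g x * complex_of_real (\<psi> x))
      = (LINT x:S|lebesgue. (h n x - g x) * complex_of_real (\<psi> x))"
      by (simp add: left_diff_distrib set_integral_diff(2)[OF i[OF n] i[OF l]])
    also have "\<dots> = (LINT x:K|lebesgue. (h n x - g x) * complex_of_real (\<psi> x))"
      by (rule set_integral_supported) (use K in auto)
    also have "norm \<dots> \<le> (LINT x:K|lebesgue. B * norm (h n x - g x))"
      unfolding set_lebesgue_integral_def
    proof (rule Bochner_Integration.integral_norm_bound_integral)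
      have d: "locally_integrable_on S (\<lambda>x. h n x - g x)"
        using n l by (auto simp: locally_integrable_on_def)
      have KK: "set_integrable lebesgue K (\<lambda>x. h n x - g x)"
        by (rule locally_integrable_onD[OF d K(1,2)])
      show "integrable lebesgue (\<lambda>x. indicator K x *\<^sub>R ((h n x - g x) * complex_of_real (\<psi> x)))"
        using set_integrable_continuous_mult[OF KK K(1) continuous_on_of_real[OF continuous_on_subset[OF c]]]
        by (simp add: set_integrable_def)
      show "integrable lebesgue (\<lambda>x. indicator K x *\<^sub>R (B * norm (h n x - g x)))"
        using set_integrable_norm[OF KK] by (simp add: set_integrable_def mult.left_commute)
      fix x
      show "norm (indicator K x *\<^sub>R ((h n x - g x) * complex_of_real (\<psi> x))) \<le> indicator K x *\<^sub>R (B * norm (h n x - g x))"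
        using B[of x] by (auto simp: indicator_def norm_mult mult.commute[of B] intro!: mult_left_mono)
    qed
    also have "\<dots> = B * (LINT x:K|lebesgue. norm (h n x - g x))" by simp
    finally show ?thesis .
  qed
  moreover have "(\<lambda>n. B * (LINT x:K|lebesgue. norm (h n x - g x))) \<longlonglongrightarrow> 0"
    using tendsto_mult_right_zero[OF lim] by simp
  ultimately have "(\<lambda>n. (LINT x:S|lebesgue. h n x * complex_of_real (\<psi> x)) - (LINT x:S|lebesgue. g x * complex_of_real (\<psi> x))) \<longlonglongrightarrow> 0"
    by (rule Lim_null_comparison[OF always_eventually[OF allI]])
  then show ?thesis by (simp add: LIM_zero_iff)
qed

text \<open>
  Both sides of the defining identity depend continuously, in \<open>L\<^sup>1\<close> of the support of the test function,
  on the function and its derivative.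
\<close>

lemma has_weak_deriv_limit:
  assumes n: "\<And>n. has_weak_deriv S (f n) (g n)"
    and loc: "locally_integrable_on S F" "locally_integrable_on S G"
    and lim: "\<And>K. compact K \<Longrightarrow> K \<subseteq> S \<Longrightarrow> (\<lambda>n. LINT x:K|lebesgue. norm (f n x - F x)) \<longlonglongrightarrow> 0"
      "\<And>K. compact K \<Longrightarrow> K \<subseteq> S \<Longrightarrow> (\<lambda>n. LINT x:K|lebesgue. norm (g n x - G x)) \<longlonglongrightarrow> 0"
  shows "has_weak_deriv S F G"
  unfolding has_weak_deriv_def
proof (intro conjI allI impI loc)
  fix \<phi> assume t: "test_function S \<phi>"
  obtain K B where K: "compact K" "K \<subseteq> S" "\<And>x. x \<notin> K \<Longrightarrow> \<phi> x = 0" "\<And>x. x \<notin> K \<Longrightarrow> deriv \<phi> x = 0"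
    "continuous_on UNIV \<phi>" "continuous_on UNIV (deriv \<phi>)"
    and B: "\<And>x. \<bar>\<phi> x\<bar> \<le> B" "\<And>x. \<bar>deriv \<phi> x\<bar> \<le> B"
    by (rule test_functionE[OF t]) (rule that; simp)
  have ln: "locally_integrable_on S (f n)" "locally_integrable_on S (g n)" for n
    using n[of n] by (simp_all add: has_weak_deriv_def)
  have 1: "(\<lambda>n. LINT x:S|lebesgue. f n x * complex_of_real (deriv \<phi> x)) \<longlonglongrightarrow> (LINT x:S|lebesgue. F x * complex_of_real (deriv \<phi> x))"
    by (rule set_integral_tendsto_L1[OF ln(1) loc(1) K(1,2,4,6) lim(1)[OF K(1,2)] B(2)])
  have 2: "(\<lambda>n. LINT x:S|lebesgue. g n x * complex_of_real (\<phi> x)) \<longlonglongrightarrow> (LINT x:S|lebesgue. G x * complex_of_real (\<phi> x))"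
    by (rule set_integral_tendsto_L1[OF ln(2) loc(2) K(1,2,3,5) lim(2)[OF K(1,2)] B(1)])
  have "(LINT x:S|lebesgue. f n x * complex_of_real (deriv \<phi> x)) = - (LINT x:S|lebesgue. g n x * complex_of_real (\<phi> x))" for n
    using n[of n] t by (simp add: has_weak_deriv_def)
  with 1 tendsto_minus[OF 2] show "(LINT x:S|lebesgue. F x * complex_of_real (deriv \<phi> x)) = - (LINT x:S|lebesgue. G x * complex_of_real (\<phi> x))"
    using LIMSEQ_unique by force
qed

lemma sigma_finite_lebesgue: "sigma_finite_measure (lebesgue :: real measure)"
proof
  show "\<exists>A. countable A \<and> A \<subseteq> sets (lebesgue :: real measure) \<and> \<Union> A = space lebesgue
      \<and> (\<forall>a\<in>A. emeasure lebesgue a \<noteq> \<infinity>)"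
  proof (intro exI[of _ "range (\<lambda>n::nat. {- real n..real n})"] conjI)
    show "\<Union> (range (\<lambda>n::nat. {- real n..real n})) = space lebesgue"
    proof (rule set_eqI)
      fix x :: real
      obtain n :: nat where "\<bar>x\<bar> \<le> real n" using real_arch_simple by blast
      then have "x \<in> {- real n..real n}" by (simp add: abs_le_iff)
      then show "x \<in> \<Union> (range (\<lambda>n::nat. {- real n..real n})) \<longleftrightarrow> x \<in> space lebesgue" by auto
    qed
  qed auto
qed

text \<open>
  The sets over which \<open>h\<close> has integral zero form a Dynkin system that contains the intervals, hence all Borel
  sets; a Lebesgue set differs from a Borel set by a null set.
\<close>

lemma AE_zero_if_integrals_zero_Icc:
  fixes h :: "real \<Rightarrow> complex"
  assumes i: "set_integrable lebesgue {a..b} h"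
    and z: "\<And>x y. a \<le> x \<Longrightarrow> x < y \<Longrightarrow> y \<le> b \<Longrightarrow> (LINT t:{x..y}|lebesgue. h t) = 0"
  shows "AE t in lebesgue. t \<in> {a..b} \<longrightarrow> h t = 0"
proof -
  define H where "H t = indicator {a..b} t *\<^sub>R h t" for t
  have iH: "integrable lebesgue H" using i by (simp add: set_integrable_def H_def[abs_def])
  have zI: "(LINT t:{x..y}|lebesgue. H t) = 0" for x y
  proof -
    have "(LINT t:{x..y}|lebesgue. H t) = (LINT t:{max a x..min b y}|lebesgue. h t)"
      unfolding set_lebesgue_integral_def H_def
      by (rule Bochner_Integration.integral_cong) (auto simp: indicator_def)
    also have "\<dots> = 0"
    proof -
      consider "max a x < min b y" | "max a x = min b y" | "max a x > min b y" by linarith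
      then show ?thesis
      proof cases
        case 2
        have "{max a x} \<in> null_sets lebesgue" by (simp add: null_sets_completionI)
        then have "AE t in lebesgue. indicator {max a x} t *\<^sub>R h t = 0"
          by (rule AE_mp[OF AE_not_in]) auto
        then have "(LINT t:{max a x}|lebesgue. h t) = 0"
          unfolding set_lebesgue_integral_def by (rule integral_eq_zero_AE)
        moreover have "{max a x..min b y} = {max a x}" unfolding 2[symmetric] by (rule atLeastAtMost_singleton)
        ultimately show ?thesis by (simp only:)
      qed (use z in \<open>auto simp: set_lebesgue_integral_def\<close>)
    qed
    finally show ?thesis .
  qed
  have set: "set_integrable lebesgue A H" if "A \<in> sets lebesgue" for A
    unfolding set_integrable_def using iH that by (rule integrable_mult_indicator[rotated])
  have all: "(LINT t|lebesgue. H t) = 0"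
  proof -
    have "(LINT t|lebesgue. H t) = (LINT t:{a..b}|lebesgue. H t)"
      unfolding set_lebesgue_integral_def H_def
      by (rule Bochner_Integration.integral_cong) (auto simp: indicator_def)
    then show ?thesis by (simp add: zI)
  qed
  have "(LINT t:A|lebesgue. H t) = 0" if "A \<in> sets borel" for A
    using that
  proof (induction rule: borel_set_induct)
    case empty
    show ?case by (simp add: set_lebesgue_integral_def)
  next
    case (interval a b)
    show ?case by (rule zI)
  next
    case (compl A)
    have A: "A \<in> sets lebesgue" using compl(1) by (simp add: sets_completionI_sets)
    have "(LINT t:UNIV|lebesgue. H t) = (LINT t:A|lebesgue. H t) + (LINT t:-A|lebesgue. H t)"
      using set_integral_Un[of A "-A" lebesgue H] set[OF A] set[of "-A"] A
      by (simp add: Compl_partition Compl_in_sets_lebesgue)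
    then show ?case using compl(2) all by (simp add: set_lebesgue_integral_def)
  next
    case (union A)
    have A: "\<And>i. A i \<in> sets lebesgue" using union(2) by (simp add: sets_completionI_sets)
    have "(LINT t:(\<Union>i. A i)|lebesgue. H t) = (\<Sum>i. (LINT t:A i|lebesgue. H t))"
      by (rule lebesgue_integral_countable_add)
         (use A union(1) in \<open>auto simp: disjoint_family_on_def intro!: set\<close>)
    then show ?case using union(3) by simp
  qed note bor = this
  have leb: "(LINT t:A|lebesgue. H t) = 0" if Aleb: "A \<in> sets lebesgue" for A
  proof -
    obtain B N N' where *: "A = B \<union> N" "N \<subseteq> N'" "N' \<in> null_sets lborel" "B \<in> sets lborel"
      using sets_completionE[OF Aleb] by metis
    have "N \<in> null_sets lebesgue" using * null_sets_completion_subset by (metis null_sets_completionI)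
    then have "AE t in lebesgue. t \<in> A \<longleftrightarrow> t \<in> B"
      using * by (auto dest: AE_not_in elim: eventually_mono)
    moreover have "B \<in> sets lebesgue" using *(4) by (simp add: sets_completionI_sets)
    ultimately have "(LINT t:A|lebesgue. H t) = (LINT t:B|lebesgue. H t)"
      using Aleb set by (intro set_integral_cong_set) (auto simp: set_borel_measurable_def set_integrable_def)
    then show ?thesis using bor * by simp
  qed
  have "AE t in lebesgue. H t = 0"
    by (rule sigma_finite_measure.density_zero[OF sigma_finite_lebesgue iH leb])
  then show ?thesis by (auto simp: H_def elim: eventually_mono)
qed

text \<open>
  The difference of two weak derivatives is a weak derivative of the zero function, so its integral over
  every compact interval in \<open>S\<close> vanishes. Countably many rational intervals cover \<open>S\<close>.
\<close>

theorem weak_deriv_unique: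
  assumes S: "open S" and 1: "has_weak_deriv S f g" and 2: "has_weak_deriv S f g'"
  shows "AE x in lebesgue. x \<in> S \<longrightarrow> g x = g' x"
proof -
  define h where "h x = g x - g' x" for x
  have w: "has_weak_deriv S (\<lambda>_. 0) h"
    using has_weak_deriv_add[OF 1 has_weak_deriv_cmult[OF 2, of "-1"]] by (simp add: h_def[abs_def])
  then have hl: "locally_integrable_on S h" by (simp add: has_weak_deriv_def)
  have "AE t in lebesgue. t \<in> {a..b} \<longrightarrow> h t = 0" if "{a..b} \<subseteq> S" for a b
  proof (rule AE_zero_if_integrals_zero_Icc)
    show "set_integrable lebesgue {a..b} h" by (rule locally_integrable_onD[OF hl]) (use that in auto)
    fix x y assume "a \<le> x" "x < y" "y \<le> b"
    with weak_deriv_FTC[OF S _ w, of x y] that show "(LINT t:{x..y}|lebesgue. h t) = 0"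
      by (auto simp: subset_iff)
  qed
  then have "\<forall>p\<in>{(a, b). a \<in> \<rat> \<and> b \<in> \<rat> \<and> {a..b} \<subseteq> S}. AE t in lebesgue. t \<in> {fst p..snd p} \<longrightarrow> h t = 0"
    by auto
  moreover have "countable {(a, b). a \<in> \<rat> \<and> b \<in> \<rat> \<and> {a..b::real} \<subseteq> S}"
    by (rule countable_subset[of _ "\<rat> \<times> \<rat>"]) (auto intro: countable_rat)
  ultimately have "AE t in lebesgue. \<forall>p\<in>{(a, b). a \<in> \<rat> \<and> b \<in> \<rat> \<and> {a..b} \<subseteq> S}. t \<in> {fst p..snd p} \<longrightarrow> h t = 0"
    by (subst AE_ball_countable) auto
  then show ?thesis
  proof eventually_elim
    case (elim x)
    show ?case
    proof
      assume "x \<in> S"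
      then obtain e where e: "e > 0" "\<And>t. dist t x < e \<Longrightarrow> t \<in> S" using S by (auto simp: open_dist)
      obtain a b where "a \<in> \<rat>" "x - e < a" "a < x" "b \<in> \<rat>" "x < b" "b < x + e"
        using Rats_dense_in_real[of "x - e" x] Rats_dense_in_real[of x "x + e"] e by auto
      moreover from this have "{a..b} \<subseteq> S" using e(2) by (auto simp: dist_norm)
      ultimately have "h x = 0" using bspec[OF elim, of "(a, b)"] by simp
      then show "g x = g' x" by (simp add: h_def)
    qed
  qed
qed

lemma weakly_differentiable_has_weak_deriv:
  "weakly_differentiable S f \<Longrightarrow> has_weak_deriv S f (weak_deriv S f)"
  unfolding weakly_differentiable_def weak_deriv_def using someI_ex[of "has_weak_deriv S f"] by simp

section \<open>Projections and separability in a Hilbert space\<close>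

context complex_inner_product_space
begin

definition nrm :: "'a \<Rightarrow> real" where
  "nrm u = sqrt (Re (ip u u))"

lemma ip_dist_nrm: "u \<in> H \<Longrightarrow> v \<in> H \<Longrightarrow> ip_dist u v = nrm (u - v)"
  by (simp add: ip_dist_def nrm_def)

lemma H_add: "u \<in> H \<Longrightarrow> v \<in> H \<Longrightarrow> u + v \<in> H"
  and H_scale: "u \<in> H \<Longrightarrow> scale c u \<in> H"
  and H_diff: "u \<in> H \<Longrightarrow> v \<in> H \<Longrightarrow> u - v \<in> H"
  and H_zero: "0 \<in> H"
  using subspace_H subspace_diff by (auto simp: subspace_def)

lemma ip_add_right: "u \<in> H \<Longrightarrow> v \<in> H \<Longrightarrow> w \<in> H \<Longrightarrow> ip w (u + v) = ip w u + ip w v"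
  by (metis H_add complex_cnj_add ip_add ip_commute)

lemma ip_scale_right: "u \<in> H \<Longrightarrow> w \<in> H \<Longrightarrow> ip w (scale c u) = cnj c * ip w u"
  by (metis H_scale complex_cnj_mult ip_scale ip_commute)

lemma ip_diff: "u \<in> H \<Longrightarrow> v \<in> H \<Longrightarrow> w \<in> H \<Longrightarrow> ip (u - v) w = ip u w - ip v w"
  using ip_add[of "u - v" v w] by (simp add: H_diff)

lemma ip_diff_right: "u \<in> H \<Longrightarrow> v \<in> H \<Longrightarrow> w \<in> H \<Longrightarrow> ip w (u - v) = ip w u - ip w v"
  using ip_add_right[of "u - v" v w] by (simp add: H_diff)

lemma ip_zero_left: "w \<in> H \<Longrightarrow> ip 0 w = 0"
  using ip_scale[of w w 0] by simp

lemma nrm_sq: "u \<in> H \<Longrightarrow> (nrm u)\<^sup>2 = Re (ip u u)"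
  by (simp add: nrm_def ip_nonneg)

lemma nrm_nonneg: "u \<in> H \<Longrightarrow> 0 \<le> nrm u"
  by (simp add: nrm_def ip_nonneg)

lemma nrm_zero: "nrm 0 = 0"
  using ip_zero_left[OF H_zero] by (simp add: nrm_def)

lemma nrm_triangle: "u \<in> H \<Longrightarrow> v \<in> H \<Longrightarrow> nrm (u + v) \<le> nrm u + nrm v"
  unfolding nrm_def by (rule ip_norm_triangle)

lemma nrm_scale: "u \<in> H \<Longrightarrow> nrm (scale c u) = cmod c * nrm u"
proof -
  assume u: "u \<in> H"
  have "ip (scale c u) (scale c u) = (c * cnj c) * ip u u"
    using u by (simp add: ip_scale ip_scale_right H_scale)
  also have "c * cnj c = complex_of_real ((cmod c)\<^sup>2)"
    using complex_norm_square[of c] by simp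
  finally have "Re (ip (scale c u) (scale c u)) = (cmod c)\<^sup>2 * Re (ip u u)" by simp
  then show ?thesis by (simp add: nrm_def real_sqrt_mult)
qed

lemma nrm_minus_commute: "u \<in> H \<Longrightarrow> v \<in> H \<Longrightarrow> nrm (u - v) = nrm (v - u)"
  using commute[of u v] by (simp add: ip_dist_nrm)

lemma nrm_diff_triangle: "u \<in> H \<Longrightarrow> v \<in> H \<Longrightarrow> w \<in> H \<Longrightarrow> nrm (u - w) \<le> nrm (u - v) + nrm (v - w)"
  using triangle[of u v w] by (simp add: ip_dist_nrm)

lemma parallelogram:
  assumes "u \<in> H" "v \<in> H"
  shows "(nrm (u - v))\<^sup>2 + (nrm (u + v))\<^sup>2 = 2 * (nrm u)\<^sup>2 + 2 * (nrm v)\<^sup>2"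
  using assms by (simp add: nrm_sq H_add H_diff ip_add ip_add_right ip_diff ip_diff_right)

definition norm_closed :: "'a set \<Rightarrow> bool" where
  "norm_closed M \<longleftrightarrow> (\<forall>u\<in>H. (\<forall>\<epsilon>>0. \<exists>m\<in>M. nrm (u - m) < \<epsilon>) \<longrightarrow> u \<in> M)"

end

context complex_hilbert_space
begin

lemma Cauchy_converges:
  fixes x :: "nat \<Rightarrow> 'a"
  assumes "\<And>n. x n \<in> H" and "\<And>\<epsilon>. \<epsilon> > 0 \<Longrightarrow> \<exists>N. \<forall>m\<ge>N. \<forall>n\<ge>N. nrm (x m - x n) < \<epsilon>"
  obtains u where "u \<in> H" "\<And>\<epsilon>. \<epsilon> > 0 \<Longrightarrow> \<exists>N. \<forall>n\<ge>N. nrm (x n - u) < \<epsilon>"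
proof -
  have "MCauchy x" using assms unfolding MCauchy_def by (auto simp: ip_dist_nrm)
  then obtain u where u: "limitin mtopology x u sequentially" using complete by (auto simp: mcomplete_def)
  then have "u \<in> H" and *: "\<And>\<epsilon>. \<epsilon> > 0 \<Longrightarrow> \<exists>N. \<forall>n\<ge>N. x n \<in> H \<and> ip_dist (x n) u < \<epsilon>"
    by (auto simp: limit_metric_sequentially)
  show ?thesis
    by (rule that[OF \<open>u \<in> H\<close>]) (use * assms(1) \<open>u \<in> H\<close> in \<open>simp add: ip_dist_nrm\<close>)
qed

text \<open>
  A sequence that minimises the distance to \<open>u\<close> is Cauchy by the parallelogram law, and its limit \<open>m\<close> is a nearest
  point. Moving \<open>m\<close> along \<open>v\<close> and along \<open>\<i> v\<close> cannot decrease the distance, which forces both the real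
  and the imaginary part of the inner product to vanish.
\<close>

theorem projection:
  assumes M: "M \<subseteq> H" "subspace M" "norm_closed M" and u: "u \<in> H"
  obtains m where "m \<in> M" "\<And>v. v \<in> M \<Longrightarrow> ip (u - m) v = 0"
proof -
  define D where "D = (\<lambda>m. (nrm (u - m))\<^sup>2) ` M"
  define d where "d = Inf D"
  have ne: "D \<noteq> {}" using subspace_0[OF M(2)] by (auto simp: D_def)
  have bd: "bdd_below D" by (rule bdd_belowI[of _ 0]) (auto simp: D_def)
  have low: "d \<le> (nrm (u - m))\<^sup>2" if "m \<in> M" for m
    unfolding d_def using that by (intro cInf_lower bd) (auto simp: D_def)
  have "\<exists>m\<in>M. (nrm (u - m))\<^sup>2 < d + 1 / real (Suc n)" for n
    using cInf_lessD[OF ne, of "d + 1 / real (Suc n)"] by (auto simp: d_def D_def)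
  then obtain x where x: "\<And>n. x n \<in> M" "\<And>n. (nrm (u - x n))\<^sup>2 < d + 1 / real (Suc n)" by metis
  have xH: "x n \<in> H" for n using x M by auto
  have gap: "(nrm (x k - x n))\<^sup>2 \<le> 2 / real (Suc n) + 2 / real (Suc k)" for n k
  proof -
    let ?h = "scale (1/2) (x n + x k)"
    have hM: "?h \<in> M" using x M by (intro subspace_scale subspace_add) auto
    have "(u - x n) + (u - x k) = scale 2 (u - ?h)"
    proof -
      have "scale 2 u = u + u" using scale_left_distrib[of 1 1 u] by simp
      then show ?thesis by (simp add: scale_right_diff_distrib)
    qed
    then have "nrm ((u - x n) + (u - x k)) = 2 * nrm (u - ?h)"
      using hM M u by (subst \<open>_ = scale 2 _\<close>, subst nrm_scale) (auto intro: H_diff)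
    then have "(nrm ((u - x n) + (u - x k)))\<^sup>2 \<ge> 4 * d"
      using low[OF hM] by (simp add: power_mult_distrib)
    moreover have "(u - x n) - (u - x k) = x k - x n" by simp
    ultimately show ?thesis
      using parallelogram[of "u - x n" "u - x k"] u xH H_diff x(2)[of n] x(2)[of k] by simp
  qed
  have "\<exists>N. \<forall>k\<ge>N. \<forall>n\<ge>N. nrm (x k - x n) < \<epsilon>" if e: "\<epsilon> > 0" for \<epsilon>
  proof -
    obtain N where N: "1 / real (Suc N) < \<epsilon>\<^sup>2 / 4" using nat_approx_posE[of "\<epsilon>\<^sup>2 / 4"] e by auto
    have "nrm (x k - x n) < \<epsilon>" if "k \<ge> N" "n \<ge> N" for k n
    proof (rule power_less_imp_less_base)
      have "1 / real (Suc k) \<le> 1 / real (Suc N)" "1 / real (Suc n) \<le> 1 / real (Suc N)"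
        using that by (auto intro!: frac_le)
      then show "(nrm (x k - x n))\<^sup>2 < \<epsilon>\<^sup>2" using gap[of k n] N by simp
    qed (use e in simp)
    then show ?thesis by blast
  qed
  then obtain m where m: "m \<in> H" "\<And>\<epsilon>. \<epsilon> > 0 \<Longrightarrow> \<exists>N. \<forall>n\<ge>N. nrm (x n - m) < \<epsilon>"
    using Cauchy_converges[of x] xH by metis
  have mM: "m \<in> M"
  proof -
    have "\<exists>y\<in>M. nrm (m - y) < \<epsilon>" if "\<epsilon> > 0" for \<epsilon>
      using m(2)[OF that] x(1) nrm_minus_commute[OF m(1) xH] by (metis order_refl)
    then show ?thesis using M(3) m(1) by (auto simp: norm_closed_def)
  qed
  have lim: "(\<lambda>n. nrm (x n - m)) \<longlonglongrightarrow> 0"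
    using m xH by (auto simp: LIMSEQ_def nrm_nonneg H_diff)
  have "nrm (u - m) \<le> sqrt (d + 1 / real (Suc n)) + nrm (x n - m)" for n
  proof -
    have "nrm (u - m) \<le> nrm (u - x n) + nrm (x n - m)" using u m xH by (intro nrm_diff_triangle)
    moreover have "nrm (u - x n) \<le> sqrt (d + 1 / real (Suc n))"
      using x(2)[of n] by (intro real_le_rsqrt) simp
    ultimately show ?thesis by simp
  qed
  moreover have "(\<lambda>n. sqrt (d + 1 / real (Suc n)) + nrm (x n - m)) \<longlonglongrightarrow> sqrt (d + 0) + 0"
    by (intro tendsto_add tendsto_real_sqrt tendsto_const lim)
       (use LIMSEQ_inverse_real_of_nat in \<open>simp add: inverse_eq_divide\<close>)
  ultimately have le: "nrm (u - m) \<le> sqrt d"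
    by (intro LIMSEQ_le_const[where X="\<lambda>n. sqrt (d + 1 / real (Suc n)) + nrm (x n - m)"]) auto
  have d0: "d \<ge> 0" unfolding d_def by (rule cInf_greatest[OF ne]) (auto simp: D_def)
  have umH: "u - m \<in> H" using u m by (rule_tac H_diff)
  have sq: "(nrm (u - m))\<^sup>2 \<le> d"
    using power_mono[OF le nrm_nonneg[OF umH], of 2] d0 by simp
  have Re0: "Re (ip (u - m) v) = 0" if v: "v \<in> M" for v
  proof -
    have vH: "v \<in> H" using v M by auto
    have *: "0 \<le> 2 * t * Re (ip (u - m) v) + t\<^sup>2 * Re (ip v v)" for t
    proof -
      have "m - scale (complex_of_real t) v \<in> M"
        using mM v M(2) by (intro subspace_diff subspace_scale)
      then have "d \<le> (nrm (u - (m - scale (complex_of_real t) v)))\<^sup>2" by (rule low)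
      also have "u - (m - scale (complex_of_real t) v) = (u - m) + scale (complex_of_real t) v" by simp
      also have "(nrm \<dots>)\<^sup>2 = Re (ip (u - m) (u - m)) + 2 * t * Re (ip (u - m) v) + t\<^sup>2 * Re (ip v v)"
        using Re_ip_expand[OF umH vH] by (simp add: nrm_sq H_add H_scale umH vH)
      finally show ?thesis using sq by (simp add: nrm_sq umH)
    qed
    let ?b = "Re (ip (u - m) v)" and ?c = "Re (ip v v)"
    have c0: "?c \<ge> 0" by (rule ip_nonneg[OF vH])
    \<comment> \<open>the optimal \<open>t\<close> is \<open>- b / c\<close>; \<open>c + 1\<close> avoids a case distinction on \<open>c = 0\<close>\<close>
    have "0 \<le> - 2 * ?b\<^sup>2 / (?c + 1) + ?b\<^sup>2 * ?c / (?c + 1)\<^sup>2"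
      using *[of "- ?b / (?c + 1)"] by (simp add: power2_eq_square field_simps)
    also have "\<dots> = - ?b\<^sup>2 * (?c + 2) / (?c + 1)\<^sup>2"
      using c0 by (simp add: divide_simps) (simp add: algebra_simps power2_eq_square)
    finally have "?b\<^sup>2 * (?c + 2) \<le> 0" using c0 by (simp add: divide_simps split: if_splits)
    then have "?b\<^sup>2 \<le> 0" using c0 by (simp add: mult_le_0_iff)
    then show ?thesis by simp
  qed
  have "ip (u - m) v = 0" if v: "v \<in> M" for v
  proof -
    have "Re (ip (u - m) (scale \<i> v)) = 0" using v M(2) by (intro Re0 subspace_scale)
    then have "Im (ip (u - m) v) = 0"
      using v M umH by (subst (asm) ip_scale_right) auto
    with Re0[OF v] show ?thesis by (simp add: complex_eq_iff)
  qed
  with mM that show ?thesis by blast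
qed

text \<open>
  The part of the Riesz representation theorem that matters for separability: for a bounded functional
  \<open>l \<noteq> 0\<close> take \<open>z\<close> orthogonal to its kernel. Then \<open>u - (l u / l z) z\<close> lies in the kernel, so \<open>u \<bottom> z\<close> gives \<open>l u = 0\<close>.
\<close>

lemma annihilator_representer:
  assumes add: "\<And>u v. u \<in> H \<Longrightarrow> v \<in> H \<Longrightarrow> l (u + v) = l u + l v"
    and scl: "\<And>c u. u \<in> H \<Longrightarrow> l (scale c u) = c * l u"
    and bd: "\<And>u. u \<in> H \<Longrightarrow> cmod (l u) \<le> C * nrm u"
  shows "\<exists>z\<in>H. \<forall>u\<in>H. ip u z = 0 \<longrightarrow> l u = (0::complex)"
proof (cases "\<exists>e\<in>H. l e \<noteq> 0")
  case False
  then show ?thesis using H_zero by blast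
next
  case True
  then obtain e where e: "e \<in> H" "l e \<noteq> 0" by blast
  have ldiff: "l (u - v) = l u - l v" if "u \<in> H" "v \<in> H" for u v
    using add[of "u - v" v] that H_diff by simp
  define M where "M = {u \<in> H. l u = 0}"
  have "subspace M"
    using add scl[of 0 0] scl by (auto simp: M_def subspace_def H_add H_scale H_zero)
  moreover have "norm_closed M"
    unfolding norm_closed_def
  proof (intro ballI impI)
    fix u assume u: "u \<in> H" and *: "\<forall>\<epsilon>>0. \<exists>m\<in>M. nrm (u - m) < \<epsilon>"
    have "cmod (l u) \<le> \<epsilon>" if "\<epsilon> > 0" for \<epsilon>
    proof -
      obtain m where m: "m \<in> H" "l m = 0" "nrm (u - m) < \<epsilon> / (\<bar>C\<bar> + 1)"
        using *[rule_format, of "\<epsilon> / (\<bar>C\<bar> + 1)"] \<open>\<epsilon> > 0\<close> by (auto simp: M_def)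
      have "cmod (l u) = cmod (l (u - m))" using u m by (simp add: ldiff)
      also have "\<dots> \<le> C * nrm (u - m)" using u m by (intro bd H_diff)
      also have "\<dots> \<le> (\<bar>C\<bar> + 1) * nrm (u - m)"
        using nrm_nonneg[OF H_diff[OF u m(1)]] by (intro mult_right_mono) auto
      also have "\<dots> \<le> \<epsilon>" using m(3) by (simp add: field_simps)
      finally show ?thesis .
    qed
    then have "cmod (l u) \<le> 0" using field_le_epsilon[of "cmod (l u)" 0] by simp
    then show "u \<in> M" using u by (simp add: M_def)
  qed
  ultimately obtain m where m: "m \<in> M" "\<And>v. v \<in> M \<Longrightarrow> ip (e - m) v = 0"
    using projection[of M e] e by (auto simp: M_def)
  define z where "z = e - m"
  have mH: "m \<in> H" "l m = 0" using m by (auto simp: M_def)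
  have z: "z \<in> H" "l z = l e" using e mH by (auto simp: z_def H_diff ldiff)
  have "l u = 0" if u: "u \<in> H" "ip u z = 0" for u
  proof -
    define c where "c = l u / l z"
    have "u - scale c z \<in> M"
      using u z e by (simp add: M_def H_diff H_scale ldiff scl c_def)
    then have "ip z (u - scale c z) = 0" using m(2) by (simp add: z_def)
    moreover have "ip z u = 0" using ip_commute[of z u] u z by simp
    ultimately have "cnj c * ip z z = 0"
      using u z by (simp add: ip_diff_right H_scale ip_scale_right)
    moreover have "ip z z \<noteq> 0"
    proof
      assume "ip z z = 0"
      then have "z = 0" using ip_definite z by blast
      then show False using scl[of 0 0] e z H_zero by simp
    qed
    ultimately show ?thesis using z e by (simp add: c_def)
  qed
  then show ?thesis using z by blast
qed

text \<open>
  Linear combinations are indexed by lists of coefficient--vector pairs, so that those with coefficients and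
  vectors from countable sets visibly form a countable set.
\<close>

definition lin_comb :: "(complex \<times> 'a) list \<Rightarrow> 'a" where
  "lin_comb xs = foldr (\<lambda>(q, z) s. scale q z + s) xs 0"

lemma lin_comb_append: "lin_comb (xs @ ys) = lin_comb xs + lin_comb ys"
  by (induction xs) (auto simp: lin_comb_def add.assoc)

lemma scale_lin_comb: "scale q (lin_comb xs) = lin_comb (map (\<lambda>(c, z). (q * c, z)) xs)"
  by (induction xs) (auto simp: lin_comb_def scale_right_distrib)

lemma lin_comb_in_H: "set xs \<subseteq> UNIV \<times> H \<Longrightarrow> lin_comb xs \<in> H"
  by (induction xs) (auto simp: lin_comb_def H_zero H_add H_scale)

text \<open>
  The dense set consists of the combinations, with coefficients in \<open>\<rat> + \<i>\<rat>\<close>, of the vectors that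
  \<open>annihilator_representer\<close> attaches to the functionals. Its closure is a closed complex subspace; a vector
  orthogonal to it is annihilated by every functional and hence zero.
\<close>

theorem separable_if_separating_functionals:
  fixes l :: "'i \<Rightarrow> 'a \<Rightarrow> complex"
  assumes P: "countable P"
    and add: "\<And>p u v. p \<in> P \<Longrightarrow> u \<in> H \<Longrightarrow> v \<in> H \<Longrightarrow> l p (u + v) = l p u + l p v"
    and scl: "\<And>p c u. p \<in> P \<Longrightarrow> u \<in> H \<Longrightarrow> l p (scale c u) = c * l p u"
    and bd: "\<And>p. p \<in> P \<Longrightarrow> \<exists>C. \<forall>u\<in>H. cmod (l p u) \<le> C * nrm u"
    and sep: "\<And>u. u \<in> H \<Longrightarrow> (\<And>p. p \<in> P \<Longrightarrow> l p u = 0) \<Longrightarrow> u = 0"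
  shows "separable_space mtopology"
proof -
  have "\<forall>p\<in>P. \<exists>z\<in>H. \<forall>u\<in>H. ip u z = 0 \<longrightarrow> l p u = 0"
  proof
    fix p assume p: "p \<in> P"
    obtain C where "\<And>u. u \<in> H \<Longrightarrow> cmod (l p u) \<le> C * nrm u" using bd[OF p] by blast
    then show "\<exists>z\<in>H. \<forall>u\<in>H. ip u z = 0 \<longrightarrow> l p u = 0"
      using add[OF p] scl[OF p] annihilator_representer[of "l p" C] by blast
  qed
  then obtain z where z: "\<And>p. p \<in> P \<Longrightarrow> z p \<in> H"
    and zl: "\<And>p u. p \<in> P \<Longrightarrow> u \<in> H \<Longrightarrow> ip u (z p) = 0 \<Longrightarrow> l p u = 0"
    by metis
  define Q where "Q = (\<lambda>(a, b). Complex a b) ` (\<rat> \<times> \<rat>)"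
  have Q_mult: "p * q \<in> Q" if "p \<in> Q" "q \<in> Q" for p q
    using that by (auto simp: Q_def image_iff complex_eq_iff intro!: bexI[of _ "(Re (p * q), Im (p * q))"])
  have Q_dense: "\<exists>q\<in>Q. cmod (c - q) < \<epsilon>" if "\<epsilon> > 0" for c \<epsilon>
  proof -
    obtain a b where ab: "a \<in> \<rat>" "Re c < a" "a < Re c + \<epsilon> / 2" "b \<in> \<rat>" "Im c < b" "b < Im c + \<epsilon> / 2"
      using Rats_dense_in_real[of "Re c" "Re c + \<epsilon> / 2"] Rats_dense_in_real[of "Im c" "Im c + \<epsilon> / 2"] \<open>\<epsilon> > 0\<close> by auto
    have "cmod (c - Complex a b) \<le> \<bar>Re (c - Complex a b)\<bar> + \<bar>Im (c - Complex a b)\<bar>" by (rule cmod_le)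
    also have "\<dots> < \<epsilon>" using ab by simp
    finally show ?thesis using ab by (auto simp: Q_def intro!: bexI[of _ "Complex a b"])
  qed
  define D where "D = lin_comb ` lists (Q \<times> z ` P)"
  have cD: "countable D"
    unfolding D_def Q_def using P by (intro countable_image countable_lists countable_SIGMA) (auto simp: countable_rat)
  have DH: "D \<subseteq> H"
    using z by (auto simp: D_def lists_eq_set intro!: lin_comb_in_H)
  have D_add: "u + v \<in> D" if "u \<in> D" "v \<in> D" for u v
    using that unfolding D_def
    by (elim imageE) (metis append_in_lists_conv lin_comb_append imageI)
  have D_scale: "scale q u \<in> D" if "q \<in> Q" "u \<in> D" for q u
  proof -
    obtain xs where xs: "xs \<in> lists (Q \<times> z ` P)" "u = lin_comb xs" using \<open>u \<in> D\<close> by (auto simp: D_def)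
    have "map (\<lambda>(c, z). (q * c, z)) xs \<in> lists (Q \<times> z ` P)"
      using xs(1) Q_mult[OF \<open>q \<in> Q\<close>] by (auto simp: lists_eq_set)
    then show ?thesis unfolding D_def xs(2) scale_lin_comb by (rule imageI)
  qed
  define M where "M = {u \<in> H. \<forall>\<epsilon>>0. \<exists>d\<in>D. nrm (u - d) < \<epsilon>}"
  have MH: "M \<subseteq> H" by (auto simp: M_def)
  have DM: "D \<subseteq> M" using DH nrm_zero by (force simp: M_def)
  have "subspace M"
    unfolding subspace_def
  proof (intro conjI ballI allI)
    have "lin_comb [] \<in> D" unfolding D_def by (rule imageI) auto
    then show "0 \<in> M" using DM by (auto simp: lin_comb_def)
  next
    fix u v assume u: "u \<in> M" and v: "v \<in> M"
    have uvH: "u \<in> H" "v \<in> H" using u v MH by auto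
    have "\<exists>d\<in>D. nrm (u + v - d) < \<epsilon>" if "\<epsilon> > 0" for \<epsilon>
    proof -
      obtain a b where ab: "a \<in> D" "nrm (u - a) < \<epsilon> / 2" "b \<in> D" "nrm (v - b) < \<epsilon> / 2"
        using u v \<open>\<epsilon> > 0\<close> by (force simp: M_def dest: spec[of _ "\<epsilon> / 2"])
      have "nrm (u + v - (a + b)) = nrm ((u - a) + (v - b))" by (simp add: algebra_simps)
      also have "\<dots> \<le> nrm (u - a) + nrm (v - b)"
        using uvH ab DH by (intro nrm_triangle H_diff) auto
      finally show ?thesis using ab D_add[of a b] by (intro bexI[of _ "a + b"]) auto
    qed
    then show "u + v \<in> M" using uvH by (simp add: M_def H_add)
  next
    fix c u assume u: "u \<in> M"
    then have uH: "u \<in> H" using MH by auto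
    have "\<exists>d\<in>D. nrm (scale c u - d) < \<epsilon>" if "\<epsilon> > 0" for \<epsilon>
    proof -
      obtain a where a: "a \<in> D" "nrm (u - a) < \<epsilon> / (2 * (cmod c + 1))"
        using u \<open>\<epsilon> > 0\<close> unfolding M_def
        by (auto dest!: spec[of _ "\<epsilon> / (2 * (cmod c + 1))"] simp: add_nonneg_pos)
      have aH: "a \<in> H" using a DH by auto
      have na: "nrm a \<ge> 0" by (rule nrm_nonneg[OF aH])
      obtain q where q: "q \<in> Q" "cmod (c - q) < \<epsilon> / (2 * (nrm a + 1))"
        using Q_dense[of "\<epsilon> / (2 * (nrm a + 1))" c] \<open>\<epsilon> > 0\<close> na by auto
      have "nrm (scale c u - scale q a) = nrm (scale c (u - a) + scale (c - q) a)"
        by (simp add: scale_right_diff_distrib scale_left_diff_distrib)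
      also have "\<dots> \<le> nrm (scale c (u - a)) + nrm (scale (c - q) a)"
        using uH aH by (intro nrm_triangle H_scale H_diff)
      also have "\<dots> = cmod c * nrm (u - a) + cmod (c - q) * nrm a"
        using uH aH by (simp add: nrm_scale H_diff)
      also have "\<dots> < \<epsilon> / 2 + \<epsilon> / 2"
      proof (rule add_less_le_mono)
        have "cmod c * nrm (u - a) \<le> cmod c * (\<epsilon> / (2 * (cmod c + 1)))"
          using a(2) by (intro mult_left_mono) auto
        also have "\<dots> < \<epsilon> / 2"
          using \<open>\<epsilon> > 0\<close> by (simp add: divide_simps add_nonneg_pos add_nonneg_eq_0_iff)
        finally show "cmod c * nrm (u - a) < \<epsilon> / 2" .
        have "cmod (c - q) * nrm a \<le> \<epsilon> / (2 * (nrm a + 1)) * nrm a"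
          using q(2) na by (intro mult_right_mono) auto
        also have "\<dots> \<le> \<epsilon> / 2" using \<open>\<epsilon> > 0\<close> na by (simp add: divide_simps)
        finally show "cmod (c - q) * nrm a \<le> \<epsilon> / 2" .
      qed
      finally show ?thesis using D_scale[OF q(1) a(1)] by auto
    qed
    then show "scale c u \<in> M" using uH by (simp add: M_def H_scale)
  qed
  moreover have "norm_closed M"
    unfolding norm_closed_def
  proof (intro ballI impI)
    fix u assume u: "u \<in> H" and *: "\<forall>\<epsilon>>0. \<exists>m\<in>M. nrm (u - m) < \<epsilon>"
    have "\<exists>d\<in>D. nrm (u - d) < \<epsilon>" if "\<epsilon> > 0" for \<epsilon>
    proof -
      obtain m where m: "m \<in> M" "nrm (u - m) < \<epsilon> / 2" using * \<open>\<epsilon> > 0\<close> half_gt_zero by blast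
      then obtain d where d: "d \<in> D" "nrm (m - d) < \<epsilon> / 2" using \<open>\<epsilon> > 0\<close> half_gt_zero unfolding M_def by blast
      have "nrm (u - d) \<le> nrm (u - m) + nrm (m - d)"
        using u m d MH DH by (intro nrm_diff_triangle) auto
      then show ?thesis using m d by (intro bexI[of _ d]) auto
    qed
    then show "u \<in> M" using u by (simp add: M_def)
  qed
  ultimately have sub: "H \<subseteq> M"
  proof (intro subsetI)
    fix u assume u: "u \<in> H" and "subspace M" "norm_closed M"
    then obtain m where m: "m \<in> M" "\<And>v. v \<in> M \<Longrightarrow> ip (u - m) v = 0" using projection[OF MH] by metis
    have w: "u - m \<in> H" using u m MH by (auto intro: H_diff)
    have "u - m = 0"
    proof (rule sep[OF w])
      fix p assume p: "p \<in> P"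
      \<comment> \<open>only some nonzero coefficient is needed to place a multiple of \<open>z p\<close> in the dense set\<close>
      obtain q where q: "q \<in> Q" "cmod (1 - q) < 1" using Q_dense[of 1 1] by auto
      have q0: "q \<noteq> 0" using q(2) by auto
      have "lin_comb [(q, z p)] \<in> D" unfolding D_def by (rule imageI) (use q p in auto)
      then have "scale q (z p) \<in> M" using DM by (auto simp: lin_comb_def)
      then have "cnj q * ip (u - m) (z p) = 0" using m(2) w z[OF p] by (metis ip_scale_right)
      then have "ip (u - m) (z p) = 0" using q0 by simp
      then show "l p (u - m) = 0" using zl p w by blast
    qed
    then show "u \<in> M" using m by simp
  qed
  show ?thesis
    unfolding separable_space_def
  proof (intro exI[of _ D] conjI cD)
    show "D \<subseteq> topspace mtopology" using DH by simp
    show "mtopology closure_of D = topspace mtopology"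
    proof -
      have "\<exists>y\<in>D. y \<in> mball u r" if u: "u \<in> H" and r: "r > 0" for u r
      proof -
        obtain d where "d \<in> D" "nrm (u - d) < r" using sub u r by (auto simp: M_def)
        then show ?thesis using u DH by (intro bexI[of _ d]) (auto simp: ip_dist_nrm subset_iff)
      qed
      then show ?thesis by (auto simp: metric_closure_of)
    qed
  qed
qed

end

section \<open>Square-integrable functions\<close>

text \<open>
  With \<open>\<Delta>\<close> for the increments, the integral of \<open>\<Sum> 4\<^sup>n \<bar>\<Delta>\<^sub>n\<bar>\<^sup>2\<close> is at most \<open>\<Sum> 2\<^sup>-\<^sup>n\<close>. Where that series is finite,
  with sum \<open>C\<close>, the increments satisfy \<open>\<bar>\<Delta>\<^sub>n\<bar> \<le> \<surd>C 2\<^sup>-\<^sup>n\<close> and are summable.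
\<close>

lemma AE_convergent_if_square_sums:
  fixes f :: "nat \<Rightarrow> 'a \<Rightarrow> complex"
  assumes m[measurable]: "\<And>n. f n \<in> borel_measurable M"
    and b: "\<And>n. (\<integral>\<^sup>+x. ennreal ((cmod (f (Suc n) x - f n x))\<^sup>2) \<partial>M) \<le> ennreal ((1/8) ^ n)"
  shows "AE x in M. convergent (\<lambda>n. f n x)"
proof -
  define T where "T n x = 4 ^ n * (cmod (f (Suc n) x - f n x))\<^sup>2" for n x
  have T0: "T n x \<ge> 0" for n x by (simp add: T_def)
  have [measurable]: "T n \<in> borel_measurable M" for n unfolding T_def by measurable
  have "(\<integral>\<^sup>+x. (\<Sum>n. ennreal (T n x)) \<partial>M) = (\<Sum>n. \<integral>\<^sup>+x. ennreal (T n x) \<partial>M)"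
    by (rule nn_integral_suminf) measurable
  also have "\<dots> \<le> (\<Sum>n. ennreal ((1/2) ^ n))"
  proof (intro suminf_le allI)
    fix n
    have "(\<integral>\<^sup>+x. ennreal (T n x) \<partial>M) = ennreal (4 ^ n) * (\<integral>\<^sup>+x. ennreal ((cmod (f (Suc n) x - f n x))\<^sup>2) \<partial>M)"
      by (simp add: T_def ennreal_mult nn_integral_cmult)
    also have "\<dots> \<le> ennreal (4 ^ n) * ennreal ((1/8) ^ n)" by (intro mult_left_mono b) simp
    also have "\<dots> = ennreal ((4 * (1/8)) ^ n)" by (simp only: power_mult_distrib) (simp add: ennreal_mult)
    finally show "(\<integral>\<^sup>+x. ennreal (T n x) \<partial>M) \<le> ennreal ((1/2) ^ n)" by simp
  qed auto
  also have "\<dots> = ennreal (\<Sum>n. (1/2) ^ n)"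
    by (rule suminf_ennreal2) (auto intro: summable_geometric)
  finally have "(\<integral>\<^sup>+x. (\<Sum>n. ennreal (T n x)) \<partial>M) \<noteq> \<infinity>"
    by (auto simp: top_unique)
  then have "AE x in M. (\<Sum>n. ennreal (T n x)) \<noteq> \<infinity>"
    by (intro nn_integral_PInf_AE) measurable
  then show ?thesis
  proof eventually_elim
    case (elim x)
    then obtain C where C: "C \<ge> 0" "(\<Sum>n. ennreal (T n x)) = ennreal C"
      by (metis ennreal_cases infinity_ennreal_def)
    have TC: "T n x \<le> C" for n
    proof -
      have "ennreal (T n x) \<le> (\<Sum>n. ennreal (T n x))"
        using sum_le_suminf[of "\<lambda>n. ennreal (T n x)" "{n}"] by simp
      then show ?thesis using C by (simp add: ennreal_le_iff)
    qed
    have step: "cmod (f (Suc n) x - f n x) \<le> sqrt C * (1/2) ^ n" for n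
    proof (rule power2_le_imp_le)
      have "(2::real) ^ n * 2 ^ n = 4 ^ n" by (simp flip: power_mult_distrib)
      then have eq: "(sqrt C * (1/2) ^ n)\<^sup>2 = C / 4 ^ n"
        using C by (simp add: power_mult_distrib power_one_over power2_eq_square)
      show "(cmod (f (Suc n) x - f n x))\<^sup>2 \<le> (sqrt C * (1/2) ^ n)\<^sup>2"
        unfolding eq using TC[of n] by (simp add: T_def pos_le_divide_eq mult.commute)
    qed (use C in auto)
    have "summable (\<lambda>n. sqrt C * (1/2) ^ n)"
      by (rule summable_mult[OF summable_geometric]) simp
    then have "summable (\<lambda>n. f (Suc n) x - f n x)"
      by (rule summable_comparison_test') (rule step)
    then have "(\<lambda>n. \<Sum>i<n. f (Suc i) x - f i x) \<longlonglongrightarrow> (\<Sum>i. f (Suc i) x - f i x)"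
      by (rule summable_LIMSEQ)
    then have "(\<lambda>n. f n x - f 0 x) \<longlonglongrightarrow> (\<Sum>i. f (Suc i) x - f i x)"
      by (simp only: sum_lessThan_telescope[of "\<lambda>n. f n x"])
    then have "(\<lambda>n. (f n x - f 0 x) + f 0 x) \<longlonglongrightarrow> (\<Sum>i. f (Suc i) x - f i x) + f 0 x"
      by (intro tendsto_add tendsto_const)
    then show ?case by (auto simp: convergent_def)
  qed
qed

lemma Fatou_bound:
  assumes m: "\<And>k. F k \<in> borel_measurable M"
    and c: "AE x in M. (\<lambda>k. F k x) \<longlonglongrightarrow> (G x :: real)"
    and b: "\<And>k. k \<ge> K \<Longrightarrow> (\<integral>\<^sup>+x. ennreal (F k x) \<partial>M) \<le> B"
  shows "(\<integral>\<^sup>+x. ennreal (G x) \<partial>M) \<le> B"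
proof -
  have "AE x in M. liminf (\<lambda>k. ennreal (F k x)) = ennreal (G x)"
    using c by eventually_elim (auto intro!: lim_imp_Liminf tendsto_ennrealI)
  then have "(\<integral>\<^sup>+x. ennreal (G x) \<partial>M) = (\<integral>\<^sup>+x. liminf (\<lambda>k. ennreal (F k x)) \<partial>M)"
    by (intro nn_integral_cong_AE) (auto elim: eventually_mono)
  also have "\<dots> \<le> liminf (\<lambda>k. \<integral>\<^sup>+x. ennreal (F k x) \<partial>M)"
    using m by (intro nn_integral_liminf) measurable
  also have "\<dots> \<le> limsup (\<lambda>k. \<integral>\<^sup>+x. ennreal (F k x) \<partial>M)"
    by (rule Liminf_le_Limsup) simp
  also have "\<dots> \<le> B"
    by (rule Limsup_bounded) (use b in \<open>auto simp: eventually_sequentially\<close>)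
  finally show ?thesis .
qed

lemma mult_le_sum_squares:
  fixes a b :: real
  assumes "a \<ge> 0" "b \<ge> 0" shows "a * b \<le> a\<^sup>2 + b\<^sup>2"
proof -
  have "0 \<le> a * b" using assms by simp
  moreover have "2 * (a * b) \<le> a\<^sup>2 + b\<^sup>2"
    using sum_squares_bound[of a b] by (simp only: mult.assoc)
  ultimately show ?thesis by linarith
qed

lemma cmod_add_square_le: "(cmod (x + y))\<^sup>2 \<le> 2 * (cmod x)\<^sup>2 + 2 * (cmod y)\<^sup>2"
proof -
  have "(cmod (x + y))\<^sup>2 \<le> (cmod x + cmod y)\<^sup>2"
    by (intro power_mono norm_triangle_ineq) simp
  also have "\<dots> \<le> 2 * (cmod x)\<^sup>2 + 2 * (cmod y)\<^sup>2"
    using sum_squares_bound[of "cmod x" "cmod y"] by (simp add: power2_sum)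
  finally show ?thesis .
qed

lemma integrable_product_of_squares:
  fixes f g :: "'a \<Rightarrow> 'b::{banach, second_countable_topology, real_normed_algebra}"
  assumes [measurable]: "f \<in> borel_measurable M" "g \<in> borel_measurable M"
    and i: "integrable M (\<lambda>x. (norm (f x))\<^sup>2)" "integrable M (\<lambda>x. (norm (g x))\<^sup>2)"
  shows "integrable M (\<lambda>x. f x * g x)"
proof (rule Bochner_Integration.integrable_bound)
  show "integrable M (\<lambda>x. (norm (f x))\<^sup>2 + (norm (g x))\<^sup>2)" using i by simp
  show "AE x in M. norm (f x * g x) \<le> norm ((norm (f x))\<^sup>2 + (norm (g x))\<^sup>2)"
  proof (rule AE_I2)
    fix x
    have "norm (f x * g x) \<le> norm (f x) * norm (g x)" by (rule norm_mult_ineq)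
    also have "\<dots> \<le> (norm (f x))\<^sup>2 + (norm (g x))\<^sup>2" by (intro mult_le_sum_squares) auto
    finally show "norm (f x * g x) \<le> norm ((norm (f x))\<^sup>2 + (norm (g x))\<^sup>2)" by simp
  qed
qed measurable

lemma Cauchy_Schwarz_integral:
  fixes f g :: "'a \<Rightarrow> real"
  assumes m[measurable]: "f \<in> borel_measurable M" "g \<in> borel_measurable M"
    and i: "integrable M (\<lambda>x. (f x)\<^sup>2)" "integrable M (\<lambda>x. (g x)\<^sup>2)"
    and nn: "\<And>x. f x \<ge> 0" "\<And>x. g x \<ge> 0"
  shows "(\<integral>x. f x * g x \<partial>M) \<le> sqrt (\<integral>x. (f x)\<^sup>2 \<partial>M) * sqrt (\<integral>x. (g x)\<^sup>2 \<partial>M)"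
proof -
  have ifg: "integrable M (\<lambda>x. f x * g x)"
    using i by (intro integrable_product_of_squares) simp_all
  have "(\<integral>\<^sup>+x. ennreal (f x) * ennreal (g x) \<partial>M)\<^sup>2
      \<le> (\<integral>\<^sup>+x. (ennreal (f x))\<^sup>2 \<partial>M) * (\<integral>\<^sup>+x. (ennreal (g x))\<^sup>2 \<partial>M)"
    by (rule Cauchy_Schwarz_nn_integral) measurable
  then have "(\<integral>\<^sup>+x. ennreal (f x * g x) \<partial>M)\<^sup>2
      \<le> (\<integral>\<^sup>+x. ennreal ((f x)\<^sup>2) \<partial>M) * (\<integral>\<^sup>+x. ennreal ((g x)\<^sup>2) \<partial>M)"
    using nn by (simp add: ennreal_mult ennreal_power)
  then have "ennreal ((\<integral>x. f x * g x \<partial>M)\<^sup>2)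
      \<le> ennreal ((\<integral>x. (f x)\<^sup>2 \<partial>M) * (\<integral>x. (g x)\<^sup>2 \<partial>M))"
    using nn by (subst (asm) nn_integral_eq_integral[OF ifg], simp,
        subst (asm) nn_integral_eq_integral[OF i(1)], simp,
        subst (asm) nn_integral_eq_integral[OF i(2)], simp)
      (simp add: ennreal_mult ennreal_power)
  then have "(\<integral>x. f x * g x \<partial>M)\<^sup>2 \<le> (\<integral>x. (f x)\<^sup>2 \<partial>M) * (\<integral>x. (g x)\<^sup>2 \<partial>M)"
    by (subst (asm) ennreal_le_iff) auto
  then show ?thesis by (simp add: real_le_rsqrt flip: real_sqrt_mult)
qed

lemma compact_lebesgue: "compact (K :: real set) \<Longrightarrow> K \<in> sets lebesgue"
  by (simp add: borel_compact sets_completionI_sets)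

lemma integrable_indicator_compact:
  "compact (K :: real set) \<Longrightarrow> integrable lebesgue (indicator K :: real \<Rightarrow> real)"
  using lmeasurable_compact by (simp add: lmeasurable_iff_integrable)

lemma square_integrable_on_compact:
  fixes h :: "real \<Rightarrow> complex"
  assumes K: "compact K" and h: "h \<in> borel_measurable lebesgue" "integrable lebesgue (\<lambda>x. (cmod (h x))\<^sup>2)"
  shows "set_integrable lebesgue K h"
    and "(LINT x:K|lebesgue. cmod (h x)) \<le> sqrt (\<integral>x. (cmod (h x))\<^sup>2 \<partial>lebesgue) * sqrt (measure lebesgue K)"
proof -
  note Kf = integrable_indicator_compact[OF K] and Km = compact_lebesgue[OF K]
  have sqK: "(indicator K x :: real)\<^sup>2 = indicator K x" for x by (simp add: indicator_def)
  have i1: "integrable lebesgue (\<lambda>x. cmod (h x) * indicator K x)"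
    by (rule integrable_product_of_squares) (use h Kf Km in \<open>simp_all add: sqK\<close>)
  show "set_integrable lebesgue K h"
    unfolding set_integrable_def
    by (rule Bochner_Integration.integrable_bound[OF i1])
       (use h(1) Km in \<open>auto intro!: borel_measurable_scaleR AE_I2 simp: indicator_def\<close>)
  have "(LINT x:K|lebesgue. cmod (h x)) = (\<integral>x. cmod (h x) * indicator K x \<partial>lebesgue)"
    by (simp add: set_lebesgue_integral_def mult.commute)
  also have "\<dots> \<le> sqrt (\<integral>x. (cmod (h x))\<^sup>2 \<partial>lebesgue) * sqrt (\<integral>x. (indicator K x)\<^sup>2 \<partial>lebesgue)"
    by (rule Cauchy_Schwarz_integral) (use h Kf Km in \<open>simp_all add: sqK\<close>)
  finally show "(LINT x:K|lebesgue. cmod (h x)) \<le> sqrt (\<integral>x. (cmod (h x))\<^sup>2 \<partial>lebesgue) * sqrt (measure lebesgue K)"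
    by (simp add: sqK)
qed

lemma LIMSEQ_0_if_eventually_le_multiple:
  fixes b :: "nat \<Rightarrow> real"
  assumes b: "\<And>\<epsilon>. \<epsilon> > 0 \<Longrightarrow> \<exists>N. \<forall>n\<ge>N. b n \<le> \<epsilon> * c" and c: "c \<ge> 0" and pos: "\<And>n. b n \<ge> 0"
  shows "b \<longlonglongrightarrow> 0"
proof (rule LIMSEQ_I)
  fix r :: real assume r: "r > 0"
  then obtain N where N: "\<And>n. n \<ge> N \<Longrightarrow> b n \<le> r / (c + 1) * c"
    using b[of "r / (c + 1)"] c by auto
  have "r / (c + 1) * c < r" using r c by (simp add: divide_simps)
  then show "\<exists>N. \<forall>n\<ge>N. norm (b n - 0) < r"
    using N pos by (intro exI[of _ N]) (auto intro: order_le_less_trans)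
qed

section \<open>The metric of a locally finite graph\<close>

lemma path_length_trans:
  assumes "is_path_length G p q L" "is_path_length G q r L'"
  shows "is_path_length G p r (L + L')"
  using assms
proof (induction rule: is_path_length.induct)
  case (step e x y q L)
  then show ?case using is_path_length.step[OF step.hyps(1-3), of r "L + L'"] by (simp add: add.assoc)
qed simp

lemma edge_point_in_graph:
  "e \<in> edges G \<Longrightarrow> x \<in> edge_interval G e \<Longrightarrow> edge_point G e x \<in> graph_points G"
  by (auto simp: graph_points_def)

lemma path_length_edge:
  assumes "e \<in> edges G" "x \<in> edge_interval G e" "y \<in> edge_interval G e"
  shows "is_path_length G (edge_point G e x) (edge_point G e y) \<bar>x - y\<bar>"
  using is_path_length.step[OF assms is_path_length.refl[OF edge_point_in_graph[OF assms(1,3)]]] by simp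

lemma path_length_sym: "is_path_length G p q L \<Longrightarrow> is_path_length G q p L"
proof (induction rule: is_path_length.induct)
  case (step e x y q L)
  have "is_path_length G q (edge_point G e x) (L + \<bar>y - x\<bar>)"
    by (rule path_length_trans[OF step.IH path_length_edge]) (use step in auto)
  then show ?case by (simp add: add.commute abs_minus_commute)
qed (rule is_path_length.refl)

lemma path_length_nonneg: "is_path_length G p q L \<Longrightarrow> 0 \<le> L"
  by (induction rule: is_path_length.induct) auto

lemma path_length_points:
  "is_path_length G p q L \<Longrightarrow> p \<in> graph_points G \<and> q \<in> graph_points G"
  by (induction rule: is_path_length.induct) (auto simp: edge_point_in_graph)

lemma edge_interval_0: "wf_metric_graph G \<Longrightarrow> e \<in> edges G \<Longrightarrow> 0 \<in> edge_interval G e"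
  by (auto simp: edge_interval_def wf_metric_graph_def zero_ereal_def[symmetric] less_imp_le)

lemma edge_len_cases:
  assumes "wf_metric_graph G" "e \<in> edges G"
  obtains l where "l > 0" "len G e = ereal l" "e \<in> bounded_edges G" | "len G e = \<infinity>" "e \<notin> bounded_edges G"
  using assms by (cases "len G e") (auto simp: wf_metric_graph_def bounded_edges_def)

lemma bounded_edge_len:
  assumes "wf_metric_graph G" "e \<in> bounded_edges G"
  obtains l where "l > 0" "len G e = ereal l"
  using assms by (cases "len G e") (auto simp: wf_metric_graph_def bounded_edges_def)

lemma path_exists:
  assumes wf: "wf_metric_graph G" and con: "connected_metric_graph G"
    and p: "p \<in> graph_points G" and q: "q \<in> graph_points G"
  shows "\<exists>L. is_path_length G p q L"
proof -
  define R where "R = {(src G e, tgt G e) | e. e \<in> bounded_edges G}"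
  have to_vertex: "\<exists>v\<in>verts G. \<exists>L. is_path_length G p (Vertex v) L" if p: "p \<in> graph_points G" for p
  proof -
    obtain e x where e: "e \<in> edges G" "x \<in> edge_interval G e" "p = edge_point G e x"
      using p by (auto simp: graph_points_def)
    have "is_path_length G p (Vertex (src G e)) \<bar>x - 0\<bar>"
      using path_length_edge[OF e(1,2) edge_interval_0[OF wf e(1)]] by (simp add: e edge_point_def)
    then show ?thesis using wf e by (auto simp: wf_metric_graph_def)
  qed
  obtain v where v: "v \<in> verts G" "\<exists>L. is_path_length G p (Vertex v) L" using to_vertex[OF p] by blast
  obtain w where w: "w \<in> verts G" "\<exists>L. is_path_length G q (Vertex w) L" using to_vertex[OF q] by blast
  have "(v, w) \<in> (R \<union> R\<inverse>)\<^sup>*" using con v w by (auto simp: connected_metric_graph_def R_def Let_def)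
  then have "\<exists>L. is_path_length G p (Vertex w) L"
  proof (induction rule: rtrancl_induct)
    case base
    show ?case by (rule v)
  next
    case (step y z)
    then obtain e where e: "e \<in> bounded_edges G"
      and yz: "y = src G e \<and> z = tgt G e \<or> y = tgt G e \<and> z = src G e"
      by (auto simp: R_def)
    have eE: "e \<in> edges G" using e by (simp add: bounded_edges_def)
    obtain l where l: "l > 0" "len G e = ereal l"
      by (rule bounded_edge_len[OF wf e])
    have "is_path_length G (edge_point G e 0) (edge_point G e l) \<bar>0 - l\<bar>"
      by (rule path_length_edge[OF eE]) (use l in \<open>auto simp: edge_interval_def\<close>)
    then have "is_path_length G (Vertex (src G e)) (Vertex (tgt G e)) l"
      using l by (simp add: edge_point_def)
    then have "is_path_length G (Vertex y) (Vertex z) l" using yz path_length_sym by blast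
    then show ?case using step.IH path_length_trans by blast
  qed
  then show ?thesis using w path_length_sym path_length_trans by blast
qed

locale loc_finite_graph =
  fixes G :: "('v, 'e) metric_graph"
  assumes wf: "wf_metric_graph G" and connected: "connected_metric_graph G"
    and loc_fin: "locally_finite_graph G"
begin

abbreviation "X \<equiv> graph_points G"
abbreviation "dG \<equiv> graph_dist G"

lemma dist_le_path: "is_path_length G p q L \<Longrightarrow> dG p q \<le> L"
  unfolding graph_dist_def using path_length_points
  by (auto intro!: cInf_lower bdd_belowI[of _ 0] dest: path_length_nonneg)

lemma dist_greatest:
  assumes "p \<in> X" "q \<in> X" "\<And>L. is_path_length G p q L \<Longrightarrow> c \<le> L"
  shows "c \<le> dG p q"
  using assms path_exists[OF wf connected assms(1,2)]
  by (auto simp: graph_dist_def intro!: cInf_greatest)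

lemma dist_nonneg: "0 \<le> dG p q"
proof (cases "p \<in> X \<and> q \<in> X")
  case True
  then show ?thesis by (intro dist_greatest path_length_nonneg) auto
qed (auto simp: graph_dist_def)

lemma dist_commute: "dG p q = dG q p"
proof -
  have "is_path_length G p q = is_path_length G q p"
    using path_length_sym by blast
  then show ?thesis by (simp add: graph_dist_def conj_commute)
qed

lemma dist_self: "p \<in> X \<Longrightarrow> dG p p = 0"
  using dist_le_path[OF is_path_length.refl] dist_nonneg[of p p] by fastforce

lemma dist_triangle:
  assumes "p \<in> X" "q \<in> X" "r \<in> X"
  shows "dG p r \<le> dG p q + dG q r"
proof -
  have "dG p r - dG q r \<le> dG p q"
  proof (rule dist_greatest[OF assms(1,2)])
    fix L assume L: "is_path_length G p q L"
    have "dG p r - L \<le> dG q r"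
    proof (rule dist_greatest[OF assms(2,3)])
      fix L' assume "is_path_length G q r L'"
      from dist_le_path[OF path_length_trans[OF L this]] show "dG p r - L \<le> L'" by simp
    qed
    then show "dG p r - dG q r \<le> L" by simp
  qed
  then show ?thesis by simp
qed

text \<open>
  Lower bounds for the distance come from functions that are 1-Lipschitz on every edge: such a function
  cannot change by more than the length along any path.
\<close>

lemma Lipschitz_le_dist:
  assumes lip: "\<And>e x y. e \<in> edges G \<Longrightarrow> x \<in> edge_interval G e \<Longrightarrow> y \<in> edge_interval G e \<Longrightarrow>
      h (edge_point G e x) - h (edge_point G e y) \<le> \<bar>x - y\<bar>"
    and p: "p \<in> X" and q: "q \<in> X"
  shows "h p - h q \<le> dG p q"
proof (rule dist_greatest[OF p q])
  fix L assume "is_path_length G p q L"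
  then show "h p - h q \<le> L"
  proof (induction rule: is_path_length.induct)
    case (step e x y q L)
    then show ?case using lip[OF step.hyps(1-3)] by simp
  qed simp
qed

lemma dist_edge_le:
  "e \<in> edges G \<Longrightarrow> x \<in> edge_interval G e \<Longrightarrow> y \<in> edge_interval G e \<Longrightarrow>
    dG (edge_point G e x) (edge_point G e y) \<le> \<bar>x - y\<bar>"
  by (rule dist_le_path[OF path_length_edge])

lemma finite_incident: "finite {e \<in> edges G. \<exists>x\<in>edge_interval G e. edge_point G e x = p}"
proof (cases "p \<in> X")
  case True
  have "graph_bounded G {p}"
    using True dist_self[OF True] by (auto simp: graph_bounded_def)
  then have "finite {e \<in> edges G. edge_part G {p} e \<noteq> {}}"
    using loc_fin by (auto simp: locally_finite_graph_def)
  then show ?thesis by (rule rev_finite_subset) (auto simp: edge_part_def)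
next
  case False
  then have "{e \<in> edges G. \<exists>x\<in>edge_interval G e. edge_point G e x = p} = {}"
    using edge_point_in_graph by fastforce
  then show ?thesis by (simp only: finite.emptyI)
qed

text \<open>
  A tent function with its tip at \<open>p\<close> is 1-Lipschitz on every edge and smaller at \<open>q\<close>. At an interior point the tent
  fits into the edge. At a vertex its height must not exceed the length of any incident edge, which
  is possible because there are only finitely many of these.
\<close>

lemma dist_pos:
  assumes p: "p \<in> X" and q: "q \<in> X" and "p \<noteq> q"
  shows "0 < dG p q"
proof (cases p)
  case (Interior e x)
  obtain e' x' where "e' \<in> edges G" "x' \<in> edge_interval G e'" "p = edge_point G e' x'"
    using p by (auto simp: graph_points_def)
  then have e: "e \<in> edges G" and x: "x \<in> edge_interval G e" "x \<noteq> 0" "ereal x \<noteq> len G e"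
    and px: "p = edge_point G e x"
    using Interior by (auto simp: edge_point_def split: if_splits)
  have x0: "0 < x" "ereal x < len G e" using x by (auto simp: edge_interval_def)
  \<comment> \<open>half the width of the largest symmetric tent at \<open>x\<close> inside the edge\<close>
  define d where "d = (case len G e of ereal l \<Rightarrow> min x (l - x) | _ \<Rightarrow> x)"
  have d: "d > 0" "d \<le> x" using x0 by (cases "len G e"; auto simp: d_def)+
  define h where "h r = (case r of Vertex v \<Rightarrow> 0 | Interior e' y \<Rightarrow> if e' = e then max 0 (d - \<bar>y - x\<bar>) else 0)" for r :: "('v, 'e) point"
  have h_edge: "h (edge_point G e' y) = (if e' = e then max 0 (d - \<bar>y - x\<bar>) else 0)"
    if "e' \<in> edges G" "y \<in> edge_interval G e'" for e' y
  proof (cases "y = 0 \<or> ereal y = len G e'")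
    case True
    have "e' = e \<Longrightarrow> d \<le> \<bar>y - x\<bar>"
    proof -
      assume "e' = e"
      show ?thesis
      proof (cases "y = 0")
        case False
        then have "len G e = ereal y" using True \<open>e' = e\<close> by simp
        then show ?thesis by (simp add: d_def)
      qed (use d in simp)
    qed
    then show ?thesis using True by (auto simp: h_def edge_point_def)
  qed (auto simp: h_def edge_point_def)
  have "h p - h q \<le> dG p q"
  proof (rule Lipschitz_le_dist[OF _ p q])
    fix e' y z assume "e' \<in> edges G" "y \<in> edge_interval G e'" "z \<in> edge_interval G e'"
    then show "h (edge_point G e' y) - h (edge_point G e' z) \<le> \<bar>y - z\<bar>"
      by (auto simp: h_edge max_def)
  qed
  moreover have "h p = d" using Interior d by (simp add: h_def)
  moreover have "h q < d"
    using Interior \<open>p \<noteq> q\<close> d by (cases q) (auto simp: h_def)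
  ultimately show ?thesis by simp
next
  case (Vertex v)
  define I where "I = {e \<in> edges G. \<exists>x\<in>edge_interval G e. edge_point G e x = p}"
  have fI: "finite I" unfolding I_def by (rule finite_incident)
  define L where "L e = (case len G e of ereal l \<Rightarrow> l | _ \<Rightarrow> 1)" for e
  have L: "L e > 0" if "e \<in> edges G" for e
    using edge_len_cases[OF wf that] by (cases) (auto simp: L_def)
  define d where "d = Min (insert 1 (L ` I))"
  have d0: "d > 0" unfolding d_def using fI L by (subst Min_gr_iff) (auto simp: I_def)
  have dL: "d \<le> L e" if "e \<in> I" for e unfolding d_def using fI that by (intro Min_le) auto
  \<comment> \<open>an edge can meet the tent at either end, and a loop at \<open>v\<close> meets it at both\<close>
  define near where "near e y = max (if src G e = v then max 0 (d - y) else 0)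
      (if e \<in> bounded_edges G \<and> tgt G e = v then max 0 (d - (L e - y)) else 0)" for e y
  have lip: "near e y - near e z \<le> \<bar>y - z\<bar>" for e y z
    unfolding near_def by (auto simp: max_def)
  define h where "h r = (case r of Vertex w \<Rightarrow> if w = v then d else 0 | Interior e y \<Rightarrow> near e y)" for r :: "('v, 'e) point"
  have h_edge: "h (edge_point G e y) = near e y" if e: "e \<in> edges G" and y: "y \<in> edge_interval G e" for e y
  proof -
    have srcI: "e \<in> I" if "src G e = v"
      using e that Vertex edge_interval_0[OF wf e] by (auto simp: I_def edge_point_def intro!: bexI[of _ 0])
    have tgtI: "e \<in> I" if t: "tgt G e = v" "e \<in> bounded_edges G"
    proof -
      obtain l where l: "l > 0" "len G e = ereal l" by (rule bounded_edge_len[OF wf t(2)])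
      then show ?thesis using e t Vertex
        by (auto simp: I_def edge_point_def edge_interval_def intro!: bexI[of _ l])
    qed
    consider "y = 0" | "y \<noteq> 0" "ereal y = len G e" | "y \<noteq> 0" "ereal y \<noteq> len G e" by blast
    then show ?thesis
    proof cases
      case 1
      then show ?thesis using dL[OF srcI] dL[OF tgtI] d0
        by (auto simp: h_def near_def edge_point_def max_def)
    next
      case 2
      have le: "len G e = ereal y" using 2 by simp
      then have "L e = y" "e \<in> bounded_edges G" by (simp_all add: L_def bounded_edges_def e)
      moreover have "y > 0" using 2(1) y by (simp add: edge_interval_def)
      ultimately show ?thesis using 2 dL[OF srcI] dL[OF tgtI] d0
        by (auto simp: h_def near_def edge_point_def max_def)
    next
      case 3
      then show ?thesis by (simp add: h_def edge_point_def)
    qed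
  qed
  have "h p - h q \<le> dG p q"
    by (rule Lipschitz_le_dist[OF _ p q]) (simp add: h_edge lip)
  moreover have "h p = d" using Vertex by (simp add: h_def)
  moreover have "h q < d"
  proof -
    obtain e y where e: "e \<in> edges G" "y \<in> edge_interval G e" "q = edge_point G e y"
      using q by (auto simp: graph_points_def)
    show ?thesis
    proof (cases q)
      case (Vertex w)
      then show ?thesis using \<open>p = Vertex v\<close> \<open>p \<noteq> q\<close> d0 by (auto simp: h_def)
    next
      case (Interior e' y')
      then have *: "e' = e" "y' = y" "y \<noteq> 0" "ereal y \<noteq> len G e"
        using e by (auto simp: edge_point_def split: if_splits)
      have "y > 0" using * e by (auto simp: edge_interval_def)
      moreover have "y < L e" if b: "e \<in> bounded_edges G"
      proof -
        obtain l where "l > 0" "len G e = ereal l" by (rule bounded_edge_len[OF wf b])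
        then show ?thesis using * e by (simp add: L_def edge_interval_def)
      qed
      ultimately show ?thesis using Interior * d0 by (auto simp: h_def near_def)
    qed
  qed
  ultimately show ?thesis by simp
qed

lemma graph_metric: "Metric_space X dG"
proof
  show "dG p q = 0 \<longleftrightarrow> p = q" if "p \<in> X" "q \<in> X" for p q
    using dist_pos[OF that] dist_self that by fastforce
qed (use dist_nonneg dist_commute dist_triangle in auto)

sublocale graph: Metric_space X dG by (rule graph_metric)


lemma continuous_map_graph:
  fixes u :: "('v, 'e) point \<Rightarrow> complex"
  shows "continuous_map (graph_topology G) euclidean u \<longleftrightarrow>
    (\<forall>p\<in>X. \<forall>\<epsilon>>0. \<exists>\<delta>>0. \<forall>q\<in>X. dG p q < \<delta> \<longrightarrow> cmod (u p - u q) < \<epsilon>)"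
proof -
  have "continuous_map (graph_topology G) euclidean u \<longleftrightarrow>
      continuous_map graph.mtopology (Metric_space.mtopology UNIV dist) u"
    by (simp add: graph_topology_def)
  also have "\<dots> \<longleftrightarrow> (\<forall>p\<in>X. \<forall>\<epsilon>>0. \<exists>\<delta>>0. \<forall>q\<in>X. dG p q < \<delta> \<longrightarrow> cmod (u p - u q) < \<epsilon>)"
    by (subst graph.metric_continuous_map[OF Met_TC.Metric_space_axioms]) (simp add: dist_norm Ball_def imp_conjL)
  finally show ?thesis .
qed

lemma bounded_ball:
  assumes "p \<in> X"
  shows "graph_bounded G {q \<in> X. dG p q < r}"
  unfolding graph_bounded_def
proof (intro conjI exI[of _ "r + r"] ballI)
  fix a b assume "a \<in> {q \<in> X. dG p q < r}" "b \<in> {q \<in> X. dG p q < r}"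
  then show "dG a b \<le> r + r"
    using dist_triangle[of a p b] dist_commute[of a p] assms by auto
qed auto

text \<open>
  On an unbounded edge the coordinate itself, extended by zero to the rest of the graph, is 1-Lipschitz,
  so bounded sets have bounded coordinates.
\<close>

lemma bounded_edge_coordinates:
  assumes B: "graph_bounded G B" and e: "e \<in> edges G"
  obtains R where "\<And>x. x \<in> edge_part G B e \<Longrightarrow> x \<le> R"
proof (cases "edge_part G B e = {}")
  case True
  then show ?thesis using that by auto
next
  case False
  show ?thesis
  proof (cases rule: edge_len_cases[OF wf e])
    case (1 l)
    then show ?thesis using that[of l] by (auto simp: edge_part_def edge_interval_def)
  next
    case 2
    define h where "h r = (case r of Vertex v \<Rightarrow> 0 | Interior e' y \<Rightarrow> if e' = e then y else 0)" for r :: "('v, 'e) point"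
    have h_edge: "h (edge_point G e' y) = (if e' = e then y else 0)" if "e' \<in> edges G" "y \<in> edge_interval G e'" for e' y
      using that 2 by (auto simp: h_def edge_point_def)
    obtain y where y: "y \<in> edge_interval G e" "edge_point G e y \<in> B"
      using False by (auto simp: edge_part_def)
    obtain r where r: "\<And>a b. a \<in> B \<Longrightarrow> b \<in> B \<Longrightarrow> dG a b \<le> r" and BX: "B \<subseteq> X"
      using B by (auto simp: graph_bounded_def)
    have "x \<le> r + y" if "x \<in> edge_part G B e" for x
    proof -
      have x: "x \<in> edge_interval G e" "edge_point G e x \<in> B" using that by (auto simp: edge_part_def)
      have "h (edge_point G e x) - h (edge_point G e y) \<le> dG (edge_point G e x) (edge_point G e y)"
        by (rule Lipschitz_le_dist) (use x y BX in \<open>auto simp: h_edge\<close>)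
      also have "\<dots> \<le> r" by (rule r) (use x y in auto)
      finally show ?thesis using x y e by (simp add: h_edge)
    qed
    then show ?thesis using that by blast
  qed
qed

lemma bounded_segment:
  assumes e: "e \<in> edges G" and J: "J \<subseteq> edge_interval G e" "bounded J"
  shows "graph_bounded G (edge_point G e ` J)"
proof -
  obtain a where a: "\<And>x. x \<in> J \<Longrightarrow> \<bar>x\<bar> \<le> a" using J(2) by (auto simp: bounded_iff)
  have "dG (edge_point G e x) (edge_point G e y) \<le> 2 * a" if "x \<in> J" "y \<in> J" for x y
  proof -
    have "dG (edge_point G e x) (edge_point G e y) \<le> \<bar>x - y\<bar>" using e J that by (intro dist_edge_le) auto
    then show ?thesis using a[of x] a[of y] that by simp
  qed
  then show ?thesis using e J edge_point_in_graph by (fastforce simp: graph_bounded_def)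
qed

end

section \<open>The pointwise estimate on an interval\<close>

text \<open>
  By Cauchy--Schwarz the oscillation of \<open>u\<close> is at most \<open>(\<surd>R + \<parallel>A\<parallel>) N\<close>, and the mean of \<open>\<bar>u\<bar>\<close> over the interval
  is at most \<open>N / \<surd>R\<close>; any value is at most the mean plus the oscillation. The estimates are made on the open
  interval, where the integral formula for \<open>u\<close> is available, and extended to the end points by continuity.
\<close>

lemma pointwise_bound_on_interval:
  fixes u D :: "real \<Rightarrow> complex" and A :: "real \<Rightarrow> real"
  assumes R: "R > 0" and J: "J = {0<..<R}" and c: "continuous_on {0..R} u"
    and ftc: "\<And>x y. 0 < x \<Longrightarrow> x < y \<Longrightarrow> y < R \<Longrightarrow>
      u y - u x = (LINT t:{x..y}|lebesgue. \<i> * (D t + complex_of_real (A t) * u t))"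
    and Dm: "set_borel_measurable lebesgue J D" and Am: "set_borel_measurable lebesgue J A"
    and Di: "set_integrable lebesgue J (\<lambda>t. (cmod (D t))\<^sup>2)"
    and Ai: "set_integrable lebesgue J (\<lambda>t. (A t)\<^sup>2)"
    and ui: "set_integrable lebesgue J (\<lambda>t. (cmod (u t))\<^sup>2)"
    and N: "N \<ge> 0" "(LINT t:J|lebesgue. (cmod (D t))\<^sup>2) \<le> N\<^sup>2" "(LINT t:J|lebesgue. (cmod (u t))\<^sup>2) \<le> N\<^sup>2"
    and x: "x \<in> {0..R}"
  shows "cmod (u x) \<le> (1 / sqrt R + sqrt R + sqrt (LINT t:J|lebesgue. (A t)\<^sup>2)) * N"
proof -
  define a where "a = sqrt (LINT t:J|lebesgue. (A t)\<^sup>2)"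
  have a0: "a \<ge> 0"
    unfolding a_def set_lebesgue_integral_def by (intro real_sqrt_ge_zero Bochner_Integration.integral_nonneg) simp
  have mJ: "J \<in> sets lebesgue" by (simp add: J)
  have um: "set_borel_measurable lebesgue J u"
  proof -
    have "continuous_on J u" using c by (rule continuous_on_subset) (auto simp: J)
    from continuous_imp_measurable_on_sets_lebesgue[OF this mJ] show ?thesis
      by (simp add: set_borel_measurable_def borel_measurable_restrict_space_iff mJ)
  qed
  define d where "d t = indicator J t * cmod (D t)" for t
  define b where "b t = indicator J t * \<bar>A t\<bar>" for t
  define w where "w t = indicator J t * cmod (u t)" for t
  define i1 where "i1 t = (indicator J t :: real)" for t
  have m: "d \<in> borel_measurable lebesgue" "b \<in> borel_measurable lebesgue" "w \<in> borel_measurable lebesgue"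
    "i1 \<in> borel_measurable lebesgue"
  proof -
    have "d = (\<lambda>t. norm (indicator J t *\<^sub>R D t))" "w = (\<lambda>t. norm (indicator J t *\<^sub>R u t))"
      "b = (\<lambda>t. norm (indicator J t *\<^sub>R A t))"
      by (auto simp: d_def w_def b_def fun_eq_iff abs_mult)
    then show "d \<in> borel_measurable lebesgue" "b \<in> borel_measurable lebesgue" "w \<in> borel_measurable lebesgue"
      using measurable_compose[OF Dm[unfolded set_borel_measurable_def] borel_measurable_norm]
        measurable_compose[OF um[unfolded set_borel_measurable_def] borel_measurable_norm]
        measurable_compose[OF Am[unfolded set_borel_measurable_def] borel_measurable_norm]
      by (simp_all only:)
    show "i1 \<in> borel_measurable lebesgue" unfolding i1_def using mJ by simp
  qed
  have sq: "(d t)\<^sup>2 = indicator J t *\<^sub>R (cmod (D t))\<^sup>2" "(w t)\<^sup>2 = indicator J t *\<^sub>R (cmod (u t))\<^sup>2"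
    "(b t)\<^sup>2 = indicator J t *\<^sub>R (A t)\<^sup>2" "(i1 t)\<^sup>2 = indicator J t" for t
    by (simp_all add: d_def w_def b_def i1_def indicator_def)
  have iJ: "integrable lebesgue (indicator J :: real \<Rightarrow> real)"
    using lmeasurable_box[of 0 R] by (simp add: lmeasurable_iff_integrable J box_real)
  have i: "integrable lebesgue (\<lambda>t. (d t)\<^sup>2)" "integrable lebesgue (\<lambda>t. (w t)\<^sup>2)"
    "integrable lebesgue (\<lambda>t. (b t)\<^sup>2)" "integrable lebesgue (\<lambda>t. (i1 t)\<^sup>2)"
  proof -
    show "integrable lebesgue (\<lambda>t. (i1 t)\<^sup>2)" unfolding sq by (rule iJ)
  qed (use Di Ai ui in \<open>simp_all add: sq set_integrable_def\<close>)
  have nn: "d t \<ge> 0" "b t \<ge> 0" "w t \<ge> 0" "i1 t \<ge> 0" for t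
    by (simp_all add: d_def b_def w_def i1_def)
  have I1: "sqrt (\<integral>t. (d t)\<^sup>2 \<partial>lebesgue) \<le> N" "sqrt (\<integral>t. (w t)\<^sup>2 \<partial>lebesgue) \<le> N"
    using N by (simp_all add: sq real_sqrt_le_iff' set_lebesgue_integral_def real_le_lsqrt)
  have I2: "sqrt (\<integral>t. (b t)\<^sup>2 \<partial>lebesgue) = a" "sqrt (\<integral>t. (i1 t)\<^sup>2 \<partial>lebesgue) = sqrt R"
    using R by (simp_all add: sq a_def set_lebesgue_integral_def J)
  have CS1: "(\<integral>t. d t * i1 t \<partial>lebesgue) \<le> N * sqrt R"
    using Cauchy_Schwarz_integral[of d lebesgue i1] m i nn I1(1) R N
    by (intro order_trans[OF Cauchy_Schwarz_integral]) (auto simp: I2 intro!: mult_right_mono)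
  have CS2: "(\<integral>t. w t * i1 t \<partial>lebesgue) \<le> N * sqrt R"
    using m i nn I1(2) R N
    by (intro order_trans[OF Cauchy_Schwarz_integral]) (auto simp: I2 intro!: mult_right_mono)
  have CS3: "(\<integral>t. b t * w t \<partial>lebesgue) \<le> a * N"
    using m i nn I1(2) a0 N
    by (intro order_trans[OF Cauchy_Schwarz_integral]) (auto simp: I2 intro!: mult_left_mono)
  have ipr: "integrable lebesgue (\<lambda>t. d t * i1 t)" "integrable lebesgue (\<lambda>t. w t * i1 t)"
    "integrable lebesgue (\<lambda>t. b t * w t)"
    using m i by (auto intro!: integrable_product_of_squares)
  have "(\<lambda>t. d t * i1 t) = d" "(\<lambda>t. w t * i1 t) = w"
    by (auto simp: d_def w_def i1_def indicator_def)
  then have id: "integrable lebesgue d" "integrable lebesgue w"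
    and Id: "(\<integral>t. d t \<partial>lebesgue) \<le> N * sqrt R" "(\<integral>t. w t \<partial>lebesgue) \<le> N * sqrt R"
    using ipr CS1 CS2 by auto
  define K where "K = N * sqrt R + a * N"
  have osc': "cmod (u y - u x) \<le> K" if xy: "0 < x" "x < y" "y < R" for x y
  proof -
    have sub: "{x..y} \<subseteq> J" using xy by (auto simp: J)
    have mm: "(\<lambda>t. indicator J t *\<^sub>R (\<i> * (D t + complex_of_real (A t) * u t))) \<in> borel_measurable lebesgue"
    proof -
      have 1: "(\<lambda>t. indicator J t *\<^sub>R D t) \<in> borel_measurable lebesgue" "(\<lambda>t. indicator J t *\<^sub>R u t) \<in> borel_measurable lebesgue"
        "(\<lambda>t. indicator J t *\<^sub>R A t) \<in> borel_measurable lebesgue"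
        using Dm um Am by (simp_all add: set_borel_measurable_def)
      have "(\<lambda>t. \<i> * (indicator J t *\<^sub>R D t + complex_of_real (indicator J t *\<^sub>R A t) * (indicator J t *\<^sub>R u t))) \<in> borel_measurable lebesgue"
        by (intro borel_measurable_times borel_measurable_add borel_measurable_const measurable_compose[OF 1(3) borel_measurable_of_real] 1)
      then show ?thesis
        by (rule measurable_cong[THEN iffD1, rotated]) (auto simp: indicator_def)
    qed
    have bound: "norm (indicator J t *\<^sub>R (\<i> * (D t + complex_of_real (A t) * u t))) \<le> d t + b t * w t" for t
    proof -
      have "cmod (\<i> * (D t + complex_of_real (A t) * u t)) \<le> cmod (D t) + \<bar>A t\<bar> * cmod (u t)"
        using norm_triangle_ineq[of "D t" "complex_of_real (A t) * u t"] by (simp add: norm_mult)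
      then show ?thesis by (simp add: d_def b_def w_def indicator_def)
    qed
    have "integrable lebesgue (\<lambda>t. indicator J t *\<^sub>R (\<i> * (D t + complex_of_real (A t) * u t)))"
      by (rule Bochner_Integration.integrable_bound[OF Bochner_Integration.integrable_add[OF id(1) ipr(3)] mm])
         (use bound in \<open>auto intro!: AE_I2 intro: order_trans abs_ge_self\<close>)
    then have "set_integrable lebesgue J (\<lambda>t. \<i> * (D t + complex_of_real (A t) * u t))"
      by (simp add: set_integrable_def)
    then have sI: "set_integrable lebesgue {x..y} (\<lambda>t. \<i> * (D t + complex_of_real (A t) * u t))"
      by (rule set_integrable_subset) (use sub in auto)
    have "cmod (u y - u x) \<le> (\<integral>t. d t + b t * w t \<partial>lebesgue)"
      unfolding ftc[OF xy] set_lebesgue_integral_def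
    proof (rule Bochner_Integration.integral_norm_bound_integral)
      fix t
      show "norm (indicator {x..y} t *\<^sub>R (\<i> * (D t + complex_of_real (A t) * u t))) \<le> d t + b t * w t"
        using bound[of t] sub nn[of t] by (auto simp: indicator_def split: if_splits)
    qed (use sI id ipr in \<open>auto simp: set_integrable_def\<close>)
    also have "\<dots> = (\<integral>t. d t \<partial>lebesgue) + (\<integral>t. b t * w t \<partial>lebesgue)"
      using id ipr by simp
    also have "\<dots> \<le> K" using Id CS3 by (simp add: K_def)
    finally show ?thesis .
  qed
  have K0: "K \<ge> 0" using N R a0 by (simp add: K_def)
  have osc: "cmod (u y - u x) \<le> K" if "x \<in> J" "y \<in> J" for x y
    using osc'[of x y] osc'[of y x] that K0 by (cases x y rule: linorder_cases) (auto simp: J norm_minus_commute)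
  have inner: "cmod (u x) \<le> (1 / sqrt R) * N + K" if xJ: "x \<in> J" for x
  proof -
    have "cmod (u x) * R = (\<integral>t. indicator J t * cmod (u x) \<partial>lebesgue)"
      using R by (simp add: J)
    also have "\<dots> \<le> (\<integral>t. w t + indicator J t * K \<partial>lebesgue)"
    proof (rule integral_mono)
      fix t
      show "indicator J t * cmod (u x) \<le> w t + indicator J t * K"
        using osc[of t x] norm_triangle_ineq2[of "u x" "u t"] xJ
        by (auto simp: indicator_def w_def)
    qed (use id iJ in simp_all)
    also have "\<dots> = (\<integral>t. w t \<partial>lebesgue) + K * R"
      using id iJ R by (subst Bochner_Integration.integral_add) (simp_all, simp add: J)
    also have "\<dots> \<le> N * sqrt R + K * R" using Id by simp
    also have "\<dots> = (N * (1 / sqrt R) + K) * R"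
      using R by (simp add: field_simps)
    finally show ?thesis using R by (simp add: mult.commute)
  qed
  have "x \<in> closure J" using x R by (simp add: J)
  have "cmod (u x) \<le> (1 / sqrt R) * N + K"
  proof (rule continuous_le_on_closure[OF _ \<open>x \<in> closure J\<close>])
    show "continuous_on (closure J) (\<lambda>t. cmod (u t))"
      using c R by (simp add: J continuous_on_norm)
  qed (rule inner)
  then show ?thesis by (simp add: K_def a_def algebra_simps)
qed

section \<open>One measure for all edges\<close>

context loc_finite_graph
begin

text \<open>
  Integration for this measure is the sum over the edges of the integrals along the line. The
  functions on the graph enter it extended by zero outside the coordinate interval of each edge.
\<close>

definition gm :: "('e \<times> real) measure" where
  "gm = count_space (edges G) \<Otimes>\<^sub>M lebesgue"

definition zext :: "('e \<Rightarrow> real \<Rightarrow> 'b::real_vector) \<Rightarrow> 'e \<times> real \<Rightarrow> 'b" where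
  "zext f p = indicator (edge_interval G (fst p)) (snd p) *\<^sub>R f (fst p) (snd p)"

lemma countable_edges: "countable (edges G)"
  using loc_fin by (simp add: locally_finite_graph_def)

sublocale pair: pair_sigma_finite "count_space (edges G)" "lebesgue :: real measure"
  by (intro pair_sigma_finite.intro sigma_finite_measure_count_space_countable countable_edges sigma_finite_lebesgue)

lemma edge_part_all: "e \<in> edges G \<Longrightarrow> edge_part G X e = edge_interval G e"
  by (auto simp: edge_part_def edge_point_in_graph)

lemma space_gm: "space gm = edges G \<times> UNIV"
  by (simp add: gm_def space_pair_measure)

lemma measurable_gm:
  "(\<And>e. e \<in> edges G \<Longrightarrow> (\<lambda>x. g (e, x)) \<in> measurable lebesgue N) \<Longrightarrow> g \<in> measurable gm N"
  unfolding gm_def by (rule measurable_pair_measure_countable1[OF countable_edges])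

lemma measurable_section:
  "g \<in> measurable gm N \<Longrightarrow> e \<in> edges G \<Longrightarrow> (\<lambda>x. g (e, x)) \<in> measurable lebesgue N"
  unfolding gm_def by (rule measurable_Pair2) auto

text \<open>
  The exceptional sets are enlarged to Lebesgue null sets first, since nothing is known about the
  measurability of \<open>P\<close> in both variables together.
\<close>

lemma AE_gm:
  assumes "\<And>e. e \<in> edges G \<Longrightarrow> AE x in lebesgue. P e x"
  shows "AE p in gm. P (fst p) (snd p)"
proof -
  have "\<exists>N. N \<in> null_sets lebesgue \<and> {x. \<not> P e x} \<subseteq> N" if "e \<in> edges G" for e
    using assms[OF that] by (auto simp: eventually_ae_filter)
  then obtain N where N: "\<And>e. e \<in> edges G \<Longrightarrow> N e \<in> null_sets lebesgue \<and> {x. \<not> P e x} \<subseteq> N e" by metis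
  have meas: "{p \<in> space gm. snd p \<notin> N (fst p)} \<in> sets gm"
  proof -
    have "(\<lambda>p. snd p \<notin> N (fst p)) \<in> measurable gm (count_space UNIV)"
    proof (rule measurable_gm)
      fix e assume "e \<in> edges G"
      then have "N e \<in> sets lebesgue" using N by auto
      then show "(\<lambda>x. snd (e, x) \<notin> N (fst (e, x))) \<in> measurable lebesgue (count_space UNIV)"
        using sets.compl_sets[of "N e" lebesgue] by (auto simp: pred_def Compl_eq[symmetric] Compl_eq_Diff_UNIV)
    qed
    then show ?thesis by (simp add: pred_def)
  qed
  have "AE p in gm. snd p \<notin> N (fst p)"
    unfolding gm_def
  proof (rule pair.AE_pair_measure)
    show "AE x in count_space (edges G). AE y in lebesgue. snd (x, y) \<notin> N (fst (x, y))"
      using N by (auto simp: AE_count_space intro!: AE_not_in)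
  qed (use meas in \<open>simp add: gm_def\<close>)
  moreover have "AE p in gm. fst p \<in> edges G"
    by (rule AE_I2) (auto simp: space_gm)
  ultimately show ?thesis by eventually_elim (use N in blast)
qed

lemma AE_section:
  assumes "AE p in gm. P p" "e \<in> edges G"
  shows "AE x in lebesgue. P (e, x)"
  using pair.AE_pair[of P] assms unfolding gm_def by (auto simp: AE_count_space)

lemma nn_integral_section_le:
  assumes [measurable]: "g \<in> borel_measurable gm" and e: "e \<in> edges G"
  shows "(\<integral>\<^sup>+x. g (e, x) \<partial>lebesgue) \<le> (\<integral>\<^sup>+p. g p \<partial>gm)"
proof -
  have "(\<integral>\<^sup>+x. g (e, x) \<partial>lebesgue) \<le> (\<integral>\<^sup>+e. (\<integral>\<^sup>+x. g (e, x) \<partial>lebesgue) \<partial>count_space (edges G))"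
    using e by (rule nn_integral_ge_point)
  also have "\<dots> = (\<integral>\<^sup>+p. g p \<partial>gm)"
    using assms(1) unfolding gm_def by (rule pair.M2.nn_integral_fst)
  finally show ?thesis .
qed

lemma integral_section_le:
  fixes F :: "'e \<times> real \<Rightarrow> real"
  assumes F: "integrable gm F" "\<And>p. F p \<ge> 0" and e: "e \<in> edges G"
  shows "integrable lebesgue (\<lambda>x. F (e, x))" "(\<integral>x. F (e, x) \<partial>lebesgue) \<le> (\<integral>p. F p \<partial>gm)"
proof -
  have m: "F \<in> borel_measurable gm" using F by simp
  have le: "(\<integral>\<^sup>+x. ennreal (F (e, x)) \<partial>lebesgue) \<le> ennreal (\<integral>p. F p \<partial>gm)"
    using nn_integral_section_le[of "\<lambda>p. ennreal (F p)" e] m e F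
    by (simp add: nn_integral_eq_integral)
  show *: "integrable lebesgue (\<lambda>x. F (e, x))"
  proof (rule integrableI_bounded)
    show "(\<lambda>x. F (e, x)) \<in> borel_measurable lebesgue" by (rule measurable_section[OF m e])
    show "(\<integral>\<^sup>+x. ennreal (norm (F (e, x))) \<partial>lebesgue) < \<infinity>"
      using le F by (simp add: order_le_less_trans)
  qed
  show "(\<integral>x. F (e, x) \<partial>lebesgue) \<le> (\<integral>p. F p \<partial>gm)"
    using le F by (simp add: nn_integral_eq_integral[OF *] ennreal_le_iff Bochner_Integration.integral_nonneg)
qed

lemma zext_section: "(\<lambda>x. zext f (e, x)) = (\<lambda>x. indicator (edge_interval G e) x *\<^sub>R f e x)"
  by (simp add: zext_def)

lemma norm_zext: "norm (zext f p) = zext (\<lambda>e x. norm (f e x)) p"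
  by (simp add: zext_def indicator_def)

lemma graph_integrable_iff:
  fixes f :: "'e \<Rightarrow> real \<Rightarrow> 'b::{banach, second_countable_topology}"
  shows "graph_integrable G X f \<longleftrightarrow> integrable gm (zext f)"
proof -
  have eq: "(LINT x:edge_interval G e|lebesgue. norm (f e x)) = (\<integral>x. norm (zext f (e, x)) \<partial>lebesgue)" for e
    by (simp add: set_lebesgue_integral_def norm_zext zext_def)
  have s: "(\<lambda>e. \<integral>x. norm (zext f (e, x)) \<partial>lebesgue) summable_on edges G
      \<longleftrightarrow> integrable (count_space (edges G)) (\<lambda>e. \<integral>x. norm (zext f (e, x)) \<partial>lebesgue)"
    using abs_summable_equivalent[of "\<lambda>e. \<integral>x. norm (zext f (e, x)) \<partial>lebesgue" "edges G"]
    by (simp add: Infinite_Set_Sum.abs_summable_on_def)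
  have "graph_integrable G X f \<longleftrightarrow> (\<forall>e\<in>edges G. integrable lebesgue (\<lambda>x. zext f (e, x))) \<and>
      integrable (count_space (edges G)) (\<lambda>e. \<integral>x. norm (zext f (e, x)) \<partial>lebesgue)"
    unfolding graph_integrable_def s[symmetric] unfolding eq[symmetric]
    by (intro arg_cong2[where f="(\<and>)"] ball_cong summable_on_cong refl)
       (simp_all add: edge_part_all set_integrable_def zext_def)
  also have "\<dots> \<longleftrightarrow> integrable gm (zext f)"
  proof (intro iffI conjI ballI)
    assume a: "(\<forall>e\<in>edges G. integrable lebesgue (\<lambda>x. zext f (e, x))) \<and>
      integrable (count_space (edges G)) (\<lambda>e. \<integral>x. norm (zext f (e, x)) \<partial>lebesgue)"
    show "integrable gm (zext f)"
      unfolding gm_def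
    proof (rule pair.Fubini_integrable)
      have "zext f \<in> borel_measurable gm" by (rule measurable_gm) (use a in auto)
      then show "zext f \<in> borel_measurable (count_space (edges G) \<Otimes>\<^sub>M lebesgue)" by (simp add: gm_def)
    qed (use a in \<open>auto simp: AE_count_space\<close>)
  next
    assume a: "integrable gm (zext f)"
    show "integrable (count_space (edges G)) (\<lambda>e. \<integral>x. norm (zext f (e, x)) \<partial>lebesgue)"
      using integrable_norm[OF a] unfolding gm_def by (rule pair.integrable_fst')
    show "integrable lebesgue (\<lambda>x. zext f (e, x))" if "e \<in> edges G" for e
      using pair.AE_integrable_fst'[of "zext f"] a that by (simp add: gm_def AE_count_space)
  qed
  finally show ?thesis .
qed

lemma graph_integral_eq:
  fixes f :: "'e \<Rightarrow> real \<Rightarrow> 'b::{banach, second_countable_topology}"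
  assumes "integrable gm (zext f)"
  shows "graph_integral G f = (\<integral>p. zext f p \<partial>gm)"
proof -
  have i: "integrable (count_space (edges G)) (\<lambda>e. \<integral>x. zext f (e, x) \<partial>lebesgue)"
    using assms unfolding gm_def by (rule pair.integrable_fst')
  have "(\<integral>p. zext f p \<partial>gm) = (\<integral>e. (\<integral>x. zext f (e, x) \<partial>lebesgue) \<partial>count_space (edges G))"
    using pair.integral_fst'[of "zext f"] assms by (simp add: gm_def)
  also have "\<dots> = infsetsum (\<lambda>e. \<integral>x. zext f (e, x) \<partial>lebesgue) (edges G)"
    by (simp add: infsetsum_def)
  also have "\<dots> = infsum (\<lambda>e. \<integral>x. zext f (e, x) \<partial>lebesgue) (edges G)"
    by (rule infsetsum_infsum) (use i in \<open>simp add: Infinite_Set_Sum.abs_summable_on_def\<close>)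
  finally show ?thesis by (simp add: graph_integral_def set_lebesgue_integral_def zext_def)
qed

end

section \<open>Bounded pieces of edges\<close>

context loc_finite_graph
begin

lemma interior_edge:
  assumes "e \<in> edges G"
  shows "interior (edge_interval G e) = {x. 0 < x \<and> ereal x < len G e}"
proof (cases rule: edge_len_cases[OF wf assms])
  case (1 l)
  then have "edge_interval G e = {0..l}" by (auto simp: edge_interval_def)
  then show ?thesis using 1 by (auto simp: interior_atLeastAtMost_real)
next
  case 2
  then have "edge_interval G e = {0..}" by (auto simp: edge_interval_def)
  then show ?thesis using 2 by auto
qed

definition seg :: "'e \<Rightarrow> real \<Rightarrow> real set" where
  "seg e R = edge_interval G e \<inter> {0..R}"

lemma seg_eq:
  assumes e: "e \<in> edges G" and R: "R > 0"
  obtains r where "r > 0" "seg e R = {0..r}" "{0<..<r} \<subseteq> interior (edge_interval G e)"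
proof (cases rule: edge_len_cases[OF wf e])
  case (1 l)
  have "seg e R = {0..min R l}" using 1 by (auto simp: seg_def edge_interval_def)
  moreover have "{0<..<min R l} \<subseteq> interior (edge_interval G e)" unfolding interior_edge[OF e] using 1 by auto
  ultimately show ?thesis using that[of "min R l"] 1 R by simp
next
  case 2
  have "seg e R = {0..R}" using 2 by (auto simp: seg_def edge_interval_def)
  moreover have "{0<..<R} \<subseteq> interior (edge_interval G e)" unfolding interior_edge[OF e] using 2 by auto
  ultimately show ?thesis using that[of R] R by simp
qed

lemma seg_lebesgue: "e \<in> edges G \<Longrightarrow> R > 0 \<Longrightarrow> seg e R \<in> sets lebesgue"
  by (metis seg_eq atLeastAtMost_borel sets_completionI_sets sets_lborel lborelD)

lemma edge_interval_lebesgue: "e \<in> edges G \<Longrightarrow> edge_interval G e \<in> sets lebesgue"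
proof -
  assume e: "e \<in> edges G"
  have "edge_interval G e = {0..} \<or> (\<exists>l. edge_interval G e = {0..l})"
    by (cases rule: edge_len_cases[OF wf e]) (auto simp: edge_interval_def)
  then show ?thesis by auto
qed

lemma finite_ends: "finite {x. x = 0 \<or> ereal x = len G e}"
proof -
  have "{x. x = 0 \<or> ereal x = len G e} \<subseteq> {0, real_of_ereal (len G e)}"
  proof
    fix x assume "x \<in> {x. x = 0 \<or> ereal x = len G e}"
    moreover have "x = real_of_ereal (len G e)" if "ereal x = len G e"
      unfolding that[symmetric] by simp
    ultimately show "x \<in> {0, real_of_ereal (len G e)}" by blast
  qed
  then show ?thesis by (rule finite_subset) simp
qed

lemma finite_lebesgue: "finite F \<Longrightarrow> F \<in> sets (lebesgue :: real measure)"
  by (simp add: finite_imp_closed borel_closed sets_completionI_sets)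

lemma AE_interior:
  assumes e: "e \<in> edges G"
  shows "AE x in lebesgue. x \<in> edge_interval G e \<longrightarrow> x \<in> interior (edge_interval G e)"
proof -
  have "{x. x = 0 \<or> ereal x = len G e} \<in> null_sets lebesgue"
    using finite_ends by (simp add: finite_imp_null_set_lborel null_sets_completionI)
  then show ?thesis
    unfolding interior_edge[OF e] by (rule AE_mp[OF AE_not_in]) (auto simp: edge_interval_def less_le)
qed

text \<open>
  The trace of the piece on an edge is the piece itself up to end points, which other edges may share.
\<close>

lemma seg_measurable:
  assumes e: "e \<in> edges G" and R: "R > 0"
  shows "graph_measurable_set G (edge_point G e ` seg e R)"
  unfolding graph_measurable_set_def
proof (intro conjI ballI)
  show "edge_point G e ` seg e R \<subseteq> X" using e edge_point_in_graph by (fastforce simp: seg_def)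
  fix e' assume e': "e' \<in> edges G"
  define P where "P = edge_part G (edge_point G e ` seg e R) e'"
  define F where "F = P \<inter> {x. x = 0 \<or> ereal x = len G e'}"
  have "F \<in> sets lebesgue" unfolding F_def by (intro finite_lebesgue finite_Int disjI2 finite_ends)
  moreover have "P = (if e' = e then seg e R else {}) \<union> F"
  proof (rule set_eqI)
    fix x
    show "x \<in> P \<longleftrightarrow> x \<in> (if e' = e then seg e R else {}) \<union> F"
    proof (cases "x = 0 \<or> ereal x = len G e'")
      case True
      then show ?thesis by (auto simp: F_def P_def edge_part_def seg_def)
    next
      case False
      then show ?thesis
        by (auto simp: F_def P_def edge_part_def seg_def edge_point_def split: if_splits)
    qed
  qed
  ultimately show "edge_part G (edge_point G e ` seg e R) e' \<in> sets lebesgue"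
    using seg_lebesgue[OF e R] by (auto simp flip: P_def)
qed

lemma seg_bounded: "e \<in> edges G \<Longrightarrow> graph_bounded G (edge_point G e ` seg e R)"
  by (rule bounded_segment) (auto simp: seg_def intro: bounded_subset[OF bounded_closed_interval])

lemma seg_subset_part: "seg e R \<subseteq> edge_part G (edge_point G e ` seg e R) e"
  by (auto simp: edge_part_def seg_def)

lemma compact_subset_seg:
  assumes "compact K" "K \<subseteq> interior (edge_interval G e)" "e \<in> edges G"
  obtains R where "R > 0" "K \<subseteq> seg e R"
proof -
  obtain R where "R > 0" "\<And>x. x \<in> K \<Longrightarrow> \<bar>x\<bar> \<le> R"
    using compact_imp_bounded[OF assms(1)] by (auto simp: bounded_pos)
  moreover have "K \<subseteq> seg e R"
  proof
    fix x assume x: "x \<in> K"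
    then have "0 < x \<and> ereal x < len G e" using assms(2) unfolding interior_edge[OF assms(3)] by auto
    then show "x \<in> seg e R"
      using \<open>\<And>x. x \<in> K \<Longrightarrow> \<bar>x\<bar> \<le> R\<close>[OF x] by (simp add: seg_def edge_interval_def less_imp_le)
  qed
  ultimately show ?thesis using that by blast
qed

lemma on_edge_continuous:
  assumes u: "continuous_map (graph_topology G) euclidean (u :: ('v, 'e) point \<Rightarrow> complex)" and e: "e \<in> edges G"
  shows "continuous_on (edge_interval G e) (on_edge G u e)"
  unfolding continuous_on_iff
proof (intro ballI allI impI)
  fix x \<epsilon> assume x: "x \<in> edge_interval G e" and "(\<epsilon>::real) > 0"
  then obtain d where d: "d > 0" "\<And>q. q \<in> X \<Longrightarrow> dG (edge_point G e x) q < d \<Longrightarrow> cmod (u (edge_point G e x) - u q) < \<epsilon>"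
    using u edge_point_in_graph[OF e x] unfolding continuous_map_graph by meson
  show "\<exists>d>0. \<forall>x'\<in>edge_interval G e. dist x' x < d \<longrightarrow> dist (on_edge G u e x') (on_edge G u e x) < \<epsilon>"
  proof (intro exI[of _ d] conjI d ballI impI)
    fix y assume y: "y \<in> edge_interval G e" "dist y x < d"
    have "dG (edge_point G e x) (edge_point G e y) < d"
      using dist_edge_le[OF e x y(1)] y(2) by (simp add: dist_norm abs_minus_commute)
    then show "dist (on_edge G u e y) (on_edge G u e x) < \<epsilon>"
      using d(2)[OF edge_point_in_graph[OF e y(1)]] by (simp add: on_edge_def dist_norm norm_minus_commute)
  qed
qed

end

section \<open>The magnetic Sobolev space inside square-integrable functions\<close>

locale magnetic_graph = loc_finite_graph G for G :: "('v, 'e) metric_graph" +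
  fixes A V :: "('v, 'e) point \<Rightarrow> real"
  assumes V1: "\<forall>p\<in>graph_points G. 1 \<le> V p" and A_loc: "L2_loc G A" and V_loc: "L1_loc G V"
begin

abbreviation "Ae \<equiv> on_edge G A"
abbreviation "Ve \<equiv> on_edge G V"
abbreviation "I \<equiv> edge_interval G"

lemma A_seg:
  assumes e: "e \<in> edges G" and R: "R > 0"
  shows "set_borel_measurable lebesgue (seg e R) (Ae e)"
    and "set_integrable lebesgue (seg e R) (\<lambda>x. (Ae e x)\<^sup>2)"
    and "set_integrable lebesgue (seg e R) (Ae e)"
proof -
  let ?P = "edge_part G (edge_point G e ` seg e R) e"
  have a: "set_borel_measurable lebesgue ?P (Ae e)" "set_integrable lebesgue ?P (\<lambda>x. (norm (Ae e x))\<^sup>2)"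
    using A_loc seg_bounded[OF e] seg_measurable[OF e R] e
    by (auto simp: L2_loc_def graph_square_integrable_def graph_integrable_def)
  have eq: "indicator (seg e R) x *\<^sub>R Ae e x = indicator (seg e R) x *\<^sub>R (indicator ?P x *\<^sub>R Ae e x)" for x
    using seg_subset_part[of e R] by (auto simp: indicator_def)
  show 1: "set_borel_measurable lebesgue (seg e R) (Ae e)"
    unfolding set_borel_measurable_def eq
    using a(1) seg_lebesgue[OF e R] by (simp add: set_borel_measurable_def)
  show 2: "set_integrable lebesgue (seg e R) (\<lambda>x. (Ae e x)\<^sup>2)"
    using set_integrable_subset[OF a(2) seg_lebesgue[OF e R] seg_subset_part] by simp
  show "set_integrable lebesgue (seg e R) (Ae e)"
  proof -
    obtain r where r: "seg e R = {0..r}" "r > 0" using seg_eq[OF e R] by metis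
    have "integrable lebesgue (\<lambda>x. (indicator (seg e R) x *\<^sub>R Ae e x) * indicator (seg e R) x)"
    proof (rule integrable_product_of_squares)
      show "integrable lebesgue (\<lambda>x. (norm (indicator (seg e R) x *\<^sub>R Ae e x))\<^sup>2)"
        using 2 unfolding set_integrable_def
        by (rule Bochner_Integration.integrable_cong[THEN iffD1, rotated 2]) (auto simp: indicator_def)
      have "integrable lebesgue (indicator (seg e R) :: real \<Rightarrow> real)"
        using lmeasurable_cbox[of 0 r] by (simp add: r lmeasurable_iff_integrable)
      then show "integrable lebesgue (\<lambda>x. (norm (indicator (seg e R) x :: real))\<^sup>2)"
        by (rule Bochner_Integration.integrable_cong[THEN iffD1, rotated 2]) (auto simp: indicator_def)
    qed (use 1 seg_lebesgue[OF e R] in \<open>auto simp: set_borel_measurable_def\<close>)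
    then show ?thesis unfolding set_integrable_def
      by (rule Bochner_Integration.integrable_cong[THEN iffD1, rotated 2]) (auto simp: indicator_def)
  qed
qed

lemma V_measurable:
  assumes e: "e \<in> edges G"
  shows "set_borel_measurable lebesgue (I e) (Ve e)"
  unfolding set_borel_measurable_def
proof (rule borel_measurable_LIMSEQ_metric)
  fix n
  let ?R = "real (Suc n)"
  let ?P = "edge_part G (edge_point G e ` seg e ?R) e"
  have "set_integrable lebesgue ?P (Ve e)"
    using V_loc seg_bounded[OF e] seg_measurable[OF e, of ?R] e
    by (auto simp: L1_loc_def graph_integrable_def)
  then have "set_integrable lebesgue (seg e ?R) (Ve e)"
    using seg_lebesgue[OF e, of ?R] seg_subset_part by (rule set_integrable_subset) simp
  then show "(\<lambda>x. indicator (seg e (real (Suc n))) x *\<^sub>R Ve e x) \<in> borel_measurable lebesgue"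
    by (simp add: set_integrable_def)
next
  fix x :: real
  obtain N :: nat where N: "x \<le> real N" using real_arch_simple by blast
  have "\<forall>\<^sub>F n in sequentially. indicator (seg e (real (Suc n))) x *\<^sub>R Ve e x = indicator (I e) x *\<^sub>R Ve e x"
    using eventually_ge_at_top[of N]
    by eventually_elim (use N in \<open>auto simp: seg_def indicator_def edge_interval_def\<close>)
  then show "(\<lambda>n. indicator (seg e (real (Suc n))) x *\<^sub>R Ve e x) \<longlonglongrightarrow> indicator (I e) x *\<^sub>R Ve e x"
    by (rule tendsto_eventually)
qed

abbreviation "H1 \<equiv> H1A G A V"

definition Dmag :: "(('v, 'e) point \<Rightarrow> complex) \<Rightarrow> 'e \<times> real \<Rightarrow> complex" where
  "Dmag u = zext (magnetic_deriv G A u)"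

definition val :: "(('v, 'e) point \<Rightarrow> complex) \<Rightarrow> 'e \<times> real \<Rightarrow> complex" where
  "val u = zext (on_edge G u)"

definition pot :: "'e \<times> real \<Rightarrow> real" where
  "pot = zext Ve"

lemma pot_measurable [measurable]: "pot \<in> borel_measurable gm"
  unfolding pot_def
  by (rule measurable_gm) (use V_measurable in \<open>simp add: zext_section set_borel_measurable_def\<close>)

lemma pot_ge_1: "e \<in> edges G \<Longrightarrow> x \<in> I e \<Longrightarrow> 1 \<le> pot (e, x)"
  using V1[rule_format, OF edge_point_in_graph] by (simp add: pot_def zext_def on_edge_def)

lemma pot_nonneg: "p \<in> space gm \<Longrightarrow> 0 \<le> pot p"
  using pot_ge_1[of "fst p" "snd p"]
  by (cases "snd p \<in> I (fst p)") (auto simp: pot_def zext_def space_gm)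

definition cont_graph :: "(('v, 'e) point \<Rightarrow> complex) \<Rightarrow> bool" where
  "cont_graph u \<longleftrightarrow> continuous_map (graph_topology G) euclidean u"

lemma val_measurable: "cont_graph u \<Longrightarrow> val u \<in> borel_measurable gm"
  unfolding val_def
proof (rule measurable_gm)
  fix e assume u: "cont_graph u" and e: "e \<in> edges G"
  have "continuous_on (I e) (on_edge G u e)" using on_edge_continuous[OF _ e] u by (simp add: cont_graph_def)
  from continuous_imp_measurable_on_sets_lebesgue[OF this edge_interval_lebesgue[OF e]]
  show "(\<lambda>x. zext (on_edge G u) (e, x)) \<in> borel_measurable lebesgue"
    using edge_interval_lebesgue[OF e] by (simp add: zext_section borel_measurable_restrict_space_iff)
qed

lemma zext_square: "zext (\<lambda>e x. (norm (f e x))\<^sup>2) = (\<lambda>p. (norm (zext f p))\<^sup>2)"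
  by (auto simp: zext_def indicator_def)

lemma zext_pot_square: "zext (\<lambda>e x. Ve e x * (cmod (on_edge G u e x))\<^sup>2) = (\<lambda>p. pot p * (cmod (val u p))\<^sup>2)"
  by (auto simp: zext_def indicator_def pot_def val_def)

text \<open>
  The space embeds, by \<open>u \<mapsto> (D\<^sub>A u, \<surd>V u)\<close>, into pairs of square-integrable functions for the
  measure \<open>gm\<close>.
\<close>

lemma H1_iff:
  "u \<in> H1 \<longleftrightarrow> (\<forall>p. p \<notin> X \<longrightarrow> u p = 0) \<and> cont_graph u \<and>
    (\<forall>e\<in>edges G. weakly_differentiable (interior (I e)) (on_edge G u e)) \<and>
    Dmag u \<in> borel_measurable gm \<and> integrable gm (\<lambda>p. (cmod (Dmag u p))\<^sup>2) \<and>
    integrable gm (\<lambda>p. pot p * (cmod (val u p))\<^sup>2)"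
proof -
  have "(\<forall>e\<in>edges G. set_borel_measurable lebesgue (edge_part G X e) (f e)) \<longleftrightarrow> zext f \<in> borel_measurable gm"
    for f :: "'e \<Rightarrow> real \<Rightarrow> complex"
  proof -
    have "set_borel_measurable lebesgue (edge_part G X e) (f e) \<longleftrightarrow> (\<lambda>x. zext f (e, x)) \<in> borel_measurable lebesgue"
      if "e \<in> edges G" for e
      using that by (simp add: edge_part_all set_borel_measurable_def zext_section)
    then show ?thesis
      by (intro iffI ballI measurable_gm) (simp_all add: measurable_section)
  qed
  then show ?thesis
    by (simp add: H1A_def graph_square_integrable_def graph_integrable_iff zext_square zext_pot_square cont_graph_def Dmag_def)
qed

text \<open>
  The definition of the magnetic derivative solved for the chosen weak derivative.
\<close>

lemma weak_deriv_eq: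
  assumes wd: "weakly_differentiable (interior (I e)) (on_edge G u e)"
  shows "has_weak_deriv (interior (I e)) (on_edge G u e)
    (\<lambda>x. \<i> * (magnetic_deriv G A u e x + complex_of_real (Ae e x) * on_edge G u e x))"
proof -
  have "(\<lambda>x. \<i> * (magnetic_deriv G A u e x + complex_of_real (Ae e x) * on_edge G u e x))
      = weak_deriv (interior (I e)) (on_edge G u e)"
    by (auto simp: magnetic_deriv_def)
  then show ?thesis using weakly_differentiable_has_weak_deriv[OF wd] by simp
qed

lemma magnetic_deriv_AE_unique:
  assumes e: "e \<in> edges G"
    and g: "has_weak_deriv (interior (I e)) (on_edge G u e)
      (\<lambda>x. \<i> * (d x + complex_of_real (Ae e x) * on_edge G u e x))"
  shows "AE x in lebesgue. indicator (I e) x *\<^sub>R magnetic_deriv G A u e x = indicator (I e) x *\<^sub>R d x"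
proof -
  have wd: "weakly_differentiable (interior (I e)) (on_edge G u e)"
    using g by (auto simp: weakly_differentiable_def)
  show ?thesis
    using AE_interior[OF e] weak_deriv_unique[OF open_interior weak_deriv_eq[OF wd] g]
    by eventually_elim (auto simp: indicator_def)
qed

text \<open>
  Linearity of the magnetic derivative holds only almost everywhere, since the representatives
  of the three weak derivatives are chosen independently.
\<close>

lemma Dmag_add_scale:
  assumes "u \<in> H1" "v \<in> H1"
  shows "\<forall>e\<in>edges G. weakly_differentiable (interior (I e)) (on_edge G (\<lambda>p. a * u p + b * v p) e)"
    and "AE p in gm. Dmag (\<lambda>p. a * u p + b * v p) p = a * Dmag u p + b * Dmag v p"
proof -
  let ?w = "\<lambda>p. a * u p + b * v p"
  have *: "has_weak_deriv (interior (I e)) (on_edge G ?w e)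
      (\<lambda>x. \<i> * ((a * magnetic_deriv G A u e x + b * magnetic_deriv G A v e x) + complex_of_real (Ae e x) * on_edge G ?w e x))"
    if e: "e \<in> edges G" for e
  proof -
    have wu: "weakly_differentiable (interior (I e)) (on_edge G u e)" and wv: "weakly_differentiable (interior (I e)) (on_edge G v e)"
      using assms e by (auto simp: H1_iff)
    from has_weak_deriv_add[OF has_weak_deriv_cmult[OF weak_deriv_eq[OF wu], of a] has_weak_deriv_cmult[OF weak_deriv_eq[OF wv], of b]]
    show ?thesis by (simp add: on_edge_def[abs_def] algebra_simps)
  qed
  then show "\<forall>e\<in>edges G. weakly_differentiable (interior (I e)) (on_edge G ?w e)"
    by (auto simp: weakly_differentiable_def)
  have "AE p in gm. indicator (I (fst p)) (snd p) *\<^sub>R magnetic_deriv G A ?w (fst p) (snd p)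
     = indicator (I (fst p)) (snd p) *\<^sub>R (a * magnetic_deriv G A u (fst p) (snd p) + b * magnetic_deriv G A v (fst p) (snd p))"
    by (rule AE_gm, rule magnetic_deriv_AE_unique) (use * in auto)
  then show "AE p in gm. Dmag ?w p = a * Dmag u p + b * Dmag v p"
    by eventually_elim (auto simp: Dmag_def zext_def indicator_def)
qed

lemma val_add_scale: "val (\<lambda>p. a * u p + b * v p) p = a * val u p + b * val v p"
  by (simp add: val_def zext_def on_edge_def algebra_simps)

section \<open>The inner product and the boundedness of point evaluations\<close>

lemma H1_properties:
  assumes "u \<in> H1"
  shows "p \<notin> X \<Longrightarrow> u p = 0" "cont_graph u" "Dmag u \<in> borel_measurable gm" "val u \<in> borel_measurable gm"
    "integrable gm (\<lambda>p. (cmod (Dmag u p))\<^sup>2)" "integrable gm (\<lambda>p. pot p * (cmod (val u p))\<^sup>2)"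
    "e \<in> edges G \<Longrightarrow> weakly_differentiable (interior (I e)) (on_edge G u e)"
  using assms val_measurable by (auto simp: H1_iff)

text \<open>
  The product measure is not complete, but Lebesgue measure on each edge is.
\<close>

lemma Dmag_measurable_AE:
  assumes g: "g \<in> borel_measurable gm" and ae: "AE p in gm. Dmag w p = g p"
  shows "Dmag w \<in> borel_measurable gm"
proof (rule measurable_gm)
  fix e assume e: "e \<in> edges G"
  have "AE x in lebesgue. g (e, x) = Dmag w (e, x)"
    using AE_section[OF ae e] by (auto elim: eventually_mono)
  with measurable_section[OF g e] show "(\<lambda>x. Dmag w (e, x)) \<in> borel_measurable lebesgue"
    by (rule borel_measurable_AE)
qed

lemma H1_lin:
  assumes u: "u \<in> H1" and v: "v \<in> H1"
  shows "(\<lambda>p. a * u p + b * v p) \<in> H1"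
proof -
  let ?w = "\<lambda>p. a * u p + b * v p"
  note ae = Dmag_add_scale(2)[OF u v, of a b]
  have m: "(\<lambda>p. a * Dmag u p + b * Dmag v p) \<in> borel_measurable gm"
    using H1_properties(3)[OF u] H1_properties(3)[OF v] by measurable
  have Dm: "Dmag ?w \<in> borel_measurable gm" by (rule Dmag_measurable_AE[OF m ae])
  have sq: "(cmod (a * x + b * y))\<^sup>2 \<le> 2 * (cmod a)\<^sup>2 * (cmod x)\<^sup>2 + 2 * (cmod b)\<^sup>2 * (cmod y)\<^sup>2" for x y
    using cmod_add_square_le[of "a * x" "b * y"] by (simp add: norm_mult power_mult_distrib)
  have "cont_graph ?w"
  proof -
    have "continuous_map (graph_topology G) euclidean (\<lambda>p. c * f p)" if "cont_graph f" for c f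
    proof -
      have "continuous_map euclidean euclidean (\<lambda>z::complex. c * z)" by (simp add: continuous_on_mult_left)
      from continuous_map_compose[OF that[unfolded cont_graph_def] this] show ?thesis by (simp add: o_def)
    qed
    then show ?thesis
      using H1_properties(2)[OF u] H1_properties(2)[OF v] unfolding cont_graph_def by (intro continuous_map_add) auto
  qed
  moreover have "integrable gm (\<lambda>p. (cmod (Dmag ?w p))\<^sup>2)"
  proof (rule Bochner_Integration.integrable_bound)
    show "integrable gm (\<lambda>p. 2 * (cmod a)\<^sup>2 * (cmod (Dmag u p))\<^sup>2 + 2 * (cmod b)\<^sup>2 * (cmod (Dmag v p))\<^sup>2)"
      using H1_properties(5)[OF u] H1_properties(5)[OF v] by simp
    show "(\<lambda>p. (cmod (Dmag ?w p))\<^sup>2) \<in> borel_measurable gm" using Dm by measurable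
    show "AE p in gm. norm ((cmod (Dmag ?w p))\<^sup>2) \<le> norm (2 * (cmod a)\<^sup>2 * (cmod (Dmag u p))\<^sup>2 + 2 * (cmod b)\<^sup>2 * (cmod (Dmag v p))\<^sup>2)"
      using ae by eventually_elim (use sq in simp)
  qed
  moreover have "integrable gm (\<lambda>p. pot p * (cmod (val ?w p))\<^sup>2)"
  proof (rule Bochner_Integration.integrable_bound)
    show "integrable gm (\<lambda>p. 2 * (cmod a)\<^sup>2 * (pot p * (cmod (val u p))\<^sup>2) + 2 * (cmod b)\<^sup>2 * (pot p * (cmod (val v p))\<^sup>2))"
      using H1_properties(6)[OF u] H1_properties(6)[OF v] by simp
    show "(\<lambda>p. pot p * (cmod (val ?w p))\<^sup>2) \<in> borel_measurable gm"
      using val_measurable[OF \<open>cont_graph ?w\<close>] by measurable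
    show "AE p in gm. norm (pot p * (cmod (val ?w p))\<^sup>2) \<le> norm (2 * (cmod a)\<^sup>2 * (pot p * (cmod (val u p))\<^sup>2) + 2 * (cmod b)\<^sup>2 * (pot p * (cmod (val v p))\<^sup>2))"
    proof (rule AE_I2)
      fix p assume p: "p \<in> space gm"
      have "pot p * (cmod (val ?w p))\<^sup>2 \<le> pot p * (2 * (cmod a)\<^sup>2 * (cmod (val u p))\<^sup>2 + 2 * (cmod b)\<^sup>2 * (cmod (val v p))\<^sup>2)"
        unfolding val_add_scale by (intro mult_left_mono sq pot_nonneg p)
      then show "norm (pot p * (cmod (val ?w p))\<^sup>2) \<le> norm (2 * (cmod a)\<^sup>2 * (pot p * (cmod (val u p))\<^sup>2) + 2 * (cmod b)\<^sup>2 * (pot p * (cmod (val v p))\<^sup>2))"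
        using pot_nonneg[OF p] by (simp add: algebra_simps)
    qed
  qed
  ultimately show ?thesis
    using Dmag_add_scale(1)[OF u v] Dm H1_properties(1)[OF u] H1_properties(1)[OF v] by (simp add: H1_iff)
qed

lemma H1_diff: "u \<in> H1 \<Longrightarrow> v \<in> H1 \<Longrightarrow> (\<lambda>p. u p - v p) \<in> H1"
  using H1_lin[of u v 1 "-1"] by simp

lemma Dmag_diff: "u \<in> H1 \<Longrightarrow> v \<in> H1 \<Longrightarrow> AE p in gm. Dmag (\<lambda>p. u p - v p) p = Dmag u p - Dmag v p"
  using Dmag_add_scale(2)[of u v 1 "-1"] by simp

lemma val_diff: "val (\<lambda>p. u p - v p) p = val u p - val v p"
  using val_add_scale[of 1 u "-1" v] by simp

definition inner_density :: "(('v, 'e) point \<Rightarrow> complex) \<Rightarrow> (('v, 'e) point \<Rightarrow> complex) \<Rightarrow> 'e \<times> real \<Rightarrow> complex" where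
  "inner_density u v p = Dmag u p * cnj (Dmag v p) + complex_of_real (pot p) * val u p * cnj (val v p)"

lemma inner_density_integrable:
  assumes u: "u \<in> H1" and v: "v \<in> H1"
  shows "integrable gm (inner_density u v)"
  unfolding inner_density_def
proof (intro Bochner_Integration.integrable_add)
  have "(cnj :: complex \<Rightarrow> complex) \<in> borel_measurable borel"
    by (intro borel_measurable_continuous_onI continuous_intros)
  note [measurable] = H1_properties(3,4)[OF u] H1_properties(3,4)[OF v] measurable_compose[OF _ this]
  show "integrable gm (\<lambda>p. Dmag u p * cnj (Dmag v p))"
  proof (rule integrable_product_of_squares)
    show "(\<lambda>p. cnj (Dmag v p)) \<in> borel_measurable gm" by measurable
  qed (use H1_properties(5)[OF u] H1_properties(5)[OF v] in simp_all)
  show "integrable gm (\<lambda>p. complex_of_real (pot p) * val u p * cnj (val v p))"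
  proof (rule Bochner_Integration.integrable_bound)
    show "integrable gm (\<lambda>p. pot p * (cmod (val u p))\<^sup>2 + pot p * (cmod (val v p))\<^sup>2)"
      using H1_properties(6)[OF u] H1_properties(6)[OF v] by simp
    show "AE p in gm. norm (complex_of_real (pot p) * val u p * cnj (val v p)) \<le> norm (pot p * (cmod (val u p))\<^sup>2 + pot p * (cmod (val v p))\<^sup>2)"
    proof (rule AE_I2)
      fix p assume p: "p \<in> space gm"
      let ?a = "cmod (val u p)" and ?b = "cmod (val v p)"
      have "?a * ?b \<le> ?a\<^sup>2 + ?b\<^sup>2" by (intro mult_le_sum_squares) auto
      then have "pot p * (?a * ?b) \<le> pot p * (?a\<^sup>2 + ?b\<^sup>2)" by (intro mult_left_mono pot_nonneg p)
      then show "norm (complex_of_real (pot p) * val u p * cnj (val v p)) \<le> norm (pot p * ?a\<^sup>2 + pot p * ?b\<^sup>2)"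
        using pot_nonneg[OF p] by (simp add: norm_mult distrib_left mult.assoc)
    qed
  qed measurable
qed

lemma inner_eq:
  assumes u: "u \<in> H1" and v: "v \<in> H1"
  shows "H1A_inner G A V u v = (\<integral>p. inner_density u v p \<partial>gm)"
proof -
  let ?f = "\<lambda>e x. magnetic_deriv G A u e x * cnj (magnetic_deriv G A v e x) +
       complex_of_real (Ve e x) * on_edge G u e x * cnj (on_edge G v e x)"
  have eq: "zext ?f = inner_density u v"
    by (auto simp: fun_eq_iff zext_def inner_density_def Dmag_def val_def pot_def indicator_def)
  have "H1A_inner G A V u v = graph_integral G ?f" by (simp add: H1A_inner_def)
  also have "\<dots> = (\<integral>p. zext ?f p \<partial>gm)"
    by (rule graph_integral_eq) (simp add: eq inner_density_integrable[OF u v])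
  finally show ?thesis by (simp add: eq)
qed

definition energy :: "(('v, 'e) point \<Rightarrow> complex) \<Rightarrow> real" where
  "energy u = (\<integral>p. (cmod (Dmag u p))\<^sup>2 + pot p * (cmod (val u p))\<^sup>2 \<partial>gm)"

lemma energy_eq: "u \<in> H1 \<Longrightarrow> energy u = Re (H1A_inner G A V u u)"
proof -
  assume u: "u \<in> H1"
  have "inner_density u u = (\<lambda>p. complex_of_real ((cmod (Dmag u p))\<^sup>2 + pot p * (cmod (val u p))\<^sup>2))"
    by (simp add: inner_density_def mult.assoc fun_eq_iff flip: complex_norm_square)
  then have "H1A_inner G A V u u = complex_of_real (energy u)"
    unfolding inner_eq[OF u u] energy_def by (simp only: integral_complex_of_real)
  then show ?thesis by simp
qed

lemma energy_integrable: "u \<in> H1 \<Longrightarrow> integrable gm (\<lambda>p. (cmod (Dmag u p))\<^sup>2 + pot p * (cmod (val u p))\<^sup>2)"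
  using H1_properties(5,6) by simp

lemma energy_integrand_nonneg: "p \<in> space gm \<Longrightarrow> 0 \<le> (cmod (Dmag u p))\<^sup>2 + pot p * (cmod (val u p))\<^sup>2"
  using pot_nonneg by simp

lemma energy_nonneg: "0 \<le> energy u"
  unfolding energy_def by (rule Bochner_Integration.integral_nonneg) (rule energy_integrand_nonneg)

lemma energy_nn:
  assumes "u \<in> H1"
  shows "(\<integral>\<^sup>+p. ennreal ((cmod (Dmag u p))\<^sup>2 + pot p * (cmod (val u p))\<^sup>2) \<partial>gm) = ennreal (energy u)"
  unfolding energy_def
  by (rule nn_integral_eq_integral[OF energy_integrable[OF assms]]) (auto intro!: AE_I2 energy_integrand_nonneg)

lemma section_bounds:
  assumes u: "u \<in> H1" and e: "e \<in> edges G"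
  shows "integrable lebesgue (\<lambda>x. (cmod (Dmag u (e, x)))\<^sup>2)" "(\<integral>x. (cmod (Dmag u (e, x)))\<^sup>2 \<partial>lebesgue) \<le> energy u"
    "integrable lebesgue (\<lambda>x. (cmod (val u (e, x)))\<^sup>2)" "(\<integral>x. (cmod (val u (e, x)))\<^sup>2 \<partial>lebesgue) \<le> energy u"
proof -
  have 1: "integrable gm (\<lambda>p. (cmod (Dmag u p))\<^sup>2)" by (rule H1_properties(5)[OF u])
  have W: "(cmod (val u p))\<^sup>2 \<le> pot p * (cmod (val u p))\<^sup>2" if "p \<in> space gm" for p
  proof (cases "snd p \<in> I (fst p)")
    case True
    then have "1 \<le> pot p" using pot_ge_1[of "fst p" "snd p"] that by (auto simp: space_gm)
    then have "1 * (cmod (val u p))\<^sup>2 \<le> pot p * (cmod (val u p))\<^sup>2" by (intro mult_right_mono) auto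
    then show ?thesis by simp
  qed (simp add: val_def zext_def)
  have 2: "integrable gm (\<lambda>p. (cmod (val u p))\<^sup>2)"
    by (rule Bochner_Integration.integrable_bound[OF H1_properties(6)[OF u]])
       (use H1_properties(4)[OF u] W in \<open>auto intro!: AE_I2 intro: order_trans[OF _ abs_ge_self]\<close>)
  show "integrable lebesgue (\<lambda>x. (cmod (Dmag u (e, x)))\<^sup>2)" "integrable lebesgue (\<lambda>x. (cmod (val u (e, x)))\<^sup>2)"
    by (rule integral_section_le(1)[OF 1 _ e, simplified], rule integral_section_le(1)[OF 2 _ e, simplified])
  have "(\<integral>x. (cmod (Dmag u (e, x)))\<^sup>2 \<partial>lebesgue) \<le> (\<integral>p. (cmod (Dmag u p))\<^sup>2 \<partial>gm)"
    by (rule integral_section_le(2)[OF 1 _ e]) simp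
  also have "\<dots> \<le> energy u"
    unfolding energy_def by (rule integral_mono[OF 1 energy_integrable[OF u]]) (simp add: pot_nonneg)
  finally show "(\<integral>x. (cmod (Dmag u (e, x)))\<^sup>2 \<partial>lebesgue) \<le> energy u" .
  have "(\<integral>x. (cmod (val u (e, x)))\<^sup>2 \<partial>lebesgue) \<le> (\<integral>p. (cmod (val u p))\<^sup>2 \<partial>gm)"
    by (rule integral_section_le(2)[OF 2 _ e]) simp
  also have "\<dots> \<le> energy u"
    unfolding energy_def by (rule integral_mono[OF 2 energy_integrable[OF u]]) (use W in \<open>simp add: add_increasing\<close>)
  finally show "(\<integral>x. (cmod (val u (e, x)))\<^sup>2 \<partial>lebesgue) \<le> energy u" .
qed

lemma evaluation_bounded_on_seg:
  assumes e: "e \<in> edges G" and R: "R > 0"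
  shows "\<exists>C\<ge>0. \<forall>u\<in>H1. \<forall>x\<in>seg e R. cmod (on_edge G u e x) \<le> C * sqrt (energy u)"
proof -
  obtain r where r: "r > 0" "seg e R = {0..r}" "{0<..<r} \<subseteq> interior (I e)" by (rule seg_eq[OF e R])
  define J where "J = {0<..<r}"
  have JI: "J \<subseteq> I e" using r(3) interior_subset by (auto simp: J_def)
  have Js: "J \<subseteq> seg e R" by (auto simp: r J_def)
  have Jm: "J \<in> sets lebesgue" by (simp add: J_def)
  define a where "a = sqrt (LINT t:J|lebesgue. (Ae e t)\<^sup>2)"
  define C where "C = 1 / sqrt r + sqrt r + a"
  have Am: "set_borel_measurable lebesgue J (Ae e)"
  proof -
    have "(\<lambda>x. indicator J x *\<^sub>R (indicator (seg e R) x *\<^sub>R Ae e x)) \<in> borel_measurable lebesgue"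
      by (rule borel_measurable_scaleR[OF borel_measurable_indicator[OF Jm] A_seg(1)[OF e R, unfolded set_borel_measurable_def]])
    then show ?thesis unfolding set_borel_measurable_def
      by (rule measurable_cong[THEN iffD1, rotated]) (use Js in \<open>auto simp: indicator_def\<close>)
  qed
  have Ai: "set_integrable lebesgue J (\<lambda>x. (Ae e x)\<^sup>2)"
    by (rule set_integrable_subset[OF A_seg(2)[OF e R] Jm Js])
  have "C \<ge> 0"
    unfolding C_def a_def set_lebesgue_integral_def using r
    by (intro add_nonneg_nonneg real_sqrt_ge_zero Bochner_Integration.integral_nonneg) auto
  moreover have "cmod (on_edge G u e x) \<le> C * sqrt (energy u)" if u: "u \<in> H1" and x: "x \<in> seg e R" for u x
    unfolding C_def a_def
  proof (rule pointwise_bound_on_interval[OF r(1) J_def])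
    have cI: "continuous_on (I e) (on_edge G u e)"
      using on_edge_continuous[OF _ e] H1_properties(2)[OF u] by (simp add: cont_graph_def)
    show "continuous_on {0..r} (on_edge G u e)"
      by (rule continuous_on_subset[OF cI]) (use r(2) in \<open>auto simp: seg_def\<close>)
    show "on_edge G u e y - on_edge G u e x =
        (LINT t:{x..y}|lebesgue. \<i> * (magnetic_deriv G A u e t + complex_of_real (Ae e t) * on_edge G u e t))"
      if "0 < x" "x < y" "y < r" for x y
      by (rule weak_deriv_FTC[OF open_interior continuous_on_subset[OF cI interior_subset]
            weak_deriv_eq[OF H1_properties(7)[OF u e]], symmetric])
         (use that r(3) in auto)
    have secD: "Dmag u (e, x) = magnetic_deriv G A u e x" "val u (e, x) = on_edge G u e x" if "x \<in> J" for x
      using that JI by (auto simp: Dmag_def val_def zext_def)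
    have meas: "(\<lambda>x. indicator J x *\<^sub>R Dmag u (e, x)) \<in> borel_measurable lebesgue"
      using measurable_section[OF H1_properties(3)[OF u] e] Jm by (intro borel_measurable_scaleR) auto
    then show "set_borel_measurable lebesgue J (magnetic_deriv G A u e)"
      unfolding set_borel_measurable_def
      by (rule measurable_cong[THEN iffD1, rotated]) (auto simp: indicator_def secD)
    have intD: "integrable lebesgue (\<lambda>x. indicator J x *\<^sub>R (cmod (Dmag u (e, x)))\<^sup>2)"
      "integrable lebesgue (\<lambda>x. indicator J x *\<^sub>R (cmod (val u (e, x)))\<^sup>2)"
      using integrable_mult_indicator[OF Jm section_bounds(1)[OF u e]]
        integrable_mult_indicator[OF Jm section_bounds(3)[OF u e]] by auto
    have eqs: "(\<lambda>x. indicator J x *\<^sub>R (cmod (Dmag u (e, x)))\<^sup>2) = (\<lambda>x. indicator J x *\<^sub>R (cmod (magnetic_deriv G A u e x))\<^sup>2)"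
      "(\<lambda>x. indicator J x *\<^sub>R (cmod (val u (e, x)))\<^sup>2) = (\<lambda>x. indicator J x *\<^sub>R (cmod (on_edge G u e x))\<^sup>2)"
      by (auto simp: indicator_def secD)
    show "set_integrable lebesgue J (\<lambda>t. (cmod (magnetic_deriv G A u e t))\<^sup>2)"
      "set_integrable lebesgue J (\<lambda>t. (cmod (on_edge G u e t))\<^sup>2)"
      using intD unfolding eqs by (simp_all add: set_integrable_def)
    have "(\<integral>x. indicator J x *\<^sub>R (cmod (Dmag u (e, x)))\<^sup>2 \<partial>lebesgue) \<le> (\<integral>x. (cmod (Dmag u (e, x)))\<^sup>2 \<partial>lebesgue)"
      "(\<integral>x. indicator J x *\<^sub>R (cmod (val u (e, x)))\<^sup>2 \<partial>lebesgue) \<le> (\<integral>x. (cmod (val u (e, x)))\<^sup>2 \<partial>lebesgue)"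
      using intD section_bounds[OF u e] by (auto intro!: integral_mono simp: indicator_def)
    then show "(LINT t:J|lebesgue. (cmod (magnetic_deriv G A u e t))\<^sup>2) \<le> (sqrt (energy u))\<^sup>2"
      "(LINT t:J|lebesgue. (cmod (on_edge G u e t))\<^sup>2) \<le> (sqrt (energy u))\<^sup>2"
      using section_bounds(2,4)[OF u e] energy_nonneg[of u] unfolding eqs set_lebesgue_integral_def by auto
  qed (use Am Ai energy_nonneg r x in auto)
  ultimately show ?thesis by blast
qed

text \<open>
  Local finiteness enters here: a bounded set meets finitely many edges, so finitely many constants suffice.
\<close>

theorem evaluation_bounded_on_bounded_sets:
  assumes B: "graph_bounded G B"
  shows "\<exists>C\<ge>0. \<forall>u\<in>H1. \<forall>p\<in>B. cmod (u p) \<le> C * sqrt (energy u)"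
proof -
  define F where "F = {e \<in> edges G. edge_part G B e \<noteq> {}}"
  have fF: "finite F" using loc_fin B by (auto simp: locally_finite_graph_def F_def)
  have "\<exists>C\<ge>0. \<forall>u\<in>H1. \<forall>x\<in>edge_part G B e. cmod (on_edge G u e x) \<le> C * sqrt (energy u)" if e: "e \<in> edges G" for e
  proof -
    obtain R where R: "\<And>x. x \<in> edge_part G B e \<Longrightarrow> x \<le> R" using bounded_edge_coordinates[OF B e] by blast
    have sub: "x \<in> seg e (max R 1)" if "x \<in> edge_part G B e" for x
      using R[OF that] that by (auto simp: seg_def edge_part_def edge_interval_def)
    have "max R 1 > 0" by simp
    from evaluation_bounded_on_seg[OF e this] obtain C where "C \<ge> 0"
      "\<And>u x. u \<in> H1 \<Longrightarrow> x \<in> seg e (max R 1) \<Longrightarrow> cmod (on_edge G u e x) \<le> C * sqrt (energy u)"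
      by blast
    with sub show ?thesis by (intro exI[of _ C]) simp
  qed
  then obtain C where C: "\<And>e. e \<in> edges G \<Longrightarrow> C e \<ge> 0"
    "\<And>e u x. e \<in> edges G \<Longrightarrow> u \<in> H1 \<Longrightarrow> x \<in> edge_part G B e \<Longrightarrow> cmod (on_edge G u e x) \<le> C e * sqrt (energy u)"
    by metis
  have "cmod (u p) \<le> (\<Sum>e\<in>F. C e) * sqrt (energy u)" if u: "u \<in> H1" and p: "p \<in> B" for u p
  proof -
    have "p \<in> X" using p B by (auto simp: graph_bounded_def)
    then obtain e x where e: "e \<in> edges G" "x \<in> I e" "p = edge_point G e x" by (auto simp: graph_points_def)
    then have x: "x \<in> edge_part G B e" using p by (simp add: edge_part_def)
    have "cmod (u p) = cmod (on_edge G u e x)" by (simp add: on_edge_def e)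
    also have "\<dots> \<le> C e * sqrt (energy u)" by (rule C(2)[OF e(1) u x])
    also have "\<dots> \<le> (\<Sum>e\<in>F. C e) * sqrt (energy u)"
      using fF C(1) e x energy_nonneg by (intro mult_right_mono member_le_sum) (auto simp: F_def)
    finally show ?thesis .
  qed
  moreover have "(\<Sum>e\<in>F. C e) \<ge> 0" by (rule sum_nonneg) (auto simp: F_def C)
  ultimately show ?thesis by blast
qed

lemma bounded_singleton: "p \<in> X \<Longrightarrow> graph_bounded G {p}"
  using dist_self by (auto simp: graph_bounded_def)

lemma inner_space: "complex_inner_product_space (\<lambda>c u p. c * u p) H1 (H1A_inner G A V)"
proof -
  interpret vs: vector_space "\<lambda>c (u :: ('v, 'e) point \<Rightarrow> complex) p. c * u p"
    by unfold_locales (auto simp: fun_eq_iff algebra_simps)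
  have lin: "H1A_inner G A V (\<lambda>p. a * u p + b * v p) w = a * H1A_inner G A V u w + b * H1A_inner G A V v w"
    if u: "u \<in> H1" and v: "v \<in> H1" and w: "w \<in> H1" for a b u v w
  proof -
    have 1: "integrable gm (inner_density (\<lambda>p. a * u p + b * v p) w)"
      by (rule inner_density_integrable[OF H1_lin[OF u v] w])
    note 2 = inner_density_integrable[OF u w] and 3 = inner_density_integrable[OF v w]
    have "H1A_inner G A V (\<lambda>p. a * u p + b * v p) w = (\<integral>p. inner_density (\<lambda>p. a * u p + b * v p) w p \<partial>gm)"
      by (rule inner_eq[OF H1_lin[OF u v] w])
    also have "\<dots> = (\<integral>p. a * inner_density u w p + b * inner_density v w p \<partial>gm)"
    proof (rule integral_cong_AE)
      show "AE p in gm. inner_density (\<lambda>p. a * u p + b * v p) w p = a * inner_density u w p + b * inner_density v w p"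
        using Dmag_add_scale(2)[OF u v, of a b]
        by eventually_elim (simp add: inner_density_def val_add_scale algebra_simps)
    qed (use 1 2 3 in auto)
    also have "\<dots> = a * H1A_inner G A V u w + b * H1A_inner G A V v w"
      using 2 3 u v w by (simp add: inner_eq)
    finally show ?thesis .
  qed
  have zero: "0 \<in> H1"
  proof -
    have "has_weak_deriv S (\<lambda>_. 0) (\<lambda>_. 0)" for S
      by (simp add: has_weak_deriv_def locally_integrable_on_def set_integrable_def)
    then have wd: "has_weak_deriv (interior (I e)) (on_edge G 0 e)
      (\<lambda>x. \<i> * (0 + complex_of_real (Ae e x) * on_edge G 0 e x))" for e
      by (simp add: on_edge_def[abs_def])
    have ae: "AE p in gm. Dmag 0 p = 0"
    proof -
      have "AE p in gm. indicator (I (fst p)) (snd p) *\<^sub>R magnetic_deriv G A 0 (fst p) (snd p) = indicator (I (fst p)) (snd p) *\<^sub>R 0"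
        by (rule AE_gm, rule magnetic_deriv_AE_unique[OF _ wd])
      then show ?thesis by (simp add: Dmag_def zext_def)
    qed
    have m: "Dmag 0 \<in> borel_measurable gm" by (rule Dmag_measurable_AE[OF _ ae]) simp
    have "integrable gm (\<lambda>p. (cmod (Dmag 0 p))\<^sup>2)"
    proof (rule integrable_cong_AE_imp)
      show "integrable gm (\<lambda>_. 0 :: real)" by simp
      show "(\<lambda>p. (cmod (Dmag 0 p))\<^sup>2) \<in> borel_measurable gm" using m by measurable
      show "AE p in gm. 0 = (cmod (Dmag 0 p))\<^sup>2" using ae by eventually_elim simp
    qed
    moreover have "val 0 = (\<lambda>_. 0)" by (simp add: val_def zext_def on_edge_def fun_eq_iff)
    moreover have "cont_graph 0"
      unfolding cont_graph_def zero_fun_def by simp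
    ultimately show ?thesis using m wd by (auto simp: H1_iff weakly_differentiable_def)
  qed
  show ?thesis
  proof (unfold_locales)
    show "vs.subspace H1"
      unfolding vs.subspace_def
    proof (intro conjI ballI allI zero)
      show "u + v \<in> H1" if "u \<in> H1" "v \<in> H1" for u v
        using H1_lin[OF that, of 1 1] by (simp add: plus_fun_def)
      show "(\<lambda>p. c * u p) \<in> H1" if "u \<in> H1" for c u
        using H1_lin[OF that that, of c 0] by simp
    qed
    show "H1A_inner G A V (u + v) w = H1A_inner G A V u w + H1A_inner G A V v w"
      if "u \<in> H1" "v \<in> H1" "w \<in> H1" for u v w
      using lin[OF that, of 1 1] by (simp add: plus_fun_def)
    show "H1A_inner G A V (\<lambda>p. c * u p) v = c * H1A_inner G A V u v" if "u \<in> H1" "v \<in> H1" for u v c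
      using lin[OF that(1,1,2), of c 0] by simp
    show "H1A_inner G A V u v = cnj (H1A_inner G A V v u)" if "u \<in> H1" "v \<in> H1" for u v
    proof -
      have "inner_density u v p = cnj (inner_density v u p)" for p
        by (simp add: inner_density_def mult.commute mult.left_commute)
      then show ?thesis using that by (simp add: inner_eq)
    qed
    show "0 \<le> Re (H1A_inner G A V u u)" if "u \<in> H1" for u
      using energy_nonneg[of u] by (simp add: energy_eq[OF that])
    show "u = 0" if u: "u \<in> H1" and z: "H1A_inner G A V u u = 0" for u
    proof
      fix p
      show "u p = 0 p"
      proof (cases "p \<in> X")
        case True
        then obtain C where "\<forall>u\<in>H1. \<forall>q\<in>{p}. cmod (u q) \<le> C * sqrt (energy u)"
          using evaluation_bounded_on_bounded_sets[OF bounded_singleton] by blast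
        then have "cmod (u p) \<le> C * sqrt (energy u)" using u by blast
        then show ?thesis using z by (simp add: energy_eq[OF u])
      qed (simp add: H1_properties(1)[OF u])
    qed
  qed
qed

end

context magnetic_graph
begin

section \<open>Completeness\<close>

text \<open>
  The functions converge uniformly on bounded pieces of the edge and the magnetic derivatives converge in \<open>L\<^sup>2\<close>. Hence
  the weak derivatives \<open>\<i> (D\<^sub>A v + A v)\<close> converge in \<open>L\<^sup>1\<close> on compact sets: the first summand by
  Cauchy--Schwarz, the second because \<open>A\<close> is integrable there.
\<close>

lemma magnetic_weak_deriv_limit:
  fixes v :: "nat \<Rightarrow> ('v, 'e) point \<Rightarrow> complex"
  assumes e: "e \<in> edges G" and v: "\<And>n. v n \<in> H1" and cu: "cont_graph u"
    and unif: "\<And>R \<epsilon>. \<epsilon> > 0 \<Longrightarrow> \<exists>N. \<forall>n\<ge>N. \<forall>x\<in>seg e R. cmod (on_edge G (v n) e x - on_edge G u e x) \<le> \<epsilon>"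
    and d: "d \<in> borel_measurable lebesgue" "integrable lebesgue (\<lambda>x. (cmod (d x))\<^sup>2)"
    and L2: "\<And>\<epsilon>. \<epsilon> > 0 \<Longrightarrow> \<exists>N. \<forall>n\<ge>N. integrable lebesgue (\<lambda>x. (cmod (Dmag (v n) (e, x) - d x))\<^sup>2) \<and>
      (\<integral>x. (cmod (Dmag (v n) (e, x) - d x))\<^sup>2 \<partial>lebesgue) \<le> \<epsilon>\<^sup>2"
  shows "has_weak_deriv (interior (I e)) (on_edge G u e)
    (\<lambda>x. \<i> * (d x + complex_of_real (Ae e x) * on_edge G u e x))"
proof -
  let ?S = "interior (I e)"
  let ?f = "\<lambda>n. on_edge G (v n) e" and ?F = "on_edge G u e"
  let ?g = "\<lambda>n x. \<i> * (magnetic_deriv G A (v n) e x + complex_of_real (Ae e x) * ?f n x)"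
  let ?G = "\<lambda>x. \<i> * (d x + complex_of_real (Ae e x) * ?F x)"
  have hn: "has_weak_deriv ?S (?f n) (?g n)" for n by (rule weak_deriv_eq[OF H1_properties(7)[OF v e]])
  have cF: "continuous_on (I e) ?F" using on_edge_continuous[OF _ e] cu by (simp add: cont_graph_def)
  have Ai: "set_integrable lebesgue K (Ae e)" if K: "compact K" "K \<subseteq> ?S" for K
  proof -
    obtain R where R: "R > 0" "K \<subseteq> seg e R" by (rule compact_subset_seg[OF K e])
    show ?thesis by (rule set_integrable_subset[OF A_seg(3)[OF e R(1)] compact_lebesgue[OF K(1)] R(2)])
  qed
  have cK: "continuous_on K ?F" if "K \<subseteq> ?S" for K
    using that interior_subset by (blast intro: continuous_on_subset[OF cF])
  show ?thesis
  proof (rule has_weak_deriv_limit[OF hn])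
    show "locally_integrable_on ?S ?F"
      unfolding locally_integrable_on_def
    proof (intro allI impI)
      fix K assume K: "compact K \<and> K \<subseteq> ?S"
      have one: "set_integrable lebesgue K (\<lambda>_. 1 :: complex)"
        using integrable_indicator_compact[of K] K unfolding set_integrable_def
        by (drule_tac conjunct1) (simp add: scaleR_conv_of_real del: of_real_indicator)
      show "set_integrable lebesgue K ?F"
        using set_integrable_continuous_mult[OF one _ cK] K by simp
    qed
    show "locally_integrable_on ?S ?G"
      unfolding locally_integrable_on_def
    proof (intro allI impI)
      fix K assume K: "compact K \<and> K \<subseteq> ?S"
      then have "set_integrable lebesgue K (\<lambda>x. complex_of_real (Ae e x))"
        using Ai[of K] unfolding set_integrable_def
        by (auto dest!: integrable_of_real[where 'a=complex] simp: scaleR_conv_of_real)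
      from set_integrable_continuous_mult[OF this _ cK]
      have "set_integrable lebesgue K (\<lambda>x. complex_of_real (Ae e x) * ?F x)" using K by blast
      then show "set_integrable lebesgue K ?G"
        using square_integrable_on_compact(1)[OF _ d, of K] K by (intro set_integrable_mult_right set_integral_add) auto
    qed
    fix K assume K: "compact K" "K \<subseteq> ?S"
    obtain R where R: "R > 0" "K \<subseteq> seg e R" by (rule compact_subset_seg[OF K e])
    have KI: "K \<subseteq> I e" using K(2) interior_subset by blast
    have unifK: "\<exists>N. \<forall>n\<ge>N. \<forall>x\<in>K. cmod (?f n x - ?F x) \<le> \<epsilon>" if "\<epsilon> > 0" for \<epsilon>
      using unif[OF that, of R] R(2) by blast
    have bound1: "(LINT x:K|lebesgue. norm (?f n x - ?F x)) \<le> \<epsilon> * measure lebesgue K"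
      if "\<forall>x\<in>K. cmod (?f n x - ?F x) \<le> \<epsilon>" "\<epsilon> > 0" for n \<epsilon>
    proof -
      have "(LINT x:K|lebesgue. norm (?f n x - ?F x)) \<le> (\<integral>x. \<epsilon> * indicator K x \<partial>lebesgue)"
        unfolding set_lebesgue_integral_def
      proof (rule integral_mono')
        show "integrable lebesgue (\<lambda>x. \<epsilon> * indicator K x)" using integrable_indicator_compact[OF K(1)] by simp
      qed (use that in \<open>auto simp: indicator_def\<close>)
      then show ?thesis by simp
    qed
    define a where "a = (LINT x:K|lebesgue. \<bar>Ae e x\<bar>)"
    have iA: "set_integrable lebesgue K (\<lambda>x. \<bar>Ae e x\<bar>)" by (rule set_integrable_abs[OF Ai[OF K]])
    have bound2: "(LINT x:K|lebesgue. norm (?g n x - ?G x)) \<le> \<epsilon> * (sqrt (measure lebesgue K) + a)"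
      if n: "\<forall>x\<in>K. cmod (?f n x - ?F x) \<le> \<epsilon>" and \<epsilon>: "\<epsilon> > 0"
        and h2: "integrable lebesgue (\<lambda>x. (cmod (Dmag (v n) (e, x) - d x))\<^sup>2) \<and>
          (\<integral>x. (cmod (Dmag (v n) (e, x) - d x))\<^sup>2 \<partial>lebesgue) \<le> \<epsilon>\<^sup>2" for n \<epsilon>
    proof -
      let ?h = "\<lambda>x. Dmag (v n) (e, x) - d x"
      have hm: "?h \<in> borel_measurable lebesgue"
        using measurable_section[OF H1_properties(3)[OF v] e] d(1) by measurable
      have le: "sqrt (\<integral>x. (cmod (?h x))\<^sup>2 \<partial>lebesgue) \<le> \<epsilon>"
        using \<epsilon> h2 by (intro real_le_lsqrt) auto
      note sK = square_integrable_on_compact[OF K(1) hm conjunct1[OF h2]]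
      have hK: "(LINT x:K|lebesgue. norm (?h x)) \<le> \<epsilon> * sqrt (measure lebesgue K)"
        using sK(2) by (rule order_trans) (intro mult_right_mono le, simp)
      have "(LINT x:K|lebesgue. norm (?g n x - ?G x)) \<le> (LINT x:K|lebesgue. norm (?h x) + \<epsilon> * \<bar>Ae e x\<bar>)"
        unfolding set_lebesgue_integral_def
      proof (rule integral_mono')
        show "integrable lebesgue (\<lambda>x. indicator K x *\<^sub>R (norm (?h x) + \<epsilon> * \<bar>Ae e x\<bar>))"
          using set_integral_add(1)[OF set_integrable_norm[OF sK(1)] set_integrable_mult_right[OF iA, of \<epsilon>]]
          by (simp add: set_integrable_def)
        fix x
        show "indicator K x *\<^sub>R norm (?g n x - ?G x) \<le> indicator K x *\<^sub>R (norm (?h x) + \<epsilon> * \<bar>Ae e x\<bar>)"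
        proof (cases "x \<in> K")
          case True
          then have "Dmag (v n) (e, x) = magnetic_deriv G A (v n) e x" using KI by (auto simp: Dmag_def zext_def)
          then have "?g n x - ?G x = \<i> * (?h x + complex_of_real (Ae e x) * (?f n x - ?F x))"
            by (simp add: algebra_simps)
          then have "norm (?g n x - ?G x) = norm (?h x + complex_of_real (Ae e x) * (?f n x - ?F x))"
            by (simp add: norm_mult)
          also have "\<dots> \<le> norm (?h x) + \<bar>Ae e x\<bar> * norm (?f n x - ?F x)"
            using norm_triangle_ineq[of "?h x" "complex_of_real (Ae e x) * (?f n x - ?F x)"] by (simp add: norm_mult)
          also have "\<dots> \<le> norm (?h x) + \<bar>Ae e x\<bar> * \<epsilon>"
            using n True by (intro add_left_mono mult_left_mono) auto
          finally show ?thesis using True by (simp add: mult.commute)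
        qed simp
        show "0 \<le> indicator K x *\<^sub>R (norm (?h x) + \<epsilon> * \<bar>Ae e x\<bar>)" using \<epsilon> by simp
      qed
      also have "\<dots> = (LINT x:K|lebesgue. norm (?h x)) + \<epsilon> * a"
        using set_integral_add(2)[OF set_integrable_norm[OF sK(1)] set_integrable_mult_right[OF iA, of \<epsilon>]]
        by (simp add: a_def)
      also have "\<dots> \<le> \<epsilon> * (sqrt (measure lebesgue K) + a)" using hK by (simp add: distrib_left)
      finally show ?thesis .
    qed
    have nn: "0 \<le> (LINT x:K|lebesgue. norm (h x :: complex))" "0 \<le> (LINT x:K|lebesgue. \<bar>b x :: real\<bar>)" for h b
      unfolding set_lebesgue_integral_def by (rule Bochner_Integration.integral_nonneg, simp)+
    show "(\<lambda>n. LINT x:K|lebesgue. norm (?f n x - ?F x)) \<longlonglongrightarrow> 0"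
    proof (rule LIMSEQ_0_if_eventually_le_multiple)
      show "\<exists>N. \<forall>n\<ge>N. (LINT x:K|lebesgue. norm (?f n x - ?F x)) \<le> \<epsilon> * measure lebesgue K" if "\<epsilon> > 0" for \<epsilon>
        using unifK[OF that] bound1[OF _ that] by blast
    qed (simp, rule nn)
    show "(\<lambda>n. LINT x:K|lebesgue. norm (?g n x - ?G x)) \<longlonglongrightarrow> 0"
    proof (rule LIMSEQ_0_if_eventually_le_multiple)
      show "\<exists>N. \<forall>n\<ge>N. (LINT x:K|lebesgue. norm (?g n x - ?G x)) \<le> \<epsilon> * (sqrt (measure lebesgue K) + a)" if \<epsilon>: "\<epsilon> > 0" for \<epsilon>
      proof -
        obtain N1 where N1: "\<And>n. n \<ge> N1 \<Longrightarrow> \<forall>x\<in>K. cmod (?f n x - ?F x) \<le> \<epsilon>" using unifK[OF \<epsilon>] by blast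
        obtain N2 where N2: "\<And>n. n \<ge> N2 \<Longrightarrow> integrable lebesgue (\<lambda>x. (cmod (Dmag (v n) (e, x) - d x))\<^sup>2) \<and>
            (\<integral>x. (cmod (Dmag (v n) (e, x) - d x))\<^sup>2 \<partial>lebesgue) \<le> \<epsilon>\<^sup>2" using L2[OF \<epsilon>] by blast
        show ?thesis
          using bound2[OF N1 \<epsilon> N2] by (intro exI[of _ "max N1 N2"]) auto
      qed
    qed (simp add: a_def nn, rule nn)
  qed
qed

text \<open>
  The rate \<open>8\<^sup>-\<^sup>n\<close> is what \<open>AE_convergent_if_square_sums\<close> asks for; every Cauchy sequence has a subsequence
  with this property.
\<close>

lemma limit_in_H1:
  fixes v :: "nat \<Rightarrow> ('v, 'e) point \<Rightarrow> complex"
  assumes v: "\<And>n. v n \<in> H1"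
    and fast: "\<And>n. energy (\<lambda>p. v (Suc n) p - v n p) \<le> (1/8) ^ n"
    and cau: "\<And>\<epsilon>. \<epsilon> > 0 \<Longrightarrow> \<exists>N. \<forall>m\<ge>N. \<forall>n\<ge>N. sqrt (energy (\<lambda>p. v m p - v n p)) < \<epsilon>"
  shows "\<exists>u\<in>H1. \<forall>\<epsilon>>0. \<exists>N. \<forall>n\<ge>N. sqrt (energy (\<lambda>p. v n p - u p)) \<le> \<epsilon>"
proof -
  have evd: "cmod (v m p - v n p) \<le> C * sqrt (energy (\<lambda>p. v m p - v n p))"
    if "\<forall>u\<in>H1. \<forall>p\<in>B. cmod (u p) \<le> C * sqrt (energy u)" "p \<in> B" for B C p m n
    using bspec[OF bspec[OF that(1) H1_diff[OF v v, of m n]] that(2)] by simp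
  \<comment> \<open>point evaluations are bounded, so the sequence is uniformly Cauchy on bounded sets\<close>
  have unif0: "\<exists>N. \<forall>m\<ge>N. \<forall>n\<ge>N. \<forall>p\<in>B. cmod (v m p - v n p) \<le> \<epsilon>"
    if B: "graph_bounded G B" and \<epsilon>: "\<epsilon> > 0" for B \<epsilon>
  proof -
    obtain C where C: "C \<ge> 0" "\<forall>u\<in>H1. \<forall>p\<in>B. cmod (u p) \<le> C * sqrt (energy u)" using evaluation_bounded_on_bounded_sets[OF B] by blast
    obtain N where N: "\<And>m n. m \<ge> N \<Longrightarrow> n \<ge> N \<Longrightarrow> sqrt (energy (\<lambda>p. v m p - v n p)) < \<epsilon> / (C + 1)"
      using cau[of "\<epsilon> / (C + 1)"] \<epsilon> C(1) by auto
    have "cmod (v m p - v n p) \<le> \<epsilon>" if "m \<ge> N" "n \<ge> N" "p \<in> B" for m n p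
    proof -
      have "cmod (v m p - v n p) \<le> C * sqrt (energy (\<lambda>p. v m p - v n p))" by (rule evd[OF C(2) that(3)])
      also have "\<dots> \<le> C * (\<epsilon> / (C + 1))" using N[OF that(1,2)] C(1) by (intro mult_left_mono) auto
      also have "\<dots> \<le> \<epsilon>" using \<epsilon> C(1) by (simp add: divide_simps)
      finally show ?thesis .
    qed
    then show ?thesis by blast
  qed
  define u where "u p = (if p \<in> X then lim (\<lambda>n. v n p) else 0)" for p
  have lim_u: "(\<lambda>n. v n p) \<longlonglongrightarrow> u p" for p
  proof (cases "p \<in> X")
    case True
    have "Cauchy (\<lambda>n. v n p)"
    proof (rule CauchyI)
      fix e :: real assume "e > 0"
      then obtain N where "\<forall>m\<ge>N. \<forall>n\<ge>N. \<forall>q\<in>{p}. cmod (v m q - v n q) \<le> e / 2"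
        using unif0[OF bounded_singleton[OF True], of "e / 2"] by auto
      then show "\<exists>M. \<forall>m\<ge>M. \<forall>n\<ge>M. norm (v m p - v n p) < e"
        using \<open>e > 0\<close> by (intro exI[of _ N]) force
    qed
    then have "convergent (\<lambda>n. v n p)" by (simp add: Cauchy_convergent_iff)
    then show ?thesis using True by (simp add: u_def convergent_LIMSEQ_iff)
  next
    case False
    then show ?thesis using H1_properties(1)[OF v] by (simp add: u_def)
  qed
  have unif: "\<exists>N. \<forall>n\<ge>N. \<forall>p\<in>B. cmod (v n p - u p) \<le> \<epsilon>"
    if B: "graph_bounded G B" and \<epsilon>: "\<epsilon> > 0" for B \<epsilon>
  proof -
    obtain N where N: "\<forall>m\<ge>N. \<forall>n\<ge>N. \<forall>p\<in>B. cmod (v m p - v n p) \<le> \<epsilon>" using unif0[OF B \<epsilon>] by blast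
    have "cmod (v n p - u p) \<le> \<epsilon>" if "n \<ge> N" "p \<in> B" for n p
    proof (rule Lim_bounded)
      show "(\<lambda>k. cmod (v n p - v k p)) \<longlonglongrightarrow> cmod (v n p - u p)"
        by (intro tendsto_intros lim_u)
      show "\<forall>k\<ge>N. cmod (v n p - v k p) \<le> \<epsilon>" using N that by blast
    qed
    then show ?thesis by blast
  qed
  have cu: "cont_graph u"
    unfolding cont_graph_def continuous_map_graph
  proof (intro ballI allI impI)
    fix p \<epsilon> assume p: "p \<in> X" and \<epsilon>: "(\<epsilon>::real) > 0"
    obtain N where N: "\<And>q. q \<in> X \<Longrightarrow> dG p q < 1 \<Longrightarrow> cmod (v N q - u q) \<le> \<epsilon> / 4"
      using unif[OF bounded_ball[OF p, of 1], of "\<epsilon> / 4"] \<epsilon> by auto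
    obtain d where d: "d > 0" "\<And>q. q \<in> X \<Longrightarrow> dG p q < d \<Longrightarrow> cmod (v N p - v N q) < \<epsilon> / 4"
      using H1_properties(2)[OF v, of N] p \<epsilon> unfolding cont_graph_def continuous_map_graph
      by (metis divide_pos_pos zero_less_numeral)
    show "\<exists>d>0. \<forall>q\<in>X. dG p q < d \<longrightarrow> cmod (u p - u q) < \<epsilon>"
    proof (intro exI[of _ "min d 1"] conjI ballI impI)
      fix q assume q: "q \<in> X" "dG p q < min d 1"
      have "u p - u q = - (v N p - u p) + (v N p - v N q) + (v N q - u q)" by simp
      then have "cmod (u p - u q) \<le> cmod (v N p - u p) + cmod (v N p - v N q) + cmod (v N q - u q)"
        using norm_triangle_ineq[of "- (v N p - u p) + (v N p - v N q)" "v N q - u q"]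
          norm_triangle_ineq[of "- (v N p - u p)" "v N p - v N q"] by (simp only: norm_minus_cancel)
      moreover have "dG p p < 1" using dist_self[OF p] by simp
      ultimately show "cmod (u p - u q) < \<epsilon>"
        using N[OF p] N[OF q(1)] d(2)[OF q(1)] q \<epsilon> by simp
    qed (use d in simp)
  qed
  have mD [measurable]: "Dmag (v n) \<in> borel_measurable gm" for n by (rule H1_properties(3)[OF v])
  have mU [measurable]: "val (v n) \<in> borel_measurable gm" for n by (rule H1_properties(4)[OF v])
  have mUu [measurable]: "val u \<in> borel_measurable gm" by (rule val_measurable[OF cu])
  have aeD: "AE p in gm. Dmag (\<lambda>p. v m p - v n p) p = Dmag (v m) p - Dmag (v n) p" for m n
    by (rule Dmag_diff[OF v v])
  \<comment> \<open>the limit of the magnetic derivatives exists almost everywhere; elsewhere \<open>lim\<close> is an unspecified number\<close>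
  define d where "d p = lim (\<lambda>n. Dmag (v n) p)" for p
  have md [measurable]: "d \<in> borel_measurable gm" unfolding d_def by measurable
  have conv: "AE p in gm. (\<lambda>n. Dmag (v n) p) \<longlonglongrightarrow> d p"
  proof -
    have "AE p in gm. convergent (\<lambda>n. Dmag (v n) p)"
    proof (rule AE_convergent_if_square_sums)
      fix n
      have "(\<integral>\<^sup>+p. ennreal ((cmod (Dmag (v (Suc n)) p - Dmag (v n) p))\<^sup>2) \<partial>gm)
        \<le> (\<integral>\<^sup>+p. ennreal ((cmod (Dmag (\<lambda>p. v (Suc n) p - v n p) p))\<^sup>2 + pot p * (cmod (val (\<lambda>p. v (Suc n) p - v n p) p))\<^sup>2) \<partial>gm)"
        using aeD[of "Suc n" n] AE_space[of gm]
        by (intro nn_integral_mono_AE, eventually_elim) (auto intro!: ennreal_leI simp: pot_nonneg)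
      also have "\<dots> = ennreal (energy (\<lambda>p. v (Suc n) p - v n p))" by (rule energy_nn[OF H1_diff[OF v v]])
      also have "\<dots> \<le> ennreal ((1/8) ^ n)" by (intro ennreal_leI fast)
      finally show "(\<integral>\<^sup>+p. ennreal ((cmod (Dmag (v (Suc n)) p - Dmag (v n) p))\<^sup>2) \<partial>gm) \<le> ennreal ((1/8) ^ n)" .
    qed (rule mD)
    then show ?thesis by eventually_elim (simp add: d_def convergent_LIMSEQ_iff)
  qed
  have d_out: "d (e, x) = 0" if "x \<notin> I e" for e x
    using that by (simp add: d_def Dmag_def zext_def)
  have lim_U: "(\<lambda>n. val (v n) p) \<longlonglongrightarrow> val u p" for p
    unfolding val_def zext_def on_edge_def by (intro tendsto_intros lim_u)
  \<comment> \<open>the squared distance of \<open>v n\<close> to the pair \<open>(d, u)\<close>, before \<open>d\<close> is known to be the magnetic derivative of \<open>u\<close>\<close>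
  define E where "E n p = (cmod (Dmag (v n) p - d p))\<^sup>2 + pot p * (cmod (val (v n) p - val u p))\<^sup>2" for n p
  have mE [measurable]: "E n \<in> borel_measurable gm" for n unfolding E_def by measurable
  have E_nonneg: "E n p \<ge> 0" if "p \<in> space gm" for n p using pot_nonneg[OF that] by (simp add: E_def)
  have E_bound: "\<exists>N. \<forall>n\<ge>N. (\<integral>\<^sup>+p. ennreal (E n p) \<partial>gm) \<le> ennreal (\<epsilon>\<^sup>2)" if \<epsilon>: "\<epsilon> > 0" for \<epsilon>
  proof -
    obtain N where N: "\<And>m n. m \<ge> N \<Longrightarrow> n \<ge> N \<Longrightarrow> sqrt (energy (\<lambda>p. v m p - v n p)) < \<epsilon>"
      using cau[OF \<epsilon>] by blast
    have "(\<integral>\<^sup>+p. ennreal (E n p) \<partial>gm) \<le> ennreal (\<epsilon>\<^sup>2)" if n: "n \<ge> N" for n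
    proof (rule Fatou_bound[where K=N])
      let ?F = "\<lambda>k p. (cmod (Dmag (v n) p - Dmag (v k) p))\<^sup>2 + pot p * (cmod (val (v n) p - val (v k) p))\<^sup>2"
      show "?F k \<in> borel_measurable gm" for k by measurable
      show "AE p in gm. (\<lambda>k. ?F k p) \<longlonglongrightarrow> E n p"
        using conv by eventually_elim (auto simp: E_def intro!: tendsto_intros lim_U)
      fix k assume k: "k \<ge> N"
      have "(\<integral>\<^sup>+p. ennreal (?F k p) \<partial>gm) = (\<integral>\<^sup>+p. ennreal ((cmod (Dmag (\<lambda>p. v n p - v k p) p))\<^sup>2 + pot p * (cmod (val (\<lambda>p. v n p - v k p) p))\<^sup>2) \<partial>gm)"
        using aeD[of n k] by (intro nn_integral_cong_AE, eventually_elim) (simp add: val_diff)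
      also have "\<dots> = ennreal (energy (\<lambda>p. v n p - v k p))" by (rule energy_nn[OF H1_diff[OF v v]])
      also have "\<dots> \<le> ennreal (\<epsilon>\<^sup>2)"
        using power_mono[OF less_imp_le[OF N[OF n k]], of 2] energy_nonneg by (intro ennreal_leI) simp
      finally show "(\<integral>\<^sup>+p. ennreal (?F k p) \<partial>gm) \<le> ennreal (\<epsilon>\<^sup>2)" .
    qed
    then show ?thesis by blast
  qed
  have E_int: "integrable gm (E n) \<and> (\<integral>p. E n p \<partial>gm) \<le> \<epsilon>\<^sup>2"
    if le: "(\<integral>\<^sup>+p. ennreal (E n p) \<partial>gm) \<le> ennreal (\<epsilon>\<^sup>2)" for n \<epsilon>
  proof
    have nE: "AE p in gm. 0 \<le> E n p" by (rule AE_I2) (rule E_nonneg)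
    show i: "integrable gm (E n)"
      by (rule integrableI_nonneg[OF mE nE]) (use le in \<open>simp add: order_le_less_trans\<close>)
    show "(\<integral>p. E n p \<partial>gm) \<le> \<epsilon>\<^sup>2"
      using le nn_integral_eq_integral[OF i nE] by (simp add: ennreal_le_iff)
  qed
  obtain N0 where "(\<integral>\<^sup>+p. ennreal (E N0 p) \<partial>gm) \<le> ennreal (1\<^sup>2)" using E_bound[of 1] by auto
  then have iE0: "integrable gm (E N0)" using E_int by blast
  have split: "(cmod b)\<^sup>2 \<le> 2 * (cmod a)\<^sup>2 + 2 * (cmod (a - b))\<^sup>2" for a b :: complex
    using cmod_add_square_le[of a "b - a"] by (simp add: norm_minus_commute)
  have id2: "integrable gm (\<lambda>p. (cmod (d p))\<^sup>2)"
  proof (rule Bochner_Integration.integrable_bound)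
    show "integrable gm (\<lambda>p. 2 * (cmod (Dmag (v N0) p))\<^sup>2 + 2 * E N0 p)" using H1_properties(5)[OF v] iE0 by simp
    show "AE p in gm. norm ((cmod (d p))\<^sup>2) \<le> norm (2 * (cmod (Dmag (v N0) p))\<^sup>2 + 2 * E N0 p)"
    proof (rule AE_I2)
      fix p assume p: "p \<in> space gm"
      have "(cmod (d p))\<^sup>2 \<le> 2 * (cmod (Dmag (v N0) p))\<^sup>2 + 2 * E N0 p"
        using split[of "d p" "Dmag (v N0) p"]
          mult_nonneg_nonneg[OF pot_nonneg[OF p], of "(cmod (val (v N0) p - val u p))\<^sup>2"]
        by (simp add: E_def)
      then show "norm ((cmod (d p))\<^sup>2) \<le> norm (2 * (cmod (Dmag (v N0) p))\<^sup>2 + 2 * E N0 p)" by simp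
    qed
  qed measurable
  have iU2: "integrable gm (\<lambda>p. pot p * (cmod (val u p))\<^sup>2)"
  proof (rule Bochner_Integration.integrable_bound)
    show "integrable gm (\<lambda>p. 2 * (pot p * (cmod (val (v N0) p))\<^sup>2) + 2 * E N0 p)" using H1_properties(6)[OF v] iE0 by simp
    show "AE p in gm. norm (pot p * (cmod (val u p))\<^sup>2) \<le> norm (2 * (pot p * (cmod (val (v N0) p))\<^sup>2) + 2 * E N0 p)"
    proof (rule AE_I2)
      fix p assume p: "p \<in> space gm"
      have "pot p * (cmod (val u p))\<^sup>2 \<le> pot p * (2 * (cmod (val (v N0) p))\<^sup>2 + 2 * (cmod (val (v N0) p - val u p))\<^sup>2)"
        by (intro mult_left_mono split pot_nonneg p)
      also have "\<dots> \<le> 2 * (pot p * (cmod (val (v N0) p))\<^sup>2) + 2 * E N0 p" by (simp add: E_def algebra_simps)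
      finally show "norm (pot p * (cmod (val u p))\<^sup>2) \<le> norm (2 * (pot p * (cmod (val (v N0) p))\<^sup>2) + 2 * E N0 p)"
        using pot_nonneg[OF p] by simp
    qed
  qed measurable
  have wd: "has_weak_deriv (interior (I e)) (on_edge G u e)
      (\<lambda>x. \<i> * (d (e, x) + complex_of_real (Ae e x) * on_edge G u e x))" if e: "e \<in> edges G" for e
  proof (rule magnetic_weak_deriv_limit[OF e v cu])
    show "\<exists>N. \<forall>n\<ge>N. \<forall>x\<in>seg e R. cmod (on_edge G (v n) e x - on_edge G u e x) \<le> \<epsilon>" if "\<epsilon> > 0" for R \<epsilon>
      using unif[OF seg_bounded[OF e, of R] that] by (auto simp: on_edge_def)
    show "(\<lambda>x. d (e, x)) \<in> borel_measurable lebesgue" "integrable lebesgue (\<lambda>x. (cmod (d (e, x)))\<^sup>2)"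
      using measurable_section[OF md e] integral_section_le(1)[OF id2 _ e] by simp_all
    fix \<epsilon> :: real assume "\<epsilon> > 0"
    then obtain N where N: "\<And>n. n \<ge> N \<Longrightarrow> (\<integral>\<^sup>+p. ennreal (E n p) \<partial>gm) \<le> ennreal (\<epsilon>\<^sup>2)" using E_bound by blast
    have "integrable lebesgue (\<lambda>x. (cmod (Dmag (v n) (e, x) - d (e, x)))\<^sup>2) \<and>
        (\<integral>x. (cmod (Dmag (v n) (e, x) - d (e, x)))\<^sup>2 \<partial>lebesgue) \<le> \<epsilon>\<^sup>2" if n: "n \<ge> N" for n
    proof -
      note E = E_int[OF N[OF n]]
      have i2: "integrable gm (\<lambda>p. (cmod (Dmag (v n) p - d p))\<^sup>2)"
        by (rule Bochner_Integration.integrable_bound[of gm "E n"])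
           (use E pot_nonneg in \<open>auto intro!: AE_I2 simp: E_def\<close>)
      have "(\<integral>p. (cmod (Dmag (v n) p - d p))\<^sup>2 \<partial>gm) \<le> (\<integral>p. E n p \<partial>gm)"
      proof (rule integral_mono[OF i2])
        show "(cmod (Dmag (v n) p - d p))\<^sup>2 \<le> E n p" if "p \<in> space gm" for p
          using pot_nonneg[OF that] by (simp add: E_def)
      qed (use E in blast)
      then show ?thesis using E integral_section_le[OF i2 _ e] by auto
    qed
    then show "\<exists>N. \<forall>n\<ge>N. integrable lebesgue (\<lambda>x. (cmod (Dmag (v n) (e, x) - d (e, x)))\<^sup>2) \<and>
        (\<integral>x. (cmod (Dmag (v n) (e, x) - d (e, x)))\<^sup>2 \<partial>lebesgue) \<le> \<epsilon>\<^sup>2" by blast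
  qed
  have aeDu: "AE p in gm. Dmag u p = d p"
  proof -
    have "AE p in gm. indicator (I (fst p)) (snd p) *\<^sub>R magnetic_deriv G A u (fst p) (snd p) = indicator (I (fst p)) (snd p) *\<^sub>R d (fst p, snd p)"
      by (rule AE_gm, rule magnetic_deriv_AE_unique[OF _ wd])
    then show ?thesis
      by eventually_elim (use d_out in \<open>auto simp: Dmag_def zext_def indicator_def split: if_splits\<close>)
  qed
  have mDu: "Dmag u \<in> borel_measurable gm" by (rule Dmag_measurable_AE[OF md aeDu])
  have "integrable gm (\<lambda>p. (cmod (Dmag u p))\<^sup>2)"
  proof (rule integrable_cong_AE_imp[OF id2])
    show "(\<lambda>p. (cmod (Dmag u p))\<^sup>2) \<in> borel_measurable gm" using mDu by measurable
    show "AE p in gm. (cmod (d p))\<^sup>2 = (cmod (Dmag u p))\<^sup>2" using aeDu by eventually_elim simp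
  qed
  then have uH: "u \<in> H1"
    using cu mDu iU2 wd by (auto simp: H1_iff weakly_differentiable_def u_def)
  have "\<exists>N. \<forall>n\<ge>N. sqrt (energy (\<lambda>p. v n p - u p)) \<le> \<epsilon>" if \<epsilon>: "\<epsilon> > 0" for \<epsilon>
  proof -
    obtain N where N: "\<And>n. n \<ge> N \<Longrightarrow> (\<integral>\<^sup>+p. ennreal (E n p) \<partial>gm) \<le> ennreal (\<epsilon>\<^sup>2)" using E_bound[OF \<epsilon>] by blast
    have "sqrt (energy (\<lambda>p. v n p - u p)) \<le> \<epsilon>" if n: "n \<ge> N" for n
    proof -
      have "ennreal (energy (\<lambda>p. v n p - u p)) = (\<integral>\<^sup>+p. ennreal (E n p) \<partial>gm)"
        unfolding energy_nn[OF H1_diff[OF v uH], symmetric]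
        using Dmag_diff[OF v uH, of n] aeDu
        by (intro nn_integral_cong_AE, eventually_elim) (simp add: E_def val_diff)
      also have "\<dots> \<le> ennreal (\<epsilon>\<^sup>2)" by (rule N[OF n])
      finally have "energy (\<lambda>p. v n p - u p) \<le> \<epsilon>\<^sup>2" by (simp add: ennreal_le_iff)
      then show ?thesis using \<epsilon> by (intro real_le_lsqrt) auto
    qed
    then show ?thesis by blast
  qed
  with uH show ?thesis by blast
qed

end

section \<open>Separability\<close>

context loc_finite_graph
begin

definition dense_points :: "('v, 'e) point set" where
  "dense_points = (\<Union>e\<in>edges G. edge_point G e ` (edge_interval G e \<inter> \<rat>))"

lemma countable_dense_points: "countable dense_points"
  unfolding dense_points_def
  by (intro countable_UN countable_edges countable_image) (auto intro: countable_subset[OF _ countable_rat])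

lemma dense_points_subset: "dense_points \<subseteq> X"
  by (auto simp: dense_points_def edge_point_in_graph)

lemma zero_if_zero_on_dense_points:
  assumes c: "continuous_map (graph_topology G) euclidean (u :: ('v, 'e) point \<Rightarrow> complex)"
    and z: "\<And>p. p \<in> dense_points \<Longrightarrow> u p = 0" and p: "p \<in> X"
  shows "u p = 0"
proof -
  obtain e x where e: "e \<in> edges G" "x \<in> edge_interval G e" "p = edge_point G e x"
    using p by (auto simp: graph_points_def)
  have "max x 1 > 0" by simp
  then obtain r where r: "r > 0" "seg e (max x 1) = {0..r}" using seg_eq[OF e(1)] by metis
  have x: "x \<in> {0..r}" using e(2) unfolding r(2)[symmetric] by (auto simp: seg_def edge_interval_def)
  have sub: "{0..r} \<subseteq> edge_interval G e" unfolding r(2)[symmetric] by (auto simp: seg_def)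
  have "closure ({0<..<r} \<inter> \<rat>) = closure {0<..<r}"
    by (rule closure_open_Int_superset) (auto simp: Rats_closure_real)
  then have cl: "closure ({0<..<r} \<inter> \<rat>) = {0..r}" using r(1) by simp
  have "on_edge G u e x = 0"
  proof (rule continuous_constant_on_closure[where f="on_edge G u e" and S="{0<..<r} \<inter> \<rat>"])
    show "continuous_on (closure ({0<..<r} \<inter> \<rat>)) (on_edge G u e)"
      unfolding cl by (rule continuous_on_subset[OF on_edge_continuous[OF c e(1)] sub])
    show "x \<in> closure ({0<..<r} \<inter> \<rat>)" using x cl by simp
    show "on_edge G u e y = 0" if "y \<in> {0<..<r} \<inter> \<rat>" for y
      unfolding on_edge_def
      by (rule z) (use that e sub in \<open>force simp: dense_points_def\<close>)
  qed
  then show ?thesis by (simp add: on_edge_def e)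
qed

end

context magnetic_graph
begin

text \<open>
  A Cauchy sequence converges as soon as a subsequence does; the subsequence is chosen so that consecutive
  distances decay at the rate that \<open>limit_in_H1\<close> requires.
\<close>

lemma hilbert_space: "complex_hilbert_space (\<lambda>c u p. c * u p) H1 (H1A_inner G A V)"
proof -
  interpret ips: complex_inner_product_space "\<lambda>c u p. c * u p" H1 "H1A_inner G A V" by (rule inner_space)
  have dist: "ips.ip_dist u v = sqrt (energy (\<lambda>p. u p - v p))" if "u \<in> H1" "v \<in> H1" for u v
    using that energy_eq[OF H1_diff[OF that]] by (simp add: ips.ip_dist_def fun_diff_def)
  show ?thesis
  proof (unfold_locales)
    show "ips.mcomplete"
      unfolding ips.mcomplete_def
    proof (intro allI impI)
      fix \<sigma> assume \<sigma>: "ips.MCauchy \<sigma>"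
      then have \<sigma>H: "\<sigma> n \<in> H1" for n by (auto simp: ips.MCauchy_def)
      have cau: "\<exists>N. \<forall>m\<ge>N. \<forall>n\<ge>N. ips.ip_dist (\<sigma> m) (\<sigma> n) < \<epsilon>" if "\<epsilon> > 0" for \<epsilon>
        using conjunct2[OF \<sigma>[unfolded ips.MCauchy_def], rule_format, OF that] by metis
      have "\<forall>k. \<exists>N. \<forall>m\<ge>N. \<forall>n\<ge>N. ips.ip_dist (\<sigma> m) (\<sigma> n) < sqrt ((1/8) ^ k)"
      proof
        fix k
        have "sqrt ((1/8) ^ k) > (0::real)" by simp
        from cau[OF this] show "\<exists>N. \<forall>m\<ge>N. \<forall>n\<ge>N. ips.ip_dist (\<sigma> m) (\<sigma> n) < sqrt ((1/8) ^ k)" .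
      qed
      then obtain f where f: "\<And>k m n. m \<ge> f k \<Longrightarrow> n \<ge> f k \<Longrightarrow> ips.ip_dist (\<sigma> m) (\<sigma> n) < sqrt ((1/8) ^ k)"
        by metis
      \<comment> \<open>the sums make the choice strictly increasing while staying above \<open>f\<close>\<close>
      define r where "r k = (\<Sum>i\<le>k. Suc (f i))" for k
      have r: "strict_mono r" by (rule strict_monoI_Suc) (simp add: r_def)
      have rf: "f k \<le> r k" for k
      proof -
        have "Suc (f k) \<le> r k" unfolding r_def by (rule member_le_sum) auto
        then show ?thesis by simp
      qed
      have "\<exists>u\<in>H1. \<forall>\<epsilon>>0. \<exists>N. \<forall>n\<ge>N. sqrt (energy (\<lambda>p. \<sigma> (r n) p - u p)) \<le> \<epsilon>"
      proof (rule limit_in_H1)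
        show "energy (\<lambda>p. \<sigma> (r (Suc n)) p - \<sigma> (r n) p) \<le> (1/8) ^ n" for n
        proof -
          have "r n \<le> r (Suc n)" using r by (simp add: strict_mono_less_eq)
          then have "ips.ip_dist (\<sigma> (r (Suc n))) (\<sigma> (r n)) < sqrt ((1/8) ^ n)"
            by (intro f order_trans[OF rf]) auto
          then show ?thesis by (simp add: dist[OF \<sigma>H \<sigma>H])
        qed
        show "\<exists>N. \<forall>m\<ge>N. \<forall>n\<ge>N. sqrt (energy (\<lambda>p. \<sigma> (r m) p - \<sigma> (r n) p)) < \<epsilon>" if e: "\<epsilon> > 0" for \<epsilon>
        proof -
          obtain N where N: "\<And>m n. m \<ge> N \<Longrightarrow> n \<ge> N \<Longrightarrow> ips.ip_dist (\<sigma> m) (\<sigma> n) < \<epsilon>" using cau[OF e] by metis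
          have "r n \<ge> N" if "n \<ge> N" for n using that seq_suble[OF r, of n] by simp
          then show ?thesis using N by (auto simp: dist[OF \<sigma>H \<sigma>H] intro!: exI[of _ N])
        qed
      qed (rule \<sigma>H)
      then obtain u where u: "u \<in> H1" "\<And>\<epsilon>. \<epsilon> > 0 \<Longrightarrow> \<exists>N. \<forall>n\<ge>N. sqrt (energy (\<lambda>p. \<sigma> (r n) p - u p)) \<le> \<epsilon>"
        by blast
      have "limitin ips.mtopology (\<sigma> \<circ> r) u sequentially"
        unfolding ips.limit_metric_sequentially
      proof (intro conjI allI impI)
        fix \<epsilon> :: real assume "\<epsilon> > 0"
        then obtain N where N: "\<And>n. n \<ge> N \<Longrightarrow> sqrt (energy (\<lambda>p. \<sigma> (r n) p - u p)) \<le> \<epsilon> / 2"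
          using u(2)[of "\<epsilon> / 2"] by auto
        have "ips.ip_dist (\<sigma> (r n)) u < \<epsilon>" if "n \<ge> N" for n
          using N[OF that] \<open>\<epsilon> > 0\<close> by (simp add: dist[OF \<sigma>H u(1)])
        then show "\<exists>N. \<forall>n\<ge>N. (\<sigma> \<circ> r) n \<in> H1 \<and> ips.ip_dist ((\<sigma> \<circ> r) n) u < \<epsilon>"
          using \<sigma>H by auto
      qed (rule u)
      from ips.MCauchy_convergent_subsequence[OF \<sigma> r this]
      show "\<exists>x. limitin ips.mtopology \<sigma> x sequentially" by blast
    qed
  qed
qed

theorem separable_hilbert_space: "separable_complex_hilbert_space (\<lambda>c u p. c * u p) H1 (H1A_inner G A V)"
proof -
  interpret hs: complex_hilbert_space "\<lambda>c u p. c * u p" H1 "H1A_inner G A V" by (rule hilbert_space)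
  have nrm: "hs.nrm u = sqrt (energy u)" if "u \<in> H1" for u by (simp add: hs.nrm_def energy_eq[OF that])
  show ?thesis
  proof (unfold_locales)
    show "separable_space hs.mtopology"
    proof (rule hs.separable_if_separating_functionals[where l="\<lambda>p u. u p" and P=dense_points])
      show "countable dense_points" by (rule countable_dense_points)
      show "(u + v) p = u p + v p" for p and u v :: "('v, 'e) point \<Rightarrow> complex" by simp
      show "\<exists>C. \<forall>u\<in>H1. cmod (u p) \<le> C * hs.nrm u" if "p \<in> dense_points" for p
      proof -
        have "p \<in> X" using that dense_points_subset by blast
        from evaluation_bounded_on_bounded_sets[OF bounded_singleton[OF this]] obtain C
          where "\<forall>u\<in>H1. \<forall>q\<in>{p}. cmod (u q) \<le> C * sqrt (energy u)" by blast
        then show ?thesis by (intro exI[of _ C]) (simp add: nrm)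
      qed
      show "u = 0" if u: "u \<in> H1" and z: "\<And>p. p \<in> dense_points \<Longrightarrow> u p = 0" for u
      proof
        fix p
        show "u p = 0 p"
          using zero_if_zero_on_dense_points[OF H1_properties(2)[OF u, unfolded cont_graph_def] z] H1_properties(1)[OF u]
          by (cases "p \<in> X") auto
      qed
    qed simp
  qed
qed

end

theorem lemma2p1:
  fixes G :: "('v, 'e) metric_graph"
    and A V :: "('v, 'e) point \<Rightarrow> real"
  assumes "wf_metric_graph G" and "connected_metric_graph G" and "locally_finite_graph G"
    and "\<forall>p\<in>graph_points G. 1 \<le> V p"
    and "L2_loc G A" and "L1_loc G V"
  shows "separable_complex_hilbert_space (\<lambda>c u p. c * u p) (H1A G A V) (H1A_inner G A V)"
proof -
  interpret magnetic_graph G A V by unfold_locales (use assms in auto)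
  show ?thesis by (rule separable_hilbert_space)
qed

end
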